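(* Let $\beta>0$, $\gamma>0$ and $c<c_*=3(\beta^2\gamma/4)^{1/3}$. Then the set of ground states $\mathcal G(\beta,c,\gamma)$ is nonempty. Moreover, a function $\varphi\in\mathcal X$ belongs to $\mathcal G(\beta,c,\gamma)$ if and only if $\varphi\neq0$, $P(\varphi)=0$ and $S(\varphi)=J$, where $$J=\inf\{S(u):\ u\in\mathcal X,\ u\neq0,\ P(u)=0\}.$$
   Context: Fix $p>1$ and a $C^2$ function $f:\mathbb R\to\mathbb R$ homogeneous of degree $p$, i.e. $f(\lambda s)=\lambda^p f(s)$ for all $\lambda>0$ and $s\in\mathbb R$. Let $F$ be the antiderivative of $f$ with $F(0)=0$. Assume $F(s_0)<0$ for some $s_0\in\mathbb R$. The operators are defined as follows. $\mathcal H$ is the Hilbert transform (Fourier symbol $-i\,\mathrm{sgn}\,\xi$). $D_x^{1/2}$ is the Fourier multiplier with symbol $|\xi|^{1/2}$. $\partial_x^{-1}$ is the Fourier multiplier with symbol $(i\xi)^{-1}$, and $\partial_x^{-2}=(\partial_x^{-1})^2$. Let $\mathcal X=\{u\in H^{1/2}(\mathbb R):\partial_x^{-1}u\in L^2(\mathbb R)\}$, with norm $\|u\|_{\mathcal X}=\|u\|_{H^{1/2}}+\|\partial_x^{-1}u\|_{L^2}$. A solitary wave is a function $\varphi\in\mathcal X$ satisfying, in the distributional sense, $$\beta\mathcal H\varphi_x-c\varphi+f(\varphi)=\gamma\partial_x^{-2}\varphi.$$ Functionals on $\mathcal X$: - $I(u;\beta,c,\gamma)=\int_{\mathbb R}\big(\beta(D_x^{1/2}u)^2-cu^2+\gamma(\partial_x^{-1}u)^2\big)dx$;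 - $K(u)=-(p+1)\int_{\mathbb R}F(u)\,dx$; - $E(u)=\int_{\mathbb R}\big(\frac\beta2(D_x^{1/2}u)^2+\frac\gamma2(\partial_x^{-1}u)^2+F(u)\big)dx$; - $Q(u)=\frac12\int_{\mathbb R}u^2dx$; - $S(u)=E(u)-cQ(u)=\frac12I(u;\beta,c,\gamma)-\frac1{p+1}K(u)$; - $P(u)=I(u;\beta,c,\gamma)-K(u)=\int_{\mathbb R}\big(-cu^2+\beta(D_x^{1/2}u)^2+\gamma(\partial_x^{-1}u)^2+(p+1)F(u)\big)dx$. Solitary waves are exactly the critical points of $S$. The set of ground states $\mathcal G(\beta,c,\gamma)$ is the set of nonzero solitary waves $\varphi$ such that $S(\varphi)\le S(\psi)$ for every nonzero solitary wave $\psi$ with the same $\beta,c,\gamma$. *)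

theory Defs
  imports "HOL-Analysis.Analysis"
begin

definition L2 :: "(real \<Rightarrow> real) \<Rightarrow> bool" where
  "L2 u \<longleftrightarrow> u \<in> borel_measurable lborel \<and> integrable lborel (\<lambda>x. (u x)\<^sup>2)"

definition fourier_trunc :: "(real \<Rightarrow> real) \<Rightarrow> real \<Rightarrow> real \<Rightarrow> complex" where
  "fourier_trunc u R \<xi> = (LINT x:{-R..R}|lborel. complex_of_real (u x) * cis (- (x * \<xi>)))"

definition is_FT :: "(real \<Rightarrow> real) \<Rightarrow> (real \<Rightarrow> complex) \<Rightarrow> bool" where
  "is_FT u g \<longleftrightarrow> L2 u \<and> g \<in> borel_measurable lborel \<and>
     integrable lborel (\<lambda>\<xi>. (cmod (g \<xi>))\<^sup>2) \<and>
     ((\<lambda>R. LINT \<xi>|lborel. (cmod (fourier_trunc u R \<xi> - g \<xi>))\<^sup>2) \<longlongrightarrow> 0) at_top"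

definition fmult :: "(real \<Rightarrow> complex) \<Rightarrow> (real \<Rightarrow> real) \<Rightarrow> (real \<Rightarrow> real) \<Rightarrow> bool" where
  "fmult m u v \<longleftrightarrow> (\<exists>g h. is_FT u g \<and> is_FT v h \<and> (AE \<xi> in lborel. h \<xi> = m \<xi> * g \<xi>))"

definition sym_Dhalf :: "real \<Rightarrow> complex" where
  "sym_Dhalf \<xi> = complex_of_real (sqrt \<bar>\<xi>\<bar>)"

definition sym_dinv :: "real \<Rightarrow> complex" where
  "sym_dinv \<xi> = 1 / (\<i> * complex_of_real \<xi>)"

text \<open>D_x^(1/2) u and the antiderivative operator (d/dx)^(-1) u (determined a.e.).\<close>
definition Dhalf :: "(real \<Rightarrow> real) \<Rightarrow> real \<Rightarrow> real" where
  "Dhalf u = (SOME v. fmult sym_Dhalf u v)"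

definition dinv :: "(real \<Rightarrow> real) \<Rightarrow> real \<Rightarrow> real" where
  "dinv u = (SOME v. fmult sym_dinv u v)"

definition H_half :: "(real \<Rightarrow> real) \<Rightarrow> bool" where
  "H_half u \<longleftrightarrow> (\<exists>g. is_FT u g \<and>
     integrable lborel (\<lambda>\<xi>. (1 + \<xi>\<^sup>2) powr (1/2) * (cmod (g \<xi>))\<^sup>2))"

definition in_X :: "(real \<Rightarrow> real) \<Rightarrow> bool" where
  "in_X u \<longleftrightarrow> H_half u \<and> (\<exists>w. fmult sym_dinv u w)"

definition nonzero :: "(real \<Rightarrow> real) \<Rightarrow> bool" where
  "nonzero u \<longleftrightarrow> \<not> (AE x in lborel. u x = 0)"

definition I_fun :: "real \<Rightarrow> real \<Rightarrow> real \<Rightarrow> (real \<Rightarrow> real) \<Rightarrow> real" where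
  "I_fun \<beta> c \<gamma> u = \<beta> * (LINT x|lborel. (Dhalf u x)\<^sup>2) - c * (LINT x|lborel. (u x)\<^sup>2)
      + \<gamma> * (LINT x|lborel. (dinv u x)\<^sup>2)"

definition K_fun :: "real \<Rightarrow> (real \<Rightarrow> real) \<Rightarrow> (real \<Rightarrow> real) \<Rightarrow> real" where
  "K_fun p F u = - (p + 1) * (LINT x|lborel. F (u x))"

definition S_fun :: "real \<Rightarrow> real \<Rightarrow> real \<Rightarrow> real \<Rightarrow> (real \<Rightarrow> real) \<Rightarrow> (real \<Rightarrow> real) \<Rightarrow> real" where
  "S_fun p \<beta> c \<gamma> F u = I_fun \<beta> c \<gamma> u / 2 - K_fun p F u / (p + 1)"

definition P_fun :: "real \<Rightarrow> real \<Rightarrow> real \<Rightarrow> real \<Rightarrow> (real \<Rightarrow> real) \<Rightarrow> (real \<Rightarrow> real) \<Rightarrow> real" where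
  "P_fun p \<beta> c \<gamma> F u = I_fun \<beta> c \<gamma> u - K_fun p F u"

text \<open>Solitary wave: weak (distributional) form of
  beta H phi_x - c phi + f(phi) = gamma (d/dx)^(-2) phi, tested against psi in X.\<close>
definition solitary :: "real \<Rightarrow> real \<Rightarrow> real \<Rightarrow> (real \<Rightarrow> real) \<Rightarrow> (real \<Rightarrow> real) \<Rightarrow> bool" where
  "solitary \<beta> c \<gamma> f \<phi> \<longleftrightarrow> in_X \<phi> \<and>
     (\<forall>\<psi>. in_X \<psi> \<longrightarrow>
        \<beta> * (LINT x|lborel. Dhalf \<phi> x * Dhalf \<psi> x) - c * (LINT x|lborel. \<phi> x * \<psi> x)
        + (LINT x|lborel. f (\<phi> x) * \<psi> x)
        = - \<gamma> * (LINT x|lborel. dinv \<phi> x * dinv \<psi> x))"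

definition ground_states :: "real \<Rightarrow> real \<Rightarrow> real \<Rightarrow> real \<Rightarrow> (real \<Rightarrow> real) \<Rightarrow> (real \<Rightarrow> real)
    \<Rightarrow> (real \<Rightarrow> real) set" where
  "ground_states p \<beta> c \<gamma> f F = {\<phi>. solitary \<beta> c \<gamma> f \<phi> \<and> nonzero \<phi> \<and>
     (\<forall>\<psi>. solitary \<beta> c \<gamma> f \<psi> \<and> nonzero \<psi> \<longrightarrow> S_fun p \<beta> c \<gamma> F \<phi> \<le> S_fun p \<beta> c \<gamma> F \<psi>)}"

definition J_inf :: "real \<Rightarrow> real \<Rightarrow> real \<Rightarrow> real \<Rightarrow> (real \<Rightarrow> real) \<Rightarrow> real" where
  "J_inf p \<beta> c \<gamma> F = Inf {S_fun p \<beta> c \<gamma> F u | u. in_X u \<and> nonzero u \<and> P_fun p \<beta> c \<gamma> F u = 0}"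

end

theory Submission
  imports Defs "HOL-Probability.Probability" "HOL-Complex_Analysis.Complex_Analysis" "HOL-Real_Asymp.Real_Asymp"
begin

text \<open>By Plancherel, \<open>2\<pi> I(u)\<close> is the integral of \<open>W |g|\<^sup>2\<close>, where \<open>g\<close> is the Fourier transform of \<open>u\<close> and
  \<open>W(\<xi>) = \<beta>|\<xi>| - c + \<gamma>/\<xi>\<^sup>2\<close>,
  and \<open>c < c\<^sub>*\<close> makes \<open>W\<close> bounded below by a positive multiple of \<open>1 + |\<xi>| + 1/\<xi>\<^sup>2\<close>; so \<open>I\<close> is the
  square of a Hilbert norm on the energy space. Since \<open>K\<close> is homogeneous of degree \<open>p + 1 > 2\<close>, minimising
  \<open>S\<close> on \<open>P = 0\<close> is, up to scaling, minimising \<open>I\<close> on \<open>K = 1\<close>. A minimising sequence does not vanish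
  (its low-frequency part would otherwise tend to zero uniformly, forcing \<open>K \<rightarrow> 0\<close>), so after
  translation it has a nonzero weak limit \<open>w\<close>. Both \<open>I\<close> and \<open>K\<close> split asymptotically between \<open>w\<close> and the
  remainder (the latter by the Brezis-Lieb argument); since \<open>1 < k\<^sup>\<theta> + (1 - k)\<^sup>\<theta>\<close> for
  \<open>\<theta> = 2/(p + 1)\<close> and \<open>0 < k < 1\<close>, no mass is lost and \<open>w\<close> is a minimiser. The first variation of
  \<open>I - m K\<^sup>\<theta>\<close> shows that every minimiser is a solitary wave; conversely testing
  the equation with \<open>\<phi>\<close> itself gives \<open>P(\<phi>) = 0\<close>, so the minimisers are exactly the ground states.\<close>

section \<open>Square-integrable functions\<close>

definition sqint :: "(real \<Rightarrow> complex) \<Rightarrow> bool" where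
  "sqint w \<longleftrightarrow> w \<in> borel_measurable lborel \<and> integrable lborel (\<lambda>x. (cmod (w x))\<^sup>2)"

definition nrm :: "(real \<Rightarrow> complex) \<Rightarrow> real" where
  "nrm w = sqrt (LINT x|lborel. (cmod (w x))\<^sup>2)"

lemma sqintD[measurable_dest]: "sqint w \<Longrightarrow> w \<in> borel_measurable borel"
  by (simp add: sqint_def)

lemma borel_measurable_cnj[measurable]: "cnj \<in> borel_measurable borel"
  by (intro borel_measurable_continuous_onI continuous_intros)

lemma sqint_integrable[simp]: "sqint w \<Longrightarrow> integrable lborel (\<lambda>x. (cmod (w x))\<^sup>2)"
  by (simp add: sqint_def)

lemma sqintI: "w \<in> borel_measurable lborel \<Longrightarrow> integrable lborel (\<lambda>x. (cmod (w x))\<^sup>2) \<Longrightarrow> sqint w"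
  by (simp add: sqint_def)

lemma nrm_nonneg[simp]: "0 \<le> nrm w"
  by (simp add: nrm_def)

lemma nrm_sq: "(nrm w)\<^sup>2 = (LINT x|lborel. (cmod (w x))\<^sup>2)"
  by (simp add: nrm_def)

lemma sqint_mono:
  assumes "sqint v" "w \<in> borel_measurable lborel" "AE x in lborel. cmod (w x) \<le> C * cmod (v x)"
  shows "sqint w"
proof (rule sqintI)
  show "integrable lborel (\<lambda>x. (cmod (w x))\<^sup>2)"
  proof (rule Bochner_Integration.integrable_bound[where f="\<lambda>x. C\<^sup>2 * (cmod (v x))\<^sup>2"])
    show "AE x in lborel. norm ((cmod (w x))\<^sup>2) \<le> norm (C\<^sup>2 * (cmod (v x))\<^sup>2)"
      using assms(3) by eventually_elim (simp add: power_mult_distrib[symmetric] power_mono)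
  qed (use assms in \<open>auto intro: sqint_integrable\<close>)
qed fact

lemma nrm_mono:
  assumes "sqint v" "w \<in> borel_measurable lborel" "AE x in lborel. cmod (w x) \<le> cmod (v x)"
  shows "nrm w \<le> nrm v"
  unfolding nrm_def
proof (rule real_sqrt_le_mono, rule integral_mono_AE)
  show "integrable lborel (\<lambda>x. (cmod (w x))\<^sup>2)"
    using sqint_mono[of v w 1] assms by (simp add: sqint_integrable)
  show "AE x in lborel. (cmod (w x))\<^sup>2 \<le> (cmod (v x))\<^sup>2"
    using assms(3) by eventually_elim (simp add: power_mono)
qed (use assms in \<open>auto intro: sqint_integrable\<close>)

lemma nrm_cong_AE:
  assumes "AE x in lborel. cmod (w x) = cmod (v x)" "w \<in> borel_measurable lborel" "v \<in> borel_measurable lborel"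
  shows "nrm w = nrm v"
  unfolding nrm_def
  by (rule arg_cong[of _ _ sqrt], rule integral_cong_AE) (use assms in auto)

lemma sqint_add: assumes "sqint u" "sqint v" shows "sqint (\<lambda>x. u x + v x)"
proof (rule sqintI)
  show "integrable lborel (\<lambda>x. (cmod (u x + v x))\<^sup>2)"
  proof (rule Bochner_Integration.integrable_bound)
    show "integrable lborel (\<lambda>x. 2 * (cmod (u x))\<^sup>2 + 2 * (cmod (v x))\<^sup>2)"
      using assms by simp
    have "(cmod (u x + v x))\<^sup>2 \<le> 2 * (cmod (u x))\<^sup>2 + 2 * (cmod (v x))\<^sup>2" for x
    proof -
      have "(cmod (u x + v x))\<^sup>2 \<le> (cmod (u x) + cmod (v x))\<^sup>2"
        by (simp add: norm_triangle_ineq power_mono)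
      also have "\<dots> \<le> 2 * (cmod (u x))\<^sup>2 + 2 * (cmod (v x))\<^sup>2"
        using sum_squares_bound[of "cmod (u x)" "cmod (v x)"] by (simp add: power2_sum)
      finally show ?thesis .
    qed
    then show "AE x in lborel. norm ((cmod (u x + v x))\<^sup>2) \<le> norm (2 * (cmod (u x))\<^sup>2 + 2 * (cmod (v x))\<^sup>2)"
      by (auto intro!: AE_I2)
  qed (use assms in measurable)
qed (use assms in measurable)

lemma sqint_cmult: assumes "sqint u" shows "sqint (\<lambda>x. c * u x)"
  by (rule sqint_mono[OF assms, where C="cmod c"]) (use assms in \<open>auto simp: norm_mult\<close>)

lemma sqint_diff: assumes "sqint u" "sqint v" shows "sqint (\<lambda>x. u x - v x)"
  using sqint_add[OF assms(1) sqint_cmult[OF assms(2), of "-1"]] by simp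

lemma sqint_cnj: assumes "sqint u" shows "sqint (\<lambda>x. cnj (u x))"
  by (rule sqint_mono[OF assms, where C=1]) (use assms in auto)

lemma sqint_norm: assumes "sqint u" shows "sqint (\<lambda>x. of_real (cmod (u x)))"
  by (rule sqint_mono[OF assms, where C=1]) (use assms in auto)

lemma sqint_indicator: assumes "sqint u" "A \<in> sets lborel" shows "sqint (\<lambda>x. indicator A x * u x)"
proof (rule sqint_mono[OF assms(1), where C=1])
  show "(\<lambda>x. indicator A x * u x) \<in> borel_measurable lborel"
    using assms by measurable
qed (simp add: indicator_def)

lemma nrm_cmult: "nrm (\<lambda>x. c * u x) = cmod c * nrm u"
  by (simp add: nrm_def norm_mult power_mult_distrib real_sqrt_mult)

lemma nrm_cnj[simp]: "nrm (\<lambda>x. cnj (u x)) = nrm u"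
  by (simp add: nrm_def)

lemma nrm_minus_commute: "nrm (\<lambda>x. u x - v x) = nrm (\<lambda>x. v x - u x)"
  by (simp add: nrm_def norm_minus_commute)

lemma nrm_eq_0:
  assumes "sqint w" "nrm w = 0" shows "AE x in lborel. w x = 0"
proof -
  have "(LINT x|lborel. (cmod (w x))\<^sup>2) = 0"
    using assms(2) by (metis nrm_sq power_zero_numeral)
  then have "AE x in lborel. (cmod (w x))\<^sup>2 = 0"
    using integral_nonneg_eq_0_iff_AE[OF sqint_integrable[OF assms(1)]] by simp
  then show ?thesis by simp
qed

lemma quadratic_form_Cauchy_Schwarz:
  fixes A B C :: real
  assumes "\<And>t. 0 \<le> A - 2 * t * C + t\<^sup>2 * B" "A \<ge> 0" "B \<ge> 0"
  shows "C \<le> sqrt A * sqrt B"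
proof (cases "B = 0")
  case True
  have "C \<le> 0"
  proof (rule ccontr)
    assume "\<not> C \<le> 0"
    then show False using assms(1)[of "(A + 1) / (2 * C)"] True by simp
  qed
  then show ?thesis using True by simp
next
  case False
  then have B: "B > 0" using assms by simp
  have "0 \<le> A - 2 * (C / B) * C + (C / B)\<^sup>2 * B" by (rule assms(1))
  also have "\<dots> = A - C\<^sup>2 / B" using B by (simp add: field_simps power2_eq_square)
  finally have "C\<^sup>2 \<le> A * B" using B by (simp add: field_simps)
  then have "\<bar>C\<bar> \<le> sqrt (A * B)" by (rule real_le_rsqrt[of "\<bar>C\<bar>", simplified])
  then show ?thesis by (simp add: real_sqrt_mult)
qed

lemma Cauchy_Schwarz_integrable:
  assumes "sqint u" "sqint v"
  shows "integrable lborel (\<lambda>x. cmod (u x) * cmod (v x))"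
proof (rule Bochner_Integration.integrable_bound)
  show "integrable lborel (\<lambda>x. (cmod (u x))\<^sup>2 + (cmod (v x))\<^sup>2)"
    using assms by simp
  have "cmod (u x) * cmod (v x) \<le> (cmod (u x))\<^sup>2 + (cmod (v x))\<^sup>2" for x
  proof -
    have "2 * (cmod (u x) * cmod (v x)) \<le> (cmod (u x))\<^sup>2 + (cmod (v x))\<^sup>2"
      using sum_squares_bound[of "cmod (u x)" "cmod (v x)"] by (simp add: mult.assoc)
    moreover have "0 \<le> cmod (u x) * cmod (v x)" by simp
    ultimately show ?thesis by linarith
  qed
  then show "AE x in lborel. norm (cmod (u x) * cmod (v x)) \<le> norm ((cmod (u x))\<^sup>2 + (cmod (v x))\<^sup>2)"
    by (auto intro!: AE_I2 simp: abs_mult)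
qed (use assms in measurable)

lemma sqint_mult_integrable:
  assumes "sqint u" "sqint v"
  shows "integrable lborel (\<lambda>x. u x * v x)"
  by (rule Bochner_Integration.integrable_bound[OF Cauchy_Schwarz_integrable[OF assms]])
     (use assms in \<open>auto simp: norm_mult\<close>)

lemma Cauchy_Schwarz:
  assumes "sqint u" "sqint v"
  shows "(LINT x|lborel. cmod (u x) * cmod (v x)) \<le> nrm u * nrm v"
  unfolding nrm_def
proof (rule quadratic_form_Cauchy_Schwarz)
  fix t :: real
  note [simp] = sqint_integrable[OF assms(1)] sqint_integrable[OF assms(2)] Cauchy_Schwarz_integrable[OF assms]
  have "0 \<le> (LINT x|lborel. (cmod (u x) - t * cmod (v x))\<^sup>2)" by simp
  also have "\<dots> = (LINT x|lborel. (cmod (u x))\<^sup>2 - 2 * t * (cmod (u x) * cmod (v x)) + t\<^sup>2 * (cmod (v x))\<^sup>2)"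
    by (simp add: power2_diff power_mult_distrib algebra_simps)
  also have "\<dots> = (LINT x|lborel. (cmod (u x))\<^sup>2) - 2 * t * (LINT x|lborel. cmod (u x) * cmod (v x))
      + t\<^sup>2 * (LINT x|lborel. (cmod (v x))\<^sup>2)"
    by simp
  finally show "0 \<le> \<dots>" .
qed simp_all

lemma integral_mult_bound:
  assumes "sqint u" "sqint v"
  shows "cmod (LINT x|lborel. u x * v x) \<le> nrm u * nrm v"
proof -
  have "cmod (LINT x|lborel. u x * v x) \<le> (LINT x|lborel. cmod (u x * v x))"
    by (rule integral_norm_bound)
  then show ?thesis using Cauchy_Schwarz[OF assms] by (simp add: norm_mult)
qed

lemma nrm_triangle:
  assumes "sqint u" "sqint v"
  shows "nrm (\<lambda>x. u x + v x) \<le> nrm u + nrm v"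
proof (rule power2_le_imp_le)
  note [simp] = sqint_integrable[OF assms(1)] sqint_integrable[OF assms(2)] Cauchy_Schwarz_integrable[OF assms]
  have "(nrm (\<lambda>x. u x + v x))\<^sup>2 \<le> (LINT x|lborel. (cmod (u x))\<^sup>2 + 2 * (cmod (u x) * cmod (v x)) + (cmod (v x))\<^sup>2)"
    unfolding nrm_sq
  proof (rule integral_mono)
    show "integrable lborel (\<lambda>x. (cmod (u x + v x))\<^sup>2)"
      using sqint_add[OF assms] by (rule sqint_integrable)
    fix x
    have "(cmod (u x + v x))\<^sup>2 \<le> (cmod (u x) + cmod (v x))\<^sup>2"
      by (simp add: norm_triangle_ineq power_mono)
    then show "(cmod (u x + v x))\<^sup>2 \<le> (cmod (u x))\<^sup>2 + 2 * (cmod (u x) * cmod (v x)) + (cmod (v x))\<^sup>2"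
      by (simp add: power2_sum)
  qed simp
  also have "\<dots> = (nrm u)\<^sup>2 + 2 * (LINT x|lborel. cmod (u x) * cmod (v x)) + (nrm v)\<^sup>2"
    by (simp add: nrm_sq)
  also have "\<dots> \<le> (nrm u + nrm v)\<^sup>2"
    using Cauchy_Schwarz[OF assms] by (simp add: power2_sum)
  finally show "(nrm (\<lambda>x. u x + v x))\<^sup>2 \<le> (nrm u + nrm v)\<^sup>2" .
qed simp

lemma nrm_triangle_via:
  assumes "sqint u" "sqint v" "sqint w"
  shows "nrm (\<lambda>x. u x - w x) \<le> nrm (\<lambda>x. u x - v x) + nrm (\<lambda>x. v x - w x)"
  using nrm_triangle[OF sqint_diff[OF assms(1,2)] sqint_diff[OF assms(2,3)]] by simp

lemma nrm_diff_ineq: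
  assumes "sqint u" "sqint v"
  shows "\<bar>nrm u - nrm v\<bar> \<le> nrm (\<lambda>x. u x - v x)"
  using nrm_triangle[OF sqint_diff[OF assms] assms(2)]
    nrm_triangle[OF sqint_diff[OF assms(2,1)] assms(1)] nrm_minus_commute[of u v] by simp

lemma cmod_diff_sq: "(cmod (a - b))\<^sup>2 = (cmod a)\<^sup>2 - 2 * Re (a * cnj b) + (cmod b)\<^sup>2"
  unfolding cmod_power2 by (simp add: power2_eq_square algebra_simps)

lemma nrm_diff_sq_expand:
  assumes "sqint u" "sqint v"
  shows "(nrm (\<lambda>x. u x - v x))\<^sup>2 = (nrm u)\<^sup>2 - 2 * Re (LINT x|lborel. u x * cnj (v x)) + (nrm v)\<^sup>2"
proof -
  note [simp] = sqint_integrable[OF assms(1)] sqint_integrable[OF assms(2)]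
    sqint_mult_integrable[OF assms(1) sqint_cnj[OF assms(2)]]
  have "(nrm (\<lambda>x. u x - v x))\<^sup>2 = (LINT x|lborel. (cmod (u x))\<^sup>2 - 2 * Re (u x * cnj (v x)) + (cmod (v x))\<^sup>2)"
    unfolding nrm_sq by (simp only: cmod_diff_sq)
  also have "\<dots> = (nrm u)\<^sup>2 - 2 * (LINT x|lborel. Re (u x * cnj (v x))) + (nrm v)\<^sup>2"
    using integrable_Re[OF sqint_mult_integrable[OF assms(1) sqint_cnj[OF assms(2)]]]
    by (simp add: nrm_sq del: times_complex.sel)
  also have "(LINT x|lborel. Re (u x * cnj (v x))) = Re (LINT x|lborel. u x * cnj (v x))"
    by (rule integral_Re) simp
  finally show ?thesis .
qed

lemma tendsto_nrm_dominated:
  fixes s :: "nat \<Rightarrow> real \<Rightarrow> complex"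
  assumes "\<And>n. s n \<in> borel_measurable lborel" "sqint v"
    "\<And>n. AE x in lborel. cmod (s n x) \<le> cmod (v x)" "AE x in lborel. (\<lambda>n. s n x) \<longlonglongrightarrow> 0"
  shows "(\<lambda>n. nrm (s n)) \<longlonglongrightarrow> 0"
proof -
  have "(\<lambda>n. LINT x|lborel. (cmod (s n x))\<^sup>2) \<longlonglongrightarrow> integral\<^sup>L lborel (\<lambda>x::real. 0::real)"
  proof (rule Bochner_Integration.integral_dominated_convergence[where w="\<lambda>x. (cmod (v x))\<^sup>2"])
    show "AE x in lborel. (\<lambda>n. (cmod (s n x))\<^sup>2) \<longlonglongrightarrow> 0"
      using assms(4) by eventually_elim (auto intro!: tendsto_eq_intros)
    show "AE x in lborel. norm ((cmod (s n x))\<^sup>2) \<le> (cmod (v x))\<^sup>2" for n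
      using assms(3)[of n] by eventually_elim (simp add: power_mono)
  qed (use assms in \<open>auto intro: sqint_integrable\<close>)
  then show ?thesis unfolding nrm_def using tendsto_real_sqrt by fastforce
qed

lemma nrm_Fatou:
  fixes s :: "nat \<Rightarrow> real \<Rightarrow> complex"
  assumes "\<And>n. sqint (s n)" "u \<in> borel_measurable lborel" "AE x in lborel. (\<lambda>n. s n x) \<longlonglongrightarrow> u x"
    "\<forall>\<^sub>F n in sequentially. nrm (s n) \<le> M"
  shows "sqint u \<and> nrm u \<le> M"
proof -
  obtain n where "nrm (s n) \<le> M" using eventually_happens'[OF sequentially_bot assms(4)] by blast
  then have M: "M \<ge> 0" using nrm_nonneg order_trans by blast
  note [measurable] = assms(2) sqintD[OF assms(1)]
  have "(\<integral>\<^sup>+x. ennreal ((cmod (u x))\<^sup>2) \<partial>lborel) = (\<integral>\<^sup>+x. liminf (\<lambda>n. ennreal ((cmod (s n x))\<^sup>2)) \<partial>lborel)"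
  proof (rule nn_integral_cong_AE)
    show "AE x in lborel. ennreal ((cmod (u x))\<^sup>2) = liminf (\<lambda>n. ennreal ((cmod (s n x))\<^sup>2))"
      using assms(3)
    proof eventually_elim
      fix x assume "(\<lambda>n. s n x) \<longlonglongrightarrow> u x"
      then have "(\<lambda>n. ennreal ((cmod (s n x))\<^sup>2)) \<longlonglongrightarrow> ennreal ((cmod (u x))\<^sup>2)"
        by (intro tendsto_intros)
      then show "ennreal ((cmod (u x))\<^sup>2) = liminf (\<lambda>n. ennreal ((cmod (s n x))\<^sup>2))"
        using lim_imp_Liminf[OF sequentially_bot] by metis
    qed
  qed
  also have "\<dots> \<le> liminf (\<lambda>n. \<integral>\<^sup>+x. ennreal ((cmod (s n x))\<^sup>2) \<partial>lborel)"
    by (rule nn_integral_liminf) measurable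
  also have "\<dots> \<le> ennreal (M\<^sup>2)"
  proof (rule Liminf_le)
    show "\<forall>\<^sub>F n in sequentially. (\<integral>\<^sup>+x. ennreal ((cmod (s n x))\<^sup>2) \<partial>lborel) \<le> ennreal (M\<^sup>2)"
      using assms(4)
    proof eventually_elim
      fix n assume "nrm (s n) \<le> M"
      have "(\<integral>\<^sup>+x. ennreal ((cmod (s n x))\<^sup>2) \<partial>lborel) = ennreal ((nrm (s n))\<^sup>2)"
        unfolding nrm_sq by (rule nn_integral_eq_integral) (use assms(1) in \<open>auto intro: sqint_integrable\<close>)
      then show "(\<integral>\<^sup>+x. ennreal ((cmod (s n x))\<^sup>2) \<partial>lborel) \<le> ennreal (M\<^sup>2)"
        using \<open>nrm (s n) \<le> M\<close> by (simp add: power_mono ennreal_leI)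
    qed
  qed simp
  finally have *: "(\<integral>\<^sup>+x. ennreal ((cmod (u x))\<^sup>2) \<partial>lborel) \<le> ennreal (M\<^sup>2)" .
  then have int: "integrable lborel (\<lambda>x. (cmod (u x))\<^sup>2)"
    by (intro integrableI_nonneg) (auto intro: le_less_trans)
  have "(\<integral>\<^sup>+x. ennreal ((cmod (u x))\<^sup>2) \<partial>lborel) = ennreal ((nrm u)\<^sup>2)"
    unfolding nrm_sq by (rule nn_integral_eq_integral[OF int]) simp
  with * have "ennreal ((nrm u)\<^sup>2) \<le> ennreal (M\<^sup>2)" by simp
  then have "(nrm u)\<^sup>2 \<le> M\<^sup>2" by (subst (asm) ennreal_le_iff) auto
  then have "nrm u \<le> M" using M by (rule power2_le_imp_le)
  then show ?thesis using sqintI[OF assms(2) int] by blast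
qed

lemma sqint_gauss: "sqint (\<lambda>x. of_real (exp (- x\<^sup>2 / 2)))"
proof (rule sqintI)
  have "integrable lborel (\<lambda>x::real. exp (- x\<^sup>2))"
    using has_bochner_integral_even_function[OF gaussian_moment_0] by (simp add: has_bochner_integral_iff)
  then show "integrable lborel (\<lambda>x. (cmod (complex_of_real (exp (- x\<^sup>2 / 2))))\<^sup>2)"
    by (simp add: power2_eq_square[of "exp _"] exp_add[symmetric])
qed simp

lemma sqint_complete:
  fixes s :: "nat \<Rightarrow> real \<Rightarrow> complex"
  assumes s: "\<And>n. sqint (s n)"
    and Cauchy: "\<And>e. e > 0 \<Longrightarrow> \<exists>N. \<forall>i\<ge>N. \<forall>j\<ge>N. nrm (\<lambda>x. s i x - s j x) < e"
  shows "\<exists>u. sqint u \<and> (\<lambda>n. nrm (\<lambda>x. s n x - u x)) \<longlonglongrightarrow> 0"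
proof -
  define G where "G = (\<lambda>x::real. complex_of_real (exp (- x\<^sup>2 / 2)))"
  have G: "sqint G" "\<And>x. G x \<noteq> 0" unfolding G_def using sqint_gauss by auto
  note [measurable] = sqintD[OF s] sqintD[OF G(1)]
  have "\<exists>N. \<forall>i\<ge>N. \<forall>j\<ge>N. LINT x|lborel. norm (s i x * G x - s j x * G x) < e" if "e > 0" for e
  proof -
    have "0 < e / (nrm G + 1)" using that by (simp add: add_nonneg_pos)
    from Cauchy[OF this]
    obtain N where N: "\<forall>i\<ge>N. \<forall>j\<ge>N. nrm (\<lambda>x. s i x - s j x) < e / (nrm G + 1)" by blast
    have "(LINT x|lborel. norm (s i x * G x - s j x * G x)) < e" if "i \<ge> N" "j \<ge> N" for i j
    proof -
      have "(LINT x|lborel. norm (s i x * G x - s j x * G x)) \<le> nrm (\<lambda>x. s i x - s j x) * nrm G"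
        using Cauchy_Schwarz[OF sqint_diff[OF s[of i] s[of j]] G(1)]
        by (simp add: norm_mult left_diff_distrib[symmetric])
      also have "\<dots> \<le> nrm (\<lambda>x. s i x - s j x) * (nrm G + 1)" by (simp add: mult_left_mono)
      also have "\<dots> < e" using N that by (simp add: pos_less_divide_eq add_nonneg_pos)
      finally show ?thesis .
    qed
    then show ?thesis by blast
  qed
  then obtain r where r: "strict_mono r" "AE x in lborel. Cauchy (\<lambda>i. s (r i) x * G x)"
    using cauchy_L1_AE_cauchy_subseq[of lborel "\<lambda>i x. s i x * G x"] sqint_mult_integrable[OF s G(1)] by blast
  define u where "u = (\<lambda>x. lim (\<lambda>i. s (r i) x))"
  have u_lim: "AE x in lborel. (\<lambda>i. s (r i) x) \<longlonglongrightarrow> u x"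
    using r(2)
  proof eventually_elim
    fix x assume "Cauchy (\<lambda>i. s (r i) x * G x)"
    then obtain l where "(\<lambda>i. s (r i) x * G x) \<longlonglongrightarrow> l" by (auto simp: Cauchy_convergent_iff convergent_def)
    then have "(\<lambda>i. s (r i) x * G x / G x) \<longlonglongrightarrow> l / G x" using G(2) by (intro tendsto_intros) auto
    then have "(\<lambda>i. s (r i) x) \<longlonglongrightarrow> l / G x" using G(2) by simp
    then show "(\<lambda>i. s (r i) x) \<longlonglongrightarrow> u x" unfolding u_def by (simp add: limI)
  qed
  have [measurable]: "u \<in> borel_measurable lborel" unfolding u_def by measurable
  have key: "sqint (\<lambda>x. s j x - u x) \<and> nrm (\<lambda>x. s j x - u x) \<le> e"
    if N: "\<forall>i\<ge>N. \<forall>j\<ge>N. nrm (\<lambda>x. s i x - s j x) < e" and j: "j \<ge> N" for e N j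
  proof (rule nrm_Fatou[where s="\<lambda>i x. s j x - s (r i) x"])
    show "sqint (\<lambda>x. s j x - s (r i) x)" for i by (rule sqint_diff[OF s s])
    show "AE x in lborel. (\<lambda>i. s j x - s (r i) x) \<longlonglongrightarrow> s j x - u x"
      using u_lim by eventually_elim (intro tendsto_intros)
    have "nrm (\<lambda>x. s j x - s (r i) x) \<le> e" if "i \<ge> N" for i
      using N j that seq_suble[OF r(1), of i] by (meson le_trans less_imp_le)
    then show "\<forall>\<^sub>F i in sequentially. nrm (\<lambda>x. s j x - s (r i) x) \<le> e"
      by (auto simp: eventually_sequentially)
  qed measurable
  obtain N1 where "\<forall>i\<ge>N1. \<forall>j\<ge>N1. nrm (\<lambda>x. s i x - s j x) < 1" using Cauchy[of 1] by auto
  from key[OF this, of N1] have "sqint (\<lambda>x. s N1 x - (s N1 x - u x))"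
    using s sqint_diff by blast
  then have "sqint u" by simp
  moreover have "(\<lambda>n. nrm (\<lambda>x. s n x - u x)) \<longlonglongrightarrow> 0"
  proof (rule LIMSEQ_I)
    fix e :: real assume "e > 0"
    then obtain N where N: "\<forall>i\<ge>N. \<forall>j\<ge>N. nrm (\<lambda>x. s i x - s j x) < e / 2" using Cauchy[of "e/2"] by auto
    show "\<exists>N. \<forall>n\<ge>N. norm (nrm (\<lambda>x. s n x - u x) - 0) < e"
    proof (intro exI[of _ N] allI impI)
      fix n assume "n \<ge> N"
      then have "nrm (\<lambda>x. s n x - u x) \<le> e / 2" using key[OF N] by blast
      then show "norm (nrm (\<lambda>x. s n x - u x) - 0) < e" using \<open>e > 0\<close> by simp
    qed
  qed
  ultimately show ?thesis by blast
qed

lemma nrm_limit_unique: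
  assumes "sqint u" "sqint v" "F \<noteq> bot" "\<And>i. sqint (s i)"
    "((\<lambda>i. nrm (\<lambda>x. s i x - u x)) \<longlongrightarrow> 0) F" "((\<lambda>i. nrm (\<lambda>x. s i x - v x)) \<longlongrightarrow> 0) F"
  shows "AE x in lborel. u x = v x"
proof -
  have "((\<lambda>i. nrm (\<lambda>x. s i x - u x) + nrm (\<lambda>x. s i x - v x)) \<longlongrightarrow> 0) F"
    using tendsto_add[OF assms(5,6)] by simp
  moreover have "nrm (\<lambda>x. u x - v x) \<le> nrm (\<lambda>x. s i x - u x) + nrm (\<lambda>x. s i x - v x)" for i
    using nrm_triangle_via[OF assms(1) assms(4)[of i] assms(2)] nrm_minus_commute[of "s i" u] by simp
  ultimately have "nrm (\<lambda>x. u x - v x) \<le> 0"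
    by (intro tendsto_lowerbound[OF _ _ assms(3)]) auto
  then have "nrm (\<lambda>x. u x - v x) = 0" by (simp add: order_antisym)
  then have "AE x in lborel. u x - v x = 0" using nrm_eq_0[OF sqint_diff[OF assms(1,2)]] by simp
  then show ?thesis by simp
qed

section \<open>Continuity of translations\<close>

lemma sqint_shift:
  assumes "sqint w" shows "sqint (\<lambda>x. w (x + t))" "nrm (\<lambda>x. w (x + t)) = nrm w"
proof -
  have "integrable lborel (\<lambda>x. (cmod (w (t + 1 * x)))\<^sup>2)"
    using lborel_integrable_real_affine[OF sqint_integrable[OF assms], of 1 t] by simp
  then show "sqint (\<lambda>x. w (x + t))"
    using sqintD[OF assms] by (intro sqintI) (simp_all add: add.commute)
  show "nrm (\<lambda>x. w (x + t)) = nrm w"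
    unfolding nrm_def
    using lborel_integral_real_affine[of 1 "\<lambda>x. (cmod (w x))\<^sup>2" t] by (simp add: add.commute)
qed

lemma sqint_bounded_interval:
  assumes "w \<in> borel_measurable lborel" "\<And>x. cmod (w x) \<le> C" "\<And>x. \<bar>x\<bar> > R \<Longrightarrow> w x = 0"
  shows "sqint w"
proof (rule sqint_mono[where v="indicator {-R..R}" and C=C])
  have "(\<lambda>x. (cmod (indicator {-R..R} x))\<^sup>2) = (indicator {-R..R} :: real \<Rightarrow> real)"
    by (auto simp: indicator_def)
  moreover have "integrable lborel (indicator {-R..R} :: real \<Rightarrow> real)"
    by (rule integrable_real_indicator) (auto simp: emeasure_lborel_Icc_eq)
  ultimately show "sqint (indicator {-R..R})"
    by (intro sqintI) simp_all
  have "cmod (w x) \<le> C * cmod (indicator {-R..R} x)" for x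
  proof (cases "\<bar>x\<bar> > R")
    case True
    then show ?thesis using assms(3)[of x] by (auto simp: indicator_def)
  next
    case False
    then have "x \<in> {-R..R}" by auto
    then show ?thesis using assms(2)[of x] by (simp add: indicator_def)
  qed
  then show "AE x in lborel. cmod (w x) \<le> C * cmod (indicator {-R..R} x)" by simp
qed fact

definition clip :: "real \<Rightarrow> complex \<Rightarrow> complex" where
  "clip n z = of_real (n / max n (cmod z)) * z"

lemma clip_bound: assumes "n > 0" shows "cmod (clip n z) \<le> n"
proof -
  have "n * cmod z \<le> n * max n (cmod z)" using assms by (intro mult_left_mono) auto
  then show ?thesis using assms by (simp add: clip_def norm_mult norm_divide field_simps)
qed

lemma clip_id: "n > 0 \<Longrightarrow> cmod z \<le> n \<Longrightarrow> clip n z = z"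
  by (simp add: clip_def max_def)

lemma continuous_on_clip: "n > 0 \<Longrightarrow> continuous_on S f \<Longrightarrow> continuous_on S (\<lambda>x. clip n (f x))"
  unfolding clip_def by (intro continuous_intros) auto

lemma sqint_approx_continuous:
  assumes w: "sqint w" and e: "e > 0"
  shows "\<exists>v R. continuous_on UNIV v \<and> (\<forall>x. \<bar>x\<bar> > R \<longrightarrow> v x = 0) \<and> sqint v \<and> nrm (\<lambda>x. w x - v x) < e"
proof -
  note [measurable] = sqintD[OF w]
  define b where "b n x = (if \<bar>x\<bar> \<le> real n \<and> cmod (w x) \<le> real n then w x else 0)" for n x
  have b_meas[measurable]: "b n \<in> borel_measurable borel" for n unfolding b_def by measurable
  have "(\<lambda>n. nrm (\<lambda>x. b n x - w x)) \<longlonglongrightarrow> 0"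
  proof (rule tendsto_nrm_dominated[OF _ w])
    show "AE x in lborel. (\<lambda>n. b n x - w x) \<longlonglongrightarrow> 0"
    proof (rule AE_I2)
      fix x
      obtain N where N: "\<bar>x\<bar> + cmod (w x) \<le> real N" using real_arch_simple by blast
      have "b n x - w x = 0" if "n \<ge> N" for n
      proof -
        have "real N \<le> real n" using that by simp
        moreover have "0 \<le> cmod (w x)" "0 \<le> \<bar>x\<bar>" by auto
        ultimately have "\<bar>x\<bar> \<le> real n" "cmod (w x) \<le> real n" using N by linarith+
        then show ?thesis by (simp add: b_def)
      qed
      then show "(\<lambda>n. b n x - w x) \<longlonglongrightarrow> 0"
        by (intro tendsto_eventually) (auto simp: eventually_sequentially)
    qed
  qed (auto simp: b_def)
  then have "\<forall>\<^sub>F n in sequentially. nrm (\<lambda>x. b n x - w x) < e / 2"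
    using e by (intro order_tendstoD) auto
  then have "\<forall>\<^sub>F n in sequentially. nrm (\<lambda>x. b n x - w x) < e / 2 \<and> n \<ge> 1"
    using eventually_ge_at_top eventually_conj by blast
  then obtain n where n: "nrm (\<lambda>x. b n x - w x) < e / 2" "n \<ge> 1"
    using eventually_happens'[OF sequentially_bot] by blast
  have "b n measurable_on UNIV"
    using b_meas by (simp add: measurable_on_iff_borel_measurable lebesgue_on_UNIV_eq measurable_completion)
  then obtain N g where N: "negligible N" and g: "\<And>m. continuous_on UNIV (g m)"
      "\<And>x. x \<notin> N \<Longrightarrow> (\<lambda>m. g m x) \<longlonglongrightarrow> b n x"
    unfolding measurable_on_def by auto
  define cutoff where "cutoff x = complex_of_real (max 0 (min 1 (real n + 1 - \<bar>x\<bar>)))" for x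
  define v where "v m x = clip (real n) (g m x) * cutoff x" for m x
  have v_cont: "continuous_on UNIV (v m)" for m
    unfolding v_def cutoff_def using n by (intro continuous_intros continuous_on_clip g) auto
  have [measurable]: "v m \<in> borel_measurable borel" for m
    by (rule borel_measurable_continuous_onI[OF v_cont])
  have v_supp: "v m x = 0" if "\<bar>x\<bar> > real n + 1" for m x
    using that by (simp add: v_def cutoff_def)
  have v_bound: "cmod (v m x) \<le> real n" for m x
  proof -
    have "cmod (v m x) \<le> real n * 1"
      unfolding v_def norm_mult using n clip_bound[of "real n" "g m x"]
      by (intro mult_mono) (auto simp: cutoff_def)
    then show ?thesis by simp
  qed
  have v_sq: "sqint (v m)" for m
    by (rule sqint_bounded_interval[OF _ v_bound v_supp]) measurable
  have b_sq: "sqint (b n)"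
    by (rule sqint_bounded_interval[where C="real n" and R="real n"]) (auto simp: b_def)
  define B where "B = (\<lambda>x. 2 * complex_of_real (real n) * indicator {-(real n + 1)..real n + 1} x)"
  have B: "sqint B"
    by (rule sqint_bounded_interval[where C="2 * real n" and R="real n + 1"]) (auto simp: B_def indicator_def)
  have "AE x in lborel. x \<notin> N"
    using N by (auto simp: negligible_iff_null_sets eventually_ae_filter null_sets_completion_iff2)
  then have AE_lim: "AE x in lborel. (\<lambda>m. v m x) \<longlonglongrightarrow> b n x"
  proof eventually_elim
    fix x assume "x \<notin> N"
    have "continuous_on UNIV (\<lambda>z. clip (real n) z)" using n by (intro continuous_on_clip) auto
    then have "isCont (clip (real n)) (b n x)" by (simp add: continuous_on_eq_continuous_at)
    from isCont_tendsto_compose[OF this g(2)[OF \<open>x \<notin> N\<close>]]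
    have "(\<lambda>m. clip (real n) (g m x)) \<longlonglongrightarrow> b n x"
      using n by (simp add: clip_id b_def)
    then have "(\<lambda>m. v m x) \<longlonglongrightarrow> b n x * cutoff x" unfolding v_def by (intro tendsto_intros)
    moreover have "b n x * cutoff x = b n x" by (auto simp: b_def cutoff_def)
    ultimately show "(\<lambda>m. v m x) \<longlonglongrightarrow> b n x" by simp
  qed
  have "(\<lambda>m. nrm (\<lambda>x. v m x - b n x)) \<longlonglongrightarrow> 0"
  proof (rule tendsto_nrm_dominated[OF _ B])
    show "AE x in lborel. cmod (v m x - b n x) \<le> cmod (B x)" for m
    proof (rule AE_I2)
      fix x
      show "cmod (v m x - b n x) \<le> cmod (B x)"
      proof (cases "\<bar>x\<bar> > real n + 1")
        case True
        then show ?thesis using v_supp[of x m] by (simp add: b_def)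
      next
        case False
        then have "x \<in> {-(real n + 1)..real n + 1}" by auto
        then have "cmod (B x) = 2 * real n" by (simp add: B_def norm_mult)
        moreover have "cmod (b n x) \<le> real n" by (simp add: b_def)
        moreover have "cmod (v m x - b n x) \<le> cmod (v m x) + cmod (b n x)" by (rule norm_triangle_ineq4)
        ultimately show ?thesis using v_bound[of m x] by linarith
      qed
    qed
    show "AE x in lborel. (\<lambda>m. v m x - b n x) \<longlonglongrightarrow> 0"
      using AE_lim by eventually_elim (simp add: LIM_zero)
  qed measurable
  then have "\<forall>\<^sub>F m in sequentially. nrm (\<lambda>x. v m x - b n x) < e / 2"
    using e by (intro order_tendstoD) auto
  then obtain m where m: "nrm (\<lambda>x. v m x - b n x) < e / 2"
    using eventually_happens'[OF sequentially_bot] by blast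
  have "nrm (\<lambda>x. w x - v m x) \<le> nrm (\<lambda>x. w x - b n x) + nrm (\<lambda>x. b n x - v m x)"
    by (rule nrm_triangle_via[OF w b_sq v_sq])
  also have "\<dots> < e"
    using n(1) m nrm_minus_commute[of w "b n"] nrm_minus_commute[of "v m" "b n"] by simp
  finally show ?thesis using v_cont v_supp v_sq by blast
qed

lemma tendsto_nrm_shift:
  assumes w: "sqint w" and t: "t \<longlonglongrightarrow> (0::real)"
  shows "(\<lambda>k. nrm (\<lambda>x. w (x + t k) - w x)) \<longlonglongrightarrow> 0"
proof (rule LIMSEQ_I)
  fix e :: real assume e: "e > 0"
  obtain v R where v: "continuous_on UNIV v" "\<And>x. \<bar>x\<bar> > R \<Longrightarrow> v x = 0" "sqint v"
      "nrm (\<lambda>x. w x - v x) < e / 3"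
    using sqint_approx_continuous[OF w, of "e/3"] e by auto
  have "compact (v ` {-R..R})" using v(1) by (intro compact_continuous_image) (auto intro: continuous_on_subset)
  then obtain C where C: "\<And>x. x \<in> {-R..R} \<Longrightarrow> cmod (v x) \<le> C" "C > 0"
    using bounded_pos[of "v ` {-R..R}"] compact_imp_bounded by (metis imageI)
  have C': "cmod (v x) \<le> C" for x
    using C(1)[of x] C(2) v(2)[of x] by (cases "x \<in> {-R..R}") auto
  note [measurable] = sqintD[OF v(3)]
  define B where "B = (\<lambda>x. 2 * complex_of_real C * indicator {-(R + 1)..R + 1} x)"
  have B: "sqint B"
    using C by (intro sqint_bounded_interval[where C="2 * C" and R="R + 1"]) (auto simp: B_def indicator_def)
  obtain K where K: "\<And>k. k \<ge> K \<Longrightarrow> \<bar>t k\<bar> \<le> 1"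
    using LIMSEQ_D[OF t, of 1] by force
  have "(\<lambda>k. nrm (\<lambda>x. v (x + t (k + K)) - v x)) \<longlonglongrightarrow> 0"
  proof (rule tendsto_nrm_dominated[OF _ B])
    show "AE x in lborel. cmod (v (x + t (k + K)) - v x) \<le> cmod (B x)" for k
    proof (rule AE_I2)
      fix x
      have tk: "\<bar>t (k + K)\<bar> \<le> 1" by (rule K) simp
      show "cmod (v (x + t (k + K)) - v x) \<le> cmod (B x)"
      proof (cases "\<bar>x\<bar> > R + 1")
        case True
        then have "\<bar>x + t (k + K)\<bar> > R" "\<bar>x\<bar> > R" using tk by linarith+
        then show ?thesis using v(2) by simp
      next
        case False
        then have "x \<in> {-(R + 1)..R + 1}" by auto
        then have "cmod (B x) = 2 * C" using C by (simp add: B_def norm_mult)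
        then show ?thesis using norm_triangle_ineq4[of "v (x + t (k + K))" "v x"] C'[of x] C'[of "x + t (k+K)"]
          by linarith
      qed
    qed
    have "(\<lambda>k. v (x + t (k + K)) - v x) \<longlonglongrightarrow> 0" for x
    proof -
      have "(\<lambda>k. x + t (k + K)) \<longlonglongrightarrow> x + 0" by (intro tendsto_intros LIMSEQ_ignore_initial_segment t)
      moreover have "isCont v x" using v(1) by (simp add: continuous_on_eq_continuous_at)
      ultimately have "(\<lambda>k. v (x + t (k + K))) \<longlonglongrightarrow> v x" using isCont_tendsto_compose by fastforce
      then show ?thesis by (simp add: LIM_zero)
    qed
    then show "AE x in lborel. (\<lambda>k. v (x + t (k + K)) - v x) \<longlonglongrightarrow> 0" by simp
  qed measurable
  then have "(\<lambda>k. nrm (\<lambda>x. v (x + t k) - v x)) \<longlonglongrightarrow> 0" by (rule LIMSEQ_offset)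
  from LIMSEQ_D[OF this, of "e/3"] e
  obtain L where L: "\<And>k. k \<ge> L \<Longrightarrow> nrm (\<lambda>x. v (x + t k) - v x) < e / 3" by auto
  have "nrm (\<lambda>x. w (x + t k) - w x) < e" if "k \<ge> L" for k
  proof -
    note sh = sqint_shift(1)[OF w, of "t k"] sqint_shift(1)[OF v(3), of "t k"]
    have "nrm (\<lambda>x. w (x + t k) - w x) \<le> nrm (\<lambda>x. w (x + t k) - v (x + t k)) + nrm (\<lambda>x. v (x + t k) - w x)"
      by (rule nrm_triangle_via[OF sh w])
    also have "nrm (\<lambda>x. v (x + t k) - w x) \<le> nrm (\<lambda>x. v (x + t k) - v x) + nrm (\<lambda>x. v x - w x)"
      by (rule nrm_triangle_via[OF sh(2) v(3) w])
    also have "nrm (\<lambda>x. w (x + t k) - v (x + t k)) = nrm (\<lambda>x. w x - v x)"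
      using sqint_shift(2)[OF sqint_diff[OF w v(3)], of "t k"] by simp
    finally show ?thesis using L[OF that] v(4) nrm_minus_commute[of v w] by linarith
  qed
  then show "\<exists>no. \<forall>k\<ge>no. norm (nrm (\<lambda>x. w (x + t k) - w x) - 0) < e" by auto
qed

section \<open>The Fourier integral and Plancherel's identity\<close>

definition ft :: "(real \<Rightarrow> complex) \<Rightarrow> real \<Rightarrow> complex" where
  "ft w \<xi> = (LINT x|lborel. w x * cis (- (x * \<xi>)))"

lemma borel_measurable_cis[measurable]: "cis \<in> borel_measurable borel"
  by (intro borel_measurable_continuous_onI continuous_intros)

lemma ft_measurable[measurable]:
  assumes [measurable]: "w \<in> borel_measurable borel" shows "ft w \<in> borel_measurable borel"
  unfolding ft_def by measurable

lemma integrable_mult_cis: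
  assumes "integrable lborel w" "h \<in> borel_measurable borel"
  shows "integrable lborel (\<lambda>x. w x * cis (h x))"
  by (rule Bochner_Integration.integrable_bound[OF assms(1)])
     (use assms in \<open>auto simp: norm_mult intro!: borel_measurable_times measurable_compose[OF _ borel_measurable_cis]\<close>)

lemma integrable_ft_integrand: "integrable lborel w \<Longrightarrow> integrable lborel (\<lambda>x. w x * cis (- (x * \<xi>)))"
  by (rule integrable_mult_cis) auto

lemma ft_bound: "cmod (ft w \<xi>) \<le> (LINT x|lborel. cmod (w x))"
proof -
  have "cmod (ft w \<xi>) \<le> (LINT x|lborel. cmod (w x * cis (- (x * \<xi>))))"
    unfolding ft_def by (rule integral_norm_bound)
  then show ?thesis by (simp add: norm_mult)
qed

lemma ft_lincomb:
  assumes "integrable lborel w" "integrable lborel v"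
  shows "ft (\<lambda>x. a * w x + b * v x) \<xi> = a * ft w \<xi> + b * ft v \<xi>"
  unfolding ft_def using integrable_ft_integrand[OF assms(1), of \<xi>] integrable_ft_integrand[OF assms(2), of \<xi>]
  by (simp add: distrib_right mult.assoc)

lemma ft_diff:
  assumes "integrable lborel w" "integrable lborel v"
  shows "ft (\<lambda>x. w x - v x) \<xi> = ft w \<xi> - ft v \<xi>"
  using ft_lincomb[OF assms, of 1 "-1"] by simp

lemma integrable_bounded_mult:
  fixes a b :: "real \<Rightarrow> complex"
  assumes "integrable lborel a" "b \<in> borel_measurable borel" "\<And>x. cmod (b x) \<le> C"
  shows "integrable lborel (\<lambda>x. b x * a x)"
proof (rule Bochner_Integration.integrable_bound)
  show "integrable lborel (\<lambda>x. C * cmod (a x))" using assms(1) by simp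
  have "0 \<le> C" using assms(3)[of 0] norm_ge_zero order_trans by blast
  then show "AE x in lborel. norm (b x * a x) \<le> norm (C * cmod (a x))"
    using assms(3) by (auto simp: norm_mult intro!: mult_right_mono)
qed (use assms in measurable)

lemma ft_mult_formula:
  assumes a: "integrable lborel a" and b: "integrable lborel b"
  shows "(LINT \<xi>|lborel. ft a \<xi> * b \<xi>) = (LINT x|lborel. a x * ft b x)"
proof -
  have [measurable]: "a \<in> borel_measurable borel" "b \<in> borel_measurable borel" using a b by auto
  define k where "k = (\<lambda>(x::real) \<xi>::real. a x * b \<xi> * cis (- (x * \<xi>)))"
  have "integrable (lborel \<Otimes>\<^sub>M lborel) (\<lambda>(x, \<xi>). k x \<xi>)"
  proof (rule lborel_pair.Fubini_integrable)
    show "(\<lambda>(x, \<xi>). k x \<xi>) \<in> borel_measurable (lborel \<Otimes>\<^sub>M lborel)" unfolding k_def by measurable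
    have "(\<lambda>x. LINT y|lborel. norm (case (x, y) of (x, \<xi>) \<Rightarrow> k x \<xi>)) = (\<lambda>x. cmod (a x) * (LINT y|lborel. cmod (b y)))"
      by (simp add: k_def norm_mult)
    then show "integrable lborel (\<lambda>x. LINT y|lborel. norm (case (x, y) of (x, \<xi>) \<Rightarrow> k x \<xi>))"
      using a by simp
    have "integrable lborel (\<lambda>y. a x * (b y * cis (- (x * y))))" for x
      by (intro integrable_mult_right integrable_mult_cis[OF b]) measurable
    then show "AE x in lborel. integrable lborel (\<lambda>y. case (x, y) of (x, \<xi>) \<Rightarrow> k x \<xi>)"
      by (simp add: k_def mult.assoc)
  qed
  from lborel_pair.Fubini_integral[OF this]
  have "(LINT \<xi>|lborel. LINT x|lborel. k x \<xi>) = (LINT x|lborel. LINT \<xi>|lborel. k x \<xi>)" .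
  moreover have "(LINT x|lborel. k x \<xi>) = ft a \<xi> * b \<xi>" for \<xi>
  proof -
    have "(LINT x|lborel. k x \<xi>) = (LINT x|lborel. a x * cis (- (x * \<xi>)) * b \<xi>)"
      by (simp add: k_def mult_ac)
    then show ?thesis by (simp add: ft_def)
  qed
  moreover have "(LINT \<xi>|lborel. k x \<xi>) = a x * ft b x" for x
  proof -
    have "(LINT \<xi>|lborel. k x \<xi>) = (LINT \<xi>|lborel. a x * (b \<xi> * cis (- (\<xi> * x))))"
      by (simp add: k_def mult_ac)
    then show ?thesis by (simp add: ft_def)
  qed
  ultimately show ?thesis by simp
qed

definition gauss :: "real \<Rightarrow> real \<Rightarrow> complex" where
  "gauss k \<xi> = of_real (exp (- (\<xi> / k)\<^sup>2 / 2))"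

lemma integrable_gauss: assumes "k > 0" shows "integrable lborel (gauss k)"
proof -
  have "integrable lborel (\<lambda>x. sqrt (2 * pi) * std_normal_density x)"
    by (intro integrable_mult_right integrable_normal_density) simp
  then have "integrable lborel (\<lambda>x::real. exp (- x\<^sup>2 / 2))"
    by (simp add: std_normal_density_def)
  from lborel_integrable_real_affine[OF this, of "1/k" 0] assms
  have "integrable lborel (\<lambda>x. complex_of_real (exp (- (x / k)\<^sup>2 / 2)))"
    by (simp add: power_divide)
  then show ?thesis by (simp add: gauss_def[abs_def])
qed

lemma ft_std_normal: "ft (\<lambda>x. of_real (std_normal_density x)) s = of_real (exp (- s\<^sup>2 / 2))"
proof -
  have "char std_normal_distribution (- s) = (LINT x|lborel. std_normal_density x *\<^sub>R cis (- (x * s)))"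
    unfolding char_def by (subst integral_density) (auto simp: cis_conv_exp mult_ac)
  then show ?thesis
    by (simp add: char_std_normal_distribution ft_def scaleR_conv_of_real)
qed

lemma ft_gauss: assumes "k > 0"
  shows "ft (gauss k) s = of_real (2 * pi * (k * std_normal_density (k * s)))"
proof -
  have "ft (gauss k) s = \<bar>k\<bar> *\<^sub>R (LINT x|lborel. gauss k (0 + k * x) * cis (- ((0 + k * x) * s)))"
    unfolding ft_def using assms by (intro lborel_integral_real_affine) simp
  also have "(LINT x|lborel. gauss k (0 + k * x) * cis (- ((0 + k * x) * s)))
      = (LINT x|lborel. of_real (sqrt (2 * pi)) * (of_real (std_normal_density x) * cis (- (x * (k * s)))))"
    using assms by (intro Bochner_Integration.integral_cong) (auto simp: gauss_def std_normal_density_def mult_ac)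
  also have "\<dots> = of_real (sqrt (2 * pi)) * ft (\<lambda>x. of_real (std_normal_density x)) (k * s)"
    unfolding ft_def by simp
  also have "\<bar>k\<bar> *\<^sub>R \<dots> = of_real (k * sqrt (2 * pi) * exp (- (k * s)\<^sup>2 / 2))"
    using assms by (simp add: ft_std_normal scaleR_conv_of_real)
  also have "k * sqrt (2 * pi) * exp (- (k * s)\<^sup>2 / 2) = 2 * pi * (k * std_normal_density (k * s))"
    by (simp add: std_normal_density_def field_simps)
  finally show ?thesis .
qed

lemma gauss_sq_le_1: "cmod (gauss k \<xi>) \<le> 1"
  by (simp add: gauss_def)

text \<open>As \<open>k\<close> tends to infinity the right-hand side tends to \<open>2\<pi>\<close> times the squared norm of \<open>w\<close>, by
  continuity of translations; this gives Plancherel's identity.\<close>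

lemma regularised_Plancherel:
  assumes w: "sqint w" "integrable lborel w" and k: "k > 0"
  shows "(LINT \<xi>|lborel. (cmod (ft w \<xi>))\<^sup>2 * exp (- (\<xi> / k)\<^sup>2 / 2))
    = 2 * pi * (LINT z|lborel. std_normal_density z * Re (LINT x|lborel. w x * cnj (w (x - z / k))))"
proof -
  have [measurable]: "w \<in> borel_measurable borel" using w(2) by auto
  define b where "b \<xi> = cnj (ft w \<xi>) * gauss k \<xi>" for \<xi>
  have b: "integrable lborel b"
    unfolding b_def
    by (rule integrable_bounded_mult[OF integrable_gauss[OF k]]) (use ft_bound in auto)
  have ftb: "ft b x = 2 * pi * (LINT z|lborel. cnj (w (x - z / k)) * of_real (std_normal_density z))" for x
  proof -
    have wx: "integrable lborel (\<lambda>s. cnj (w (x - s)))"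
      using lborel_integrable_real_affine[OF w(2), of "-1" x] by simp
    have conv: "ft (\<lambda>s. cnj (w (x - s))) \<xi> = cnj (ft w \<xi>) * cis (- (x * \<xi>))" for \<xi>
    proof -
      have "ft (\<lambda>s. cnj (w (x - s))) \<xi> = (LINT s|lborel. cnj (w (x - s)) * cis (- (s * \<xi>)))"
        by (simp add: ft_def)
      also have "\<dots> = (LINT s|lborel. cnj (w (x - (x + -1 * s))) * cis (- ((x + -1 * s) * \<xi>)))"
        by (subst lborel_integral_real_affine[of "-1" _ x]) auto
      also have "\<dots> = (LINT s|lborel. cnj (w s * cis (- (s * \<xi>))) * cis (- (x * \<xi>)))"
        by (intro Bochner_Integration.integral_cong)
           (auto simp: cis_cnj cis_mult algebra_simps)
      also have "\<dots> = (LINT s|lborel. cnj (w s * cis (- (s * \<xi>)))) * cis (- (x * \<xi>))"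
        by simp
      also have "(LINT s|lborel. cnj (w s * cis (- (s * \<xi>)))) = cnj (ft w \<xi>)"
        unfolding ft_def by (rule Bochner_Integration.integral_cnj)
      finally show ?thesis .
    qed
    have "ft b x = (LINT \<xi>|lborel. ft (\<lambda>s. cnj (w (x - s))) \<xi> * gauss k \<xi>)"
      unfolding conv ft_def[of b] b_def by (simp add: mult_ac)
    also have "\<dots> = (LINT s|lborel. cnj (w (x - s)) * ft (gauss k) s)"
      by (rule ft_mult_formula[OF wx integrable_gauss[OF k]])
    also have "\<dots> = (LINT s|lborel. cnj (w (x - s)) * of_real (2 * pi * (k * std_normal_density (k * s))))"
      unfolding ft_gauss[OF k] ..
    also have "\<dots> = \<bar>1 / k\<bar> *\<^sub>R (LINT s|lborel. cnj (w (x - (0 + 1 / k * s))) * of_real (2 * pi * (k * std_normal_density (k * (0 + 1 / k * s)))))"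
      using k by (intro lborel_integral_real_affine) simp
    also have "\<dots> = \<bar>1 / k\<bar> *\<^sub>R (LINT s|lborel. of_real (2 * pi * k) * (cnj (w (x - s / k)) * of_real (std_normal_density s)))"
      using k by (intro arg_cong[where f="scaleR _"] Bochner_Integration.integral_cong) (auto simp: mult_ac)
    also have "\<dots> = 2 * pi * (LINT z|lborel. cnj (w (x - z / k)) * of_real (std_normal_density z))"
      using k by (simp add: scaleR_conv_of_real)
    finally show ?thesis .
  qed
  define K where "K = (\<lambda>(z::real) x::real. w x * cnj (w (x - z / k)) * of_real (std_normal_density z))"
  have shifted: "sqint (\<lambda>x. cnj (w (x - z / k)))" "nrm (\<lambda>x. cnj (w (x - z / k))) = nrm w" for z
    using sqint_shift[OF w(1), of "- z / k"] by (auto intro!: sqint_cnj)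
  have "integrable (lborel \<Otimes>\<^sub>M lborel) (\<lambda>(z, x). K z x)"
  proof (rule lborel_pair.Fubini_integrable)
    show "(\<lambda>(z, x). K z x) \<in> borel_measurable (lborel \<Otimes>\<^sub>M lborel)" unfolding K_def by measurable
    show "AE z in lborel. integrable lborel (\<lambda>x. case (z, x) of (z, x) \<Rightarrow> K z x)"
      using sqint_mult_integrable[OF w(1) shifted(1)] by (simp add: K_def)
    show "integrable lborel (\<lambda>z. LINT x|lborel. norm (case (z, x) of (z, x) \<Rightarrow> K z x))"
    proof (rule Bochner_Integration.integrable_bound)
      show "integrable lborel (\<lambda>z. (nrm w * nrm w) * std_normal_density z)" by simp
      have "(\<lambda>(z, x). norm (K z x)) \<in> borel_measurable (lborel \<Otimes>\<^sub>M lborel)" unfolding K_def by measurable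
      then show "(\<lambda>z. LINT x|lborel. norm (case (z, x) of (z, x) \<Rightarrow> K z x)) \<in> borel_measurable lborel"
        by (intro lborel.borel_measurable_lebesgue_integral) simp
      have "(LINT x|lborel. norm (K z x)) \<le> (nrm w * nrm w) * std_normal_density z" for z
        using Cauchy_Schwarz[OF w(1) shifted(1), of z] shifted(2)[of z]
        by (simp add: K_def norm_mult mult_right_mono)
      then show "AE z in lborel. norm (LINT x|lborel. norm (case (z, x) of (z, x) \<Rightarrow> K z x))
          \<le> norm ((nrm w * nrm w) * std_normal_density z)" by simp
    qed
  qed
  from lborel_pair.Fubini_integral[OF this]
  have F: "(LINT x|lborel. LINT z|lborel. K z x) = (LINT z|lborel. LINT x|lborel. K z x)" .
  have K_x: "(LINT x|lborel. K z x) = of_real (std_normal_density z) * (LINT x|lborel. w x * cnj (w (x - z / k)))" for z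
  proof -
    have "(LINT x|lborel. K z x) = (LINT x|lborel. of_real (std_normal_density z) * (w x * cnj (w (x - z / k))))"
      unfolding K_def by (simp only: mult_ac)
    also have "\<dots> = of_real (std_normal_density z) * (LINT x|lborel. w x * cnj (w (x - z / k)))"
      by (rule integral_mult_right_zero)
    finally show ?thesis .
  qed
  have "(LINT \<xi>|lborel. ft w \<xi> * b \<xi>) = (LINT x|lborel. w x * ft b x)"
    by (rule ft_mult_formula[OF w(2) b])
  also have "\<dots> = 2 * pi * (LINT x|lborel. LINT z|lborel. K z x)"
    by (simp add: ftb K_def mult_ac flip: integral_mult_right_zero)
  also have "\<dots> = 2 * pi * (LINT z|lborel. of_real (std_normal_density z) * (LINT x|lborel. w x * cnj (w (x - z / k))))"
    unfolding F K_x ..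
  finally have eq: "(LINT \<xi>|lborel. ft w \<xi> * b \<xi>)
    = 2 * pi * (LINT z|lborel. of_real (std_normal_density z) * (LINT x|lborel. w x * cnj (w (x - z / k))))" .
  have "ft w \<xi> * b \<xi> = of_real ((cmod (ft w \<xi>))\<^sup>2 * exp (- (\<xi> / k)\<^sup>2 / 2))" for \<xi>
    by (simp only: of_real_mult complex_norm_square b_def gauss_def mult.assoc)
  then have "(LINT \<xi>|lborel. (cmod (ft w \<xi>))\<^sup>2 * exp (- (\<xi> / k)\<^sup>2 / 2)) = Re (LINT \<xi>|lborel. ft w \<xi> * b \<xi>)"
    by (simp only: integral_complex_of_real Re_complex_of_real)
  also have "\<dots> = 2 * pi * Re (LINT z|lborel. of_real (std_normal_density z) * (LINT x|lborel. w x * cnj (w (x - z / k))))"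
    unfolding eq by simp
  also have "Re (LINT z|lborel. of_real (std_normal_density z) * (LINT x|lborel. w x * cnj (w (x - z / k))))
     = (LINT z|lborel. Re (of_real (std_normal_density z) * (LINT x|lborel. w x * cnj (w (x - z / k)))))"
  proof (rule integral_Re[symmetric])
    have "integrable lborel (\<lambda>z. LINT x|lborel. K z x)"
      using lborel_pair.integrable_fst[OF \<open>integrable (lborel \<Otimes>\<^sub>M lborel) (\<lambda>(z, x). K z x)\<close>] by simp
    then show "integrable lborel (\<lambda>z. of_real (std_normal_density z) * (LINT x|lborel. w x * cnj (w (x - z / k))))"
      unfolding K_x .
  qed
  finally show ?thesis by simp
qed

lemma nrm_sq_pairing: assumes "sqint w" shows "Re (LINT x|lborel. w x * cnj (w x)) = (nrm w)\<^sup>2"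
proof -
  have "(LINT x|lborel. w x * cnj (w x)) = (LINT x|lborel. complex_of_real ((cmod (w x))\<^sup>2))"
    by (simp only: complex_norm_square)
  then show ?thesis by (simp add: nrm_sq del: of_real_power)
qed

theorem Plancherel_integrable:
  assumes w: "sqint w" "integrable lborel w"
  shows "sqint (ft w)" "nrm (ft w) = sqrt (2 * pi) * nrm w"
proof -
  have [measurable]: "w \<in> borel_measurable borel" using w(2) by auto
  define A where "A n = (\<lambda>\<xi>. (cmod (ft w \<xi>))\<^sup>2 * exp (- (\<xi> / real (Suc n))\<^sup>2 / 2))" for n
  define L where "L n z = Re (LINT x|lborel. w x * cnj (w (x - z / real (Suc n))))" for n z
  have shifted: "sqint (\<lambda>x. cnj (w (x - t)))" "nrm (\<lambda>x. cnj (w (x - t))) = nrm w" for t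
    using sqint_shift[OF w(1), of "- t"] by (auto intro!: sqint_cnj)
  have L_bound: "\<bar>L n z\<bar> \<le> nrm w * nrm w" for n z
  proof -
    have "\<bar>L n z\<bar> \<le> cmod (LINT x|lborel. w x * cnj (w (x - z / real (Suc n))))"
      unfolding L_def by (rule abs_Re_le_cmod)
    also have "\<dots> \<le> nrm w * nrm w"
      using integral_mult_bound[OF w(1) shifted(1)] shifted(2) by metis
    finally show ?thesis .
  qed
  have L_lim: "(\<lambda>n. L n z) \<longlonglongrightarrow> (nrm w)\<^sup>2" for z
  proof -
    have t0: "(\<lambda>n. - z / real (Suc n)) \<longlonglongrightarrow> 0"
      by (rule LIMSEQ_Suc[OF lim_const_over_n])
    have "(\<lambda>n. L n z - (nrm w)\<^sup>2) \<longlonglongrightarrow> 0"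
    proof (rule Lim_null_comparison)
      show "(\<lambda>n. nrm w * nrm (\<lambda>x. w (x + (- z / real (Suc n))) - w x)) \<longlonglongrightarrow> 0"
        using tendsto_mult[OF tendsto_const tendsto_nrm_shift[OF w(1) t0], of "nrm w"] by simp
      have "norm (L n z - (nrm w)\<^sup>2) \<le> nrm w * nrm (\<lambda>x. w (x + (- z / real (Suc n))) - w x)" for n
      proof -
        define t where "t = z / real (Suc n)"
        have "L n z - (nrm w)\<^sup>2 = Re ((LINT x|lborel. w x * cnj (w (x - t))) - (LINT x|lborel. w x * cnj (w x)))"
          by (simp add: L_def t_def nrm_sq_pairing[OF w(1)])
        also have "(LINT x|lborel. w x * cnj (w (x - t))) - (LINT x|lborel. w x * cnj (w x))
          = (LINT x|lborel. w x * cnj (w (x - t) - w x))"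
          using sqint_mult_integrable[OF w(1) shifted(1), of t] sqint_mult_integrable[OF w(1) sqint_cnj[OF w(1)]]
          by (simp add: right_diff_distrib)
        also have "\<bar>Re \<dots>\<bar> \<le> cmod (LINT x|lborel. w x * cnj (w (x - t) - w x))" by (rule abs_Re_le_cmod)
        also have "\<dots> \<le> nrm w * nrm (\<lambda>x. cnj (w (x - t) - w x))"
          by (intro integral_mult_bound w sqint_cnj sqint_diff)
             (use sqint_shift(1)[OF w(1), of "-t"] in simp)
        also have "nrm (\<lambda>x. cnj (w (x - t) - w x)) = nrm (\<lambda>x. w (x - t) - w x)" by (rule nrm_cnj)
        finally show ?thesis by (simp add: t_def)
      qed
      then show "\<forall>\<^sub>F n in sequentially. norm (L n z - (nrm w)\<^sup>2) \<le> nrm w * nrm (\<lambda>x. w (x + (- z / real (Suc n))) - w x)"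
        by simp
    qed
    then show ?thesis by (simp add: LIM_zero_iff)
  qed
  have L_meas[measurable]: "L n \<in> borel_measurable borel" for n
    unfolding L_def by measurable
  have "(\<lambda>n. LINT z|lborel. std_normal_density z * L n z) \<longlonglongrightarrow> (LINT z|lborel. std_normal_density z * (nrm w)\<^sup>2)"
  proof (rule Bochner_Integration.integral_dominated_convergence[where w="\<lambda>z. std_normal_density z * (nrm w * nrm w)"])
    show "AE z in lborel. (\<lambda>n. std_normal_density z * L n z) \<longlonglongrightarrow> std_normal_density z * (nrm w)\<^sup>2"
      by (intro AE_I2 tendsto_intros L_lim)
    show "AE z in lborel. norm (std_normal_density z * L n z) \<le> std_normal_density z * (nrm w * nrm w)" for n
      using L_bound by (auto simp: abs_mult intro!: mult_left_mono)
  qed simp_all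
  moreover have "(LINT z|lborel. std_normal_density z * (nrm w)\<^sup>2) = (nrm w)\<^sup>2" by simp
  ultimately have "(\<lambda>n. 2 * pi * (LINT z|lborel. std_normal_density z * L n z)) \<longlonglongrightarrow> 2 * pi * (nrm w)\<^sup>2"
    by (intro tendsto_intros) simp
  moreover have "2 * pi * (LINT z|lborel. std_normal_density z * L n z) = integral\<^sup>L lborel (A n)" for n
    unfolding A_def L_def using regularised_Plancherel[OF w, of "real (Suc n)"] by simp
  ultimately have A_lim: "(\<lambda>n. integral\<^sup>L lborel (A n)) \<longlonglongrightarrow> 2 * pi * (nrm w)\<^sup>2" by simp
  have A_int: "integrable lborel (A n)" for n
  proof -
    have "integrable lborel (\<lambda>\<xi>. (ft w \<xi> * cnj (ft w \<xi>)) * gauss (real (Suc n)) \<xi>)"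
    proof (rule integrable_bounded_mult[OF integrable_gauss])
      show "cmod (ft w \<xi> * cnj (ft w \<xi>)) \<le> (LINT x|lborel. cmod (w x)) * (LINT x|lborel. cmod (w x))" for \<xi>
        unfolding norm_mult complex_mod_cnj using ft_bound[of w \<xi>] norm_ge_zero
        by (intro mult_mono) (auto intro: order_trans[OF norm_ge_zero])
    qed simp_all
    moreover have "complex_of_real (A n \<xi>) = (ft w \<xi> * cnj (ft w \<xi>)) * gauss (real (Suc n)) \<xi>" for \<xi>
      by (simp only: A_def of_real_mult complex_norm_square gauss_def)
    ultimately have "integrable lborel (\<lambda>\<xi>. complex_of_real (A n \<xi>))" by simp
    then show ?thesis by (simp add: complex_of_real_integrable_eq)
  qed
  have A_mono: "mono (\<lambda>n. A n \<xi>)" for \<xi>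
  proof (rule monoI)
    fix m n :: nat assume "m \<le> n"
    then have "(\<xi> / real (Suc n))\<^sup>2 \<le> (\<xi> / real (Suc m))\<^sup>2"
      by (simp add: power_divide divide_left_mono)
    then show "A m \<xi> \<le> A n \<xi>" unfolding A_def by (intro mult_left_mono) auto
  qed
  have A_ptw: "(\<lambda>n. A n \<xi>) \<longlonglongrightarrow> (cmod (ft w \<xi>))\<^sup>2" for \<xi>
  proof -
    have "(\<lambda>n. \<xi> / real (Suc n)) \<longlonglongrightarrow> 0" by (rule LIMSEQ_Suc[OF lim_const_over_n])
    then have "(\<lambda>n. (cmod (ft w \<xi>))\<^sup>2 * exp (- (\<xi> / real (Suc n))\<^sup>2 / 2)) \<longlonglongrightarrow> (cmod (ft w \<xi>))\<^sup>2 * exp (- 0\<^sup>2 / 2)"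
      by (intro tendsto_intros) auto
    then show ?thesis by (simp add: A_def)
  qed
  have i: "integrable lborel (\<lambda>\<xi>. (cmod (ft w \<xi>))\<^sup>2)"
    using integrable_monotone_convergence[OF A_int AE_I2[OF A_mono] AE_I2[OF A_ptw] A_lim] by simp
  then show "sqint (ft w)" by (intro sqintI) simp_all
  have "(LINT \<xi>|lborel. (cmod (ft w \<xi>))\<^sup>2) = 2 * pi * (nrm w)\<^sup>2"
    using integral_monotone_convergence[OF A_int AE_I2[OF A_mono] AE_I2[OF A_ptw] A_lim] by simp
  then show "nrm (ft w) = sqrt (2 * pi) * nrm w"
    by (simp add: nrm_def[of "ft w"] real_sqrt_mult)
qed

section \<open>The Fourier transform on square-integrable functions\<close>

lemma tendsto_pairing:
  assumes "\<And>i. sqint (a i)" "sqint a0" "\<And>i. sqint (b i)" "sqint b0"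
    "((\<lambda>i. nrm (\<lambda>x. a i x - a0 x)) \<longlongrightarrow> 0) F" "((\<lambda>i. nrm (\<lambda>x. b i x - b0 x)) \<longlongrightarrow> 0) F"
  shows "((\<lambda>i. LINT x|lborel. a i x * b i x) \<longlongrightarrow> (LINT x|lborel. a0 x * b0 x)) F"
proof -
  define A where "A i = nrm (\<lambda>x. a i x - a0 x)" for i
  define B where "B i = nrm (\<lambda>x. b i x - b0 x)" for i
  have AB: "(A \<longlongrightarrow> 0) F" "(B \<longlongrightarrow> 0) F"
    using assms(5,6) unfolding A_def B_def .
  have "((\<lambda>i. (LINT x|lborel. a i x * b i x) - (LINT x|lborel. a0 x * b0 x)) \<longlongrightarrow> 0) F"
  proof (rule Lim_null_comparison)
    have "((\<lambda>i. A i * B i + A i * nrm b0 + nrm a0 * B i) \<longlongrightarrow> 0 * 0 + 0 * nrm b0 + nrm a0 * 0) F"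
      by (intro tendsto_intros AB)
    then show "((\<lambda>i. A i * B i + A i * nrm b0 + nrm a0 * B i) \<longlongrightarrow> 0) F" by simp
    have "norm ((LINT x|lborel. a i x * b i x) - (LINT x|lborel. a0 x * b0 x)) \<le> A i * B i + A i * nrm b0 + nrm a0 * B i" for i
    proof -
      define p where "p = (\<lambda>x. a i x - a0 x)"
      define q where "q = (\<lambda>x. b i x - b0 x)"
      have pq: "sqint p" "sqint q" unfolding p_def q_def using assms by (auto intro: sqint_diff)
      note [simp] = sqint_mult_integrable[OF assms(1) assms(3)] sqint_mult_integrable[OF assms(2) assms(4)]
        sqint_mult_integrable[OF pq] sqint_mult_integrable[OF pq(1) assms(4)] sqint_mult_integrable[OF assms(2) pq(2)]
      have "(LINT x|lborel. a i x * b i x) - (LINT x|lborel. a0 x * b0 x) = (LINT x|lborel. a i x * b i x - a0 x * b0 x)"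
        by simp
      also have "\<dots> = (LINT x|lborel. p x * q x + p x * b0 x + a0 x * q x)"
        by (intro Bochner_Integration.integral_cong) (auto simp: p_def q_def algebra_simps)
      also have "\<dots> = (LINT x|lborel. p x * q x) + (LINT x|lborel. p x * b0 x) + (LINT x|lborel. a0 x * q x)"
        by simp
      also have "norm \<dots> \<le> norm (LINT x|lborel. p x * q x) + norm (LINT x|lborel. p x * b0 x) + norm (LINT x|lborel. a0 x * q x)"
        by (intro order_trans[OF norm_triangle_ineq] add_mono order_refl norm_triangle_ineq)
      also have "\<dots> \<le> A i * B i + A i * nrm b0 + nrm a0 * B i"
        unfolding A_def B_def p_def[symmetric] q_def[symmetric]
        by (intro add_mono integral_mult_bound pq assms)
      finally show ?thesis .
    qed
    then show "\<forall>\<^sub>F i in F. norm ((LINT x|lborel. a i x * b i x) - (LINT x|lborel. a0 x * b0 x)) \<le> A i * B i + A i * nrm b0 + nrm a0 * B i"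
      by simp
  qed
  then show ?thesis by (simp add: LIM_zero_iff)
qed

lemma tendsto_nrm:
  assumes "\<And>i. sqint (a i)" "sqint a0" "((\<lambda>i. nrm (\<lambda>x. a i x - a0 x)) \<longlongrightarrow> 0) F"
  shows "((\<lambda>i. nrm (a i)) \<longlongrightarrow> nrm a0) F"
proof -
  have "((\<lambda>i. nrm (a i) - nrm a0) \<longlongrightarrow> 0) F"
    by (rule Lim_null_comparison[OF _ assms(3)]) (simp add: nrm_diff_ineq assms)
  then show ?thesis by (simp add: LIM_zero_iff)
qed

definition trunc :: "real \<Rightarrow> (real \<Rightarrow> complex) \<Rightarrow> real \<Rightarrow> complex" where
  "trunc R w x = indicator {-R..R} x * w x"

lemma sqint_interval: "sqint (indicator {-R..R})"
  by (rule sqint_bounded_interval[where C=1 and R=R]) (auto simp: indicator_def)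

lemma sqint_trunc: "sqint w \<Longrightarrow> sqint (trunc R w)"
  unfolding trunc_def by (rule sqint_indicator) auto

lemma integrable_trunc: "sqint w \<Longrightarrow> integrable lborel (trunc R w)"
  unfolding trunc_def using sqint_mult_integrable[OF sqint_interval] by (simp add: trunc_def[abs_def])

lemma tendsto_trunc:
  assumes "sqint w" shows "((\<lambda>R. nrm (\<lambda>x. trunc R w x - w x)) \<longlongrightarrow> 0) at_top"
proof (rule tendsto_at_topI_sequentially)
  fix X :: "nat \<Rightarrow> real" assume X: "filterlim X at_top sequentially"
  note [measurable] = sqintD[OF assms] sqintD[OF sqint_trunc[OF assms]]
  show "(\<lambda>n. nrm (\<lambda>x. trunc (X n) w x - w x)) \<longlonglongrightarrow> 0"
  proof (rule tendsto_nrm_dominated[OF _ assms])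
    show "AE x in lborel. (\<lambda>n. trunc (X n) w x - w x) \<longlonglongrightarrow> 0"
    proof (rule AE_I2, rule tendsto_eventually)
      fix x
      have "\<forall>\<^sub>F n in sequentially. \<bar>x\<bar> \<le> X n" using X by (simp add: filterlim_at_top)
      then show "\<forall>\<^sub>F n in sequentially. trunc (X n) w x - w x = 0"
        by eventually_elim (auto simp: trunc_def indicator_def)
    qed
  qed (auto simp: trunc_def indicator_def)
qed

definition FT :: "(real \<Rightarrow> complex) \<Rightarrow> (real \<Rightarrow> complex) \<Rightarrow> bool" where
  "FT w g \<longleftrightarrow> sqint w \<and> sqint g \<and> ((\<lambda>R. nrm (\<lambda>\<xi>. ft (trunc R w) \<xi> - g \<xi>)) \<longlongrightarrow> 0) at_top"

lemma FT_sqint: "FT w g \<Longrightarrow> sqint w" "FT w g \<Longrightarrow> sqint g"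
  by (auto simp: FT_def)

lemma is_FT_iff: "is_FT u g \<longleftrightarrow> FT (\<lambda>x. of_real (u x)) g"
proof -
  have L: "L2 u \<longleftrightarrow> sqint (\<lambda>x. complex_of_real (u x))"
  proof -
    have "u \<in> borel_measurable borel" if "(\<lambda>x. complex_of_real (u x)) \<in> borel_measurable borel"
      using measurable_compose[OF that borel_measurable_Re] by (simp only: Re_complex_of_real)
    moreover have "(\<lambda>x. complex_of_real (u x)) \<in> borel_measurable borel" if "u \<in> borel_measurable borel"
      by (rule measurable_compose[OF that borel_measurable_of_real])
    ultimately have m: "(\<lambda>x. complex_of_real (u x)) \<in> borel_measurable lborel \<longleftrightarrow> u \<in> borel_measurable lborel"
      unfolding measurable_lborel2 by blast
    show ?thesis unfolding L2_def sqint_def m norm_of_real power2_abs ..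
  qed
  have ft: "fourier_trunc u R \<xi> = ft (trunc R (\<lambda>x. complex_of_real (u x))) \<xi>" for R \<xi>
    unfolding fourier_trunc_def ft_def trunc_def set_lebesgue_integral_def
    by (intro Bochner_Integration.integral_cong) (auto simp: indicator_def)
  have sq: "(((\<lambda>R. (N R)\<^sup>2) \<longlongrightarrow> 0) at_top) \<longleftrightarrow> ((N \<longlongrightarrow> 0) at_top)" for N :: "real \<Rightarrow> real"
    using tendsto_power[of N 0 at_top 2] tendsto_real_sqrt[of "\<lambda>R. (N R)\<^sup>2" 0 at_top]
    by (auto simp: tendsto_rabs_zero_iff)
  show ?thesis
    unfolding is_FT_def FT_def L ft
      sq[of "\<lambda>R. nrm (\<lambda>\<xi>. ft (trunc R (\<lambda>x. complex_of_real (u x))) \<xi> - g \<xi>)", unfolded nrm_sq]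
    unfolding sqint_def[of g] by (simp only: conj_assoc)
qed

lemma sqint_ft: "sqint w \<Longrightarrow> integrable lborel w \<Longrightarrow> sqint (ft w)"
  by (rule Plancherel_integrable)

lemma nrm_ft_diff:
  assumes "sqint v" "integrable lborel v" "sqint w" "integrable lborel w"
  shows "nrm (\<lambda>\<xi>. ft v \<xi> - ft w \<xi>) = sqrt (2 * pi) * nrm (\<lambda>x. v x - w x)"
  using Plancherel_integrable(2)[OF sqint_diff[OF assms(1,3)]] assms(2,4) ft_diff[OF assms(2,4)]
  by (simp add: ft_def[abs_def])

lemma FT_of_approx:
  assumes w: "sqint w" "sqint g" and v: "\<And>i. sqint (v i)" "\<And>i. integrable lborel (v i)"
    and lim: "((\<lambda>i. nrm (\<lambda>x. v i x - w x)) \<longlongrightarrow> 0) F" "((\<lambda>i. nrm (\<lambda>\<xi>. ft (v i) \<xi> - g \<xi>)) \<longlongrightarrow> 0) F"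
    and F: "F \<noteq> bot"
  shows "FT w g"
proof -
  let ?k = "sqrt (2 * pi)"
  have le: "nrm (\<lambda>\<xi>. ft (trunc R w) \<xi> - g \<xi>) \<le> ?k * nrm (\<lambda>x. trunc R w x - w x)" for R
  proof -
    note t = sqint_trunc[OF w(1), of R] integrable_trunc[OF w(1), of R]
    have "nrm (\<lambda>\<xi>. ft (trunc R w) \<xi> - g \<xi>) \<le> ?k * (nrm (\<lambda>x. trunc R w x - w x) + nrm (\<lambda>x. v i x - w x)) + nrm (\<lambda>\<xi>. ft (v i) \<xi> - g \<xi>)" for i
    proof -
      have "nrm (\<lambda>\<xi>. ft (trunc R w) \<xi> - g \<xi>) \<le> nrm (\<lambda>\<xi>. ft (trunc R w) \<xi> - ft (v i) \<xi>) + nrm (\<lambda>\<xi>. ft (v i) \<xi> - g \<xi>)"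
        by (intro nrm_triangle_via sqint_ft v t w)
      moreover have "nrm (\<lambda>x. trunc R w x - v i x) \<le> nrm (\<lambda>x. trunc R w x - w x) + nrm (\<lambda>x. v i x - w x)"
        using nrm_triangle_via[OF t(1) w(1) v(1)[of i]] nrm_minus_commute[of w "v i"] by simp
      from mult_left_mono[OF this, of ?k] have "nrm (\<lambda>\<xi>. ft (trunc R w) \<xi> - ft (v i) \<xi>)
          \<le> ?k * (nrm (\<lambda>x. trunc R w x - w x) + nrm (\<lambda>x. v i x - w x))"
        unfolding nrm_ft_diff[OF t v(1)[of i] v(2)[of i]] by simp
      ultimately show ?thesis by linarith
    qed
    moreover have "((\<lambda>i. ?k * (nrm (\<lambda>x. trunc R w x - w x) + nrm (\<lambda>x. v i x - w x)) + nrm (\<lambda>\<xi>. ft (v i) \<xi> - g \<xi>))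
        \<longlongrightarrow> ?k * (nrm (\<lambda>x. trunc R w x - w x) + 0) + 0) F"
      by (intro tendsto_intros lim)
    ultimately have "nrm (\<lambda>\<xi>. ft (trunc R w) \<xi> - g \<xi>) \<le> ?k * (nrm (\<lambda>x. trunc R w x - w x) + 0) + 0"
      by (intro tendsto_lowerbound[OF _ _ F]) auto
    then show ?thesis by simp
  qed
  have "((\<lambda>R. ?k * nrm (\<lambda>x. trunc R w x - w x)) \<longlongrightarrow> ?k * 0) at_top"
    by (intro tendsto_intros tendsto_trunc w)
  then have k0: "((\<lambda>R. ?k * nrm (\<lambda>x. trunc R w x - w x)) \<longlongrightarrow> 0) at_top"
    by (simp only: mult_zero_right)
  have "\<forall>R. norm (nrm (\<lambda>\<xi>. ft (trunc R w) \<xi> - g \<xi>)) \<le> ?k * nrm (\<lambda>x. trunc R w x - w x)"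
    unfolding real_norm_def abs_of_nonneg[OF nrm_nonneg] by (rule allI) (rule le)
  then have "((\<lambda>R. nrm (\<lambda>\<xi>. ft (trunc R w) \<xi> - g \<xi>)) \<longlongrightarrow> 0) at_top"
    by (rule Lim_null_comparison[OF always_eventually k0])
  then show ?thesis using w by (simp add: FT_def)
qed

lemma FT_ft: assumes "sqint w" "integrable lborel w" shows "FT w (ft w)"
  by (rule FT_of_approx[where v="\<lambda>_. w" and F=sequentially]) (use assms in \<open>auto simp: sqint_ft nrm_def\<close>)

theorem FT_exists: assumes "sqint w" shows "\<exists>g. FT w g"
proof -
  let ?k = "sqrt (2 * pi)"
  define v where "v n = trunc (real n) w" for n
  have v: "sqint (v n)" "integrable lborel (v n)" for n
    unfolding v_def using assms by (auto intro: sqint_trunc integrable_trunc)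
  have vlim: "(\<lambda>n. nrm (\<lambda>x. v n x - w x)) \<longlonglongrightarrow> 0"
    unfolding v_def by (rule filterlim_compose[OF tendsto_trunc[OF assms] filterlim_real_sequentially])
  have "\<exists>g. sqint g \<and> (\<lambda>n. nrm (\<lambda>\<xi>. ft (v n) \<xi> - g \<xi>)) \<longlonglongrightarrow> 0"
  proof (rule sqint_complete)
    fix e :: real assume "e > 0"
    then have "e / (2 * ?k) > 0" by simp
    from LIMSEQ_D[OF vlim this] obtain N where N: "\<And>n. n \<ge> N \<Longrightarrow> nrm (\<lambda>x. v n x - w x) < e / (2 * ?k)" by auto
    have "nrm (\<lambda>\<xi>. ft (v i) \<xi> - ft (v j) \<xi>) < e" if "i \<ge> N" "j \<ge> N" for i j
    proof -
      have "nrm (\<lambda>x. v i x - v j x) \<le> nrm (\<lambda>x. v i x - w x) + nrm (\<lambda>x. v j x - w x)"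
        using nrm_triangle_via[OF v(1)[of i] assms v(1)[of j]] nrm_minus_commute[of w "v j"] by simp
      also have "\<dots> < e / (2 * ?k) + e / (2 * ?k)" using N[OF that(1)] N[OF that(2)] by simp
      also have "\<dots> = e / ?k" by (simp add: field_simps)
      finally have "nrm (\<lambda>x. v i x - v j x) < e / ?k" .
      then have "?k * nrm (\<lambda>x. v i x - v j x) < e"
        by (subst (asm) pos_less_divide_eq) (auto simp: mult.commute)
      then show ?thesis unfolding nrm_ft_diff[OF v(1)[of i] v(2)[of i] v(1)[of j] v(2)[of j]] .
    qed
    then show "\<exists>N. \<forall>i\<ge>N. \<forall>j\<ge>N. nrm (\<lambda>\<xi>. ft (v i) \<xi> - ft (v j) \<xi>) < e" by blast
  qed (intro sqint_ft v)
  then obtain g where "sqint g" "(\<lambda>n. nrm (\<lambda>\<xi>. ft (v n) \<xi> - g \<xi>)) \<longlonglongrightarrow> 0" by blast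
  then show ?thesis using FT_of_approx[OF assms _ v vlim] by auto
qed

lemma FT_unique: assumes "FT w g" "FT w h" shows "AE \<xi> in lborel. g \<xi> = h \<xi>"
  using assms unfolding FT_def
  by (intro nrm_limit_unique[where s="\<lambda>R. ft (trunc R w)" and F=at_top])
     (auto intro: sqint_ft sqint_trunc integrable_trunc)

theorem FT_isometry: assumes "FT w g" shows "nrm g = sqrt (2 * pi) * nrm w"
proof -
  have w: "sqint w" "sqint g" using assms by (auto dest: FT_sqint)
  have "((\<lambda>R. nrm (ft (trunc R w))) \<longlongrightarrow> nrm g) at_top"
    using assms by (intro tendsto_nrm sqint_ft sqint_trunc integrable_trunc w) (simp add: FT_def)
  moreover have "((\<lambda>R. nrm (ft (trunc R w))) \<longlongrightarrow> sqrt (2 * pi) * nrm w) at_top"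
    unfolding Plancherel_integrable(2)[OF sqint_trunc[OF w(1)] integrable_trunc[OF w(1)]]
    by (intro tendsto_intros tendsto_nrm sqint_trunc w tendsto_trunc)
  ultimately show ?thesis using tendsto_unique[OF trivial_limit_at_top_linorder] by blast
qed

lemma FT_lincomb:
  assumes "FT w g" "FT v h"
  shows "FT (\<lambda>x. a * w x + b * v x) (\<lambda>\<xi>. a * g \<xi> + b * h \<xi>)"
proof -
  note s = FT_sqint[OF assms(1)] FT_sqint[OF assms(2)]
  have "((\<lambda>R. nrm (\<lambda>\<xi>. ft (trunc R (\<lambda>x. a * w x + b * v x)) \<xi> - (a * g \<xi> + b * h \<xi>))) \<longlongrightarrow> 0) at_top"
  proof (rule Lim_null_comparison)
    have "((\<lambda>R. cmod a * nrm (\<lambda>\<xi>. ft (trunc R w) \<xi> - g \<xi>) + cmod b * nrm (\<lambda>\<xi>. ft (trunc R v) \<xi> - h \<xi>))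
      \<longlongrightarrow> cmod a * 0 + cmod b * 0) at_top"
      using assms by (intro tendsto_intros) (auto simp: FT_def)
    then show "((\<lambda>R. cmod a * nrm (\<lambda>\<xi>. ft (trunc R w) \<xi> - g \<xi>) + cmod b * nrm (\<lambda>\<xi>. ft (trunc R v) \<xi> - h \<xi>))
      \<longlongrightarrow> 0) at_top" by simp
    have "nrm (\<lambda>\<xi>. ft (trunc R (\<lambda>x. a * w x + b * v x)) \<xi> - (a * g \<xi> + b * h \<xi>))
      \<le> cmod a * nrm (\<lambda>\<xi>. ft (trunc R w) \<xi> - g \<xi>) + cmod b * nrm (\<lambda>\<xi>. ft (trunc R v) \<xi> - h \<xi>)" for R
    proof -
      have "trunc R (\<lambda>x. a * w x + b * v x) = (\<lambda>x. a * trunc R w x + b * trunc R v x)"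
        by (auto simp: trunc_def algebra_simps)
      then have eq: "ft (trunc R (\<lambda>x. a * w x + b * v x)) \<xi> - (a * g \<xi> + b * h \<xi>)
          = a * (ft (trunc R w) \<xi> - g \<xi>) + b * (ft (trunc R v) \<xi> - h \<xi>)" for \<xi>
        by (simp add: ft_lincomb[OF integrable_trunc[OF s(1)] integrable_trunc[OF s(3)]] algebra_simps)
      show ?thesis unfolding eq nrm_cmult[symmetric]
        by (intro nrm_triangle sqint_cmult sqint_diff sqint_ft sqint_trunc integrable_trunc s)
    qed
    then show "\<forall>\<^sub>F R in at_top. norm (nrm (\<lambda>\<xi>. ft (trunc R (\<lambda>x. a * w x + b * v x)) \<xi> - (a * g \<xi> + b * h \<xi>)))
      \<le> cmod a * nrm (\<lambda>\<xi>. ft (trunc R w) \<xi> - g \<xi>) + cmod b * nrm (\<lambda>\<xi>. ft (trunc R v) \<xi> - h \<xi>)" by simp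
  qed
  then show ?thesis using s by (auto simp: FT_def intro!: sqint_add sqint_cmult)
qed

lemma FT_cmult: "FT w g \<Longrightarrow> FT (\<lambda>x. a * w x) (\<lambda>\<xi>. a * g \<xi>)"
  using FT_lincomb[of w g w g a 0] by simp

lemma FT_diff: "FT w g \<Longrightarrow> FT v h \<Longrightarrow> FT (\<lambda>x. w x - v x) (\<lambda>\<xi>. g \<xi> - h \<xi>)"
  using FT_lincomb[of w g v h 1 "-1"] by simp

lemma FT_cong_AE:
  assumes "FT w g" "AE x in lborel. w x = w' x" "w' \<in> borel_measurable borel"
    "AE x in lborel. g x = g' x" "g' \<in> borel_measurable borel"
  shows "FT w' g'"
proof -
  note s = FT_sqint[OF assms(1)]
  have w': "AE x in lborel. cmod (w' x) \<le> 1 * cmod (w x)"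
    using assms(2) by eventually_elim simp
  have g': "AE x in lborel. cmod (g' x) \<le> 1 * cmod (g x)"
    using assms(4) by eventually_elim simp
  have s': "sqint w'" "sqint g'"
    using sqint_mono[OF s(1) _ w'] sqint_mono[OF s(2) _ g'] assms(3,5) by simp_all
  note [measurable] = sqintD[OF s(1)] assms(3,5) sqintD[OF s(2)]
  have "ft (trunc R w') \<xi> = ft (trunc R w) \<xi>" for R \<xi>
    unfolding ft_def
  proof (rule integral_cong_AE)
    show "AE x in lborel. trunc R w' x * cis (- (x * \<xi>)) = trunc R w x * cis (- (x * \<xi>))"
      using assms(2) by eventually_elim (simp add: trunc_def)
  qed (simp_all add: trunc_def)
  moreover have "nrm (\<lambda>\<xi>. ft (trunc R w) \<xi> - g' \<xi>) = nrm (\<lambda>\<xi>. ft (trunc R w) \<xi> - g \<xi>)" for R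
  proof (rule nrm_cong_AE)
    show "AE \<xi> in lborel. cmod (ft (trunc R w) \<xi> - g' \<xi>) = cmod (ft (trunc R w) \<xi> - g \<xi>)"
      using assms(4) by eventually_elim simp
  qed (use sqintD[OF sqint_trunc[OF s(1)]] in auto)
  ultimately show ?thesis using assms(1) s' by (simp add: FT_def)
qed

theorem FT_mult_formula:
  assumes "FT w g" "FT v h"
  shows "(LINT x|lborel. g x * v x) = (LINT x|lborel. w x * h x)"
proof -
  note s = FT_sqint[OF assms(1)] FT_sqint[OF assms(2)]
  have "((\<lambda>R. LINT x|lborel. ft (trunc R w) x * trunc R v x) \<longlongrightarrow> (LINT x|lborel. g x * v x)) at_top"
    using assms by (intro tendsto_pairing sqint_ft sqint_trunc integrable_trunc s tendsto_trunc) (auto simp: FT_def)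
  moreover have "((\<lambda>R. LINT x|lborel. trunc R w x * ft (trunc R v) x) \<longlongrightarrow> (LINT x|lborel. w x * h x)) at_top"
    using assms by (intro tendsto_pairing sqint_ft sqint_trunc integrable_trunc s tendsto_trunc) (auto simp: FT_def)
  ultimately show ?thesis
    unfolding ft_mult_formula[OF integrable_trunc[OF s(1)] integrable_trunc[OF s(3)]]
    using tendsto_unique[OF trivial_limit_at_top_linorder] by blast
qed

text \<open>Inversion: the difference of the two sides has norm zero, by expanding its square with the
  isometry property and the multiplication formula.\<close>

theorem FT_inversion:
  assumes "FT w g" shows "FT (\<lambda>\<xi>. cnj (g \<xi>)) (\<lambda>x. 2 * pi * cnj (w x))"
proof -
  note s = FT_sqint[OF assms]
  obtain h where h: "FT (\<lambda>\<xi>. cnj (g \<xi>)) h" using FT_exists[OF sqint_cnj[OF s(2)]] by blast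
  note sh = FT_sqint(2)[OF h]
  have sw: "sqint (\<lambda>x. 2 * pi * cnj (w x))" by (intro sqint_cmult sqint_cnj s)
  have n1: "(nrm g)\<^sup>2 = 2 * pi * (nrm w)\<^sup>2" unfolding FT_isometry[OF assms] by (simp add: power_mult_distrib)
  have n2: "(nrm h)\<^sup>2 = 2 * pi * (nrm g)\<^sup>2" unfolding FT_isometry[OF h] by (simp add: power_mult_distrib)
  have n3: "(nrm (\<lambda>x. 2 * pi * cnj (w x)))\<^sup>2 = 4 * pi\<^sup>2 * (nrm w)\<^sup>2"
    using nrm_cmult[of "2 * pi" "\<lambda>x. cnj (w x)"] by (simp add: power_mult_distrib)
  have "(LINT x|lborel. h x * cnj (2 * pi * cnj (w x))) = 2 * pi * (LINT x|lborel. h x * w x)"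
    by (simp add: mult_ac flip: integral_mult_right_zero)
  also have "(LINT x|lborel. h x * w x) = (LINT x|lborel. cnj (g x) * g x)"
    by (rule FT_mult_formula[OF h assms])
  finally have "Re (LINT x|lborel. h x * cnj (2 * pi * cnj (w x))) = 2 * pi * (nrm g)\<^sup>2"
    using nrm_sq_pairing[OF s(2)] by (simp add: mult.commute)
  then have "(nrm (\<lambda>x. h x - 2 * pi * cnj (w x)))\<^sup>2 = 0"
    using nrm_diff_sq_expand[OF sh sw] unfolding n3 n2 n1 by (simp add: power2_eq_square)
  then have "nrm (\<lambda>x. h x - 2 * pi * cnj (w x)) = 0" by simp
  from nrm_eq_0[OF sqint_diff[OF sh sw] this] have "AE x in lborel. h x = 2 * pi * cnj (w x)" by simp
  then show ?thesis using sqintD[OF sqint_cnj[OF s(2)]] sqintD[OF sw] by (intro FT_cong_AE[OF h]) auto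
qed

theorem FT_surj: assumes "sqint g" shows "\<exists>w. FT w g"
proof -
  obtain h where "FT (\<lambda>\<xi>. cnj (g \<xi>)) h" using FT_exists[OF sqint_cnj[OF assms]] by blast
  from FT_cmult[OF FT_inversion[OF this], of "1 / (2 * pi)"]
  show ?thesis by auto
qed

lemma sqint_uminus:
  assumes "sqint w" shows "sqint (\<lambda>x. w (- x))" "nrm (\<lambda>x. w (- x)) = nrm w"
proof -
  have "integrable lborel (\<lambda>x. (cmod (w (0 + (-1) * x)))\<^sup>2)"
    using lborel_integrable_real_affine[OF sqint_integrable[OF assms], of "-1" 0] by simp
  then show "sqint (\<lambda>x. w (- x))"
    using sqintD[OF assms] by (intro sqintI) simp_all
  show "nrm (\<lambda>x. w (- x)) = nrm w"
    unfolding nrm_def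
    using lborel_integral_real_affine[of "-1" "\<lambda>x. (cmod (w x))\<^sup>2" 0] by simp
qed

lemma FT_cnj: assumes "FT w g" shows "FT (\<lambda>x. cnj (w x)) (\<lambda>\<xi>. cnj (g (- \<xi>)))"
proof -
  note s = FT_sqint[OF assms]
  have eq: "ft (trunc R (\<lambda>x. cnj (w x))) \<xi> = cnj (ft (trunc R w) (- \<xi>))" for R \<xi>
    unfolding ft_def Bochner_Integration.integral_cnj[symmetric]
    by (intro Bochner_Integration.integral_cong) (auto simp: trunc_def indicator_def cis_cnj)
  have "nrm (\<lambda>\<xi>. ft (trunc R (\<lambda>x. cnj (w x))) \<xi> - cnj (g (- \<xi>))) = nrm (\<lambda>\<xi>. ft (trunc R w) \<xi> - g \<xi>)" for R
  proof -
    have "nrm (\<lambda>\<xi>. ft (trunc R (\<lambda>x. cnj (w x))) \<xi> - cnj (g (- \<xi>))) = nrm (\<lambda>\<xi>. cnj (ft (trunc R w) (- \<xi>) - g (- \<xi>)))"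
      by (simp add: eq)
    also have "\<dots> = nrm (\<lambda>\<xi>. ft (trunc R w) (- \<xi>) - g (- \<xi>))" by (rule nrm_cnj)
    also have "\<dots> = nrm (\<lambda>\<xi>. ft (trunc R w) \<xi> - g \<xi>)"
      using sqint_uminus(2)[OF sqint_diff[OF sqint_ft[OF sqint_trunc[OF s(1)] integrable_trunc[OF s(1)]] s(2)]] by simp
    finally show ?thesis .
  qed
  then show ?thesis using assms sqint_cnj[OF sqint_uminus(1)[OF s(2)]] by (simp add: FT_def sqint_cnj)
qed

lemma FT_shift: assumes "FT w g" shows "FT (\<lambda>x. w (x + t)) (\<lambda>\<xi>. cis (t * \<xi>) * g \<xi>)"
proof -
  note s = FT_sqint[OF assms]
  have sg: "sqint (\<lambda>\<xi>. cis (t * \<xi>) * g \<xi>)"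
    by (rule sqint_mono[OF s(2), where C=1]) (use sqintD[OF s(2)] in \<open>auto simp: norm_mult\<close>)
  have ts: "sqint (trunc R w)" "integrable lborel (trunc R w)" for R
    using s by (auto intro: sqint_trunc integrable_trunc)
  have int: "integrable lborel (\<lambda>x. trunc R w (x + t))" for R
    using lborel_integrable_real_affine[OF ts(2)[of R], of 1 t] by (simp add: add.commute)
  have eq: "ft (\<lambda>x. trunc R w (x + t)) \<xi> = cis (t * \<xi>) * ft (trunc R w) \<xi>" for R \<xi>
  proof -
    have "ft (\<lambda>x. trunc R w (x + t)) \<xi> = (LINT x|lborel. trunc R w ((-t + 1 * x) + t) * cis (- ((-t + 1 * x) * \<xi>)))"
      unfolding ft_def using lborel_integral_real_affine[of 1 "\<lambda>x. trunc R w (x + t) * cis (- (x * \<xi>))" "-t"] by simp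
    also have "\<dots> = (LINT x|lborel. cis (t * \<xi>) * (trunc R w x * cis (- (x * \<xi>))))"
      by (intro Bochner_Integration.integral_cong) (auto simp: cis_mult algebra_simps)
    finally show ?thesis by (simp add: ft_def)
  qed
  show ?thesis
  proof (rule FT_of_approx[where v="\<lambda>R x. trunc R w (x + t)" and F=at_top])
    have "nrm (\<lambda>x. trunc R w (x + t) - w (x + t)) = nrm (\<lambda>x. trunc R w x - w x)" for R
      using sqint_shift(2)[OF sqint_diff[OF ts(1) s(1)], of R t] by simp
    then show "((\<lambda>R. nrm (\<lambda>x. trunc R w (x + t) - w (x + t))) \<longlongrightarrow> 0) at_top"
      using tendsto_trunc[OF s(1)] by simp
    have "nrm (\<lambda>\<xi>. ft (\<lambda>x. trunc R w (x + t)) \<xi> - cis (t * \<xi>) * g \<xi>) = nrm (\<lambda>\<xi>. ft (trunc R w) \<xi> - g \<xi>)" for R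
      by (simp add: nrm_def eq norm_mult flip: right_diff_distrib)
    then show "((\<lambda>R. nrm (\<lambda>\<xi>. ft (\<lambda>x. trunc R w (x + t)) \<xi> - cis (t * \<xi>) * g \<xi>)) \<longlongrightarrow> 0) at_top"
      using assms by (simp add: FT_def)
  qed (use sqint_shift(1)[OF s(1)] sqint_shift(1)[OF ts(1)] sg int in auto)
qed

lemma FT_real_hermitian:
  assumes "FT (\<lambda>x. of_real (u x)) g" shows "AE \<xi> in lborel. g (- \<xi>) = cnj (g \<xi>)"
proof -
  have "FT (\<lambda>x. of_real (u x)) (\<lambda>\<xi>. cnj (g (- \<xi>)))" using FT_cnj[OF assms] by simp
  from FT_unique[OF this assms] show ?thesis
    by eventually_elim (metis complex_cnj_cnj)
qed

lemma FT_hermitian_real: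
  assumes "sqint g" "AE \<xi> in lborel. g (- \<xi>) = cnj (g \<xi>)"
  shows "\<exists>u. FT (\<lambda>x. of_real (u x)) g"
proof -
  obtain w where w: "FT w g" using FT_surj[OF assms(1)] by blast
  note s = FT_sqint[OF w]
  note [measurable] = sqintD[OF s(1)] sqintD[OF s(2)]
  have "FT (\<lambda>x. cnj (w x)) g"
    by (rule FT_cong_AE[OF FT_cnj[OF w]]) (use assms(2) in \<open>auto elim: eventually_mono\<close>)
  from FT_lincomb[OF w this, of "1/2" "1/2"]
  have "FT (\<lambda>x. of_real (Re (w x))) g"
    by (rule FT_cong_AE) (auto simp: complex_eq_iff)
  then show ?thesis by (intro exI[of _ "\<lambda>x. Re (w x)"])
qed

section \<open>Fourier multipliers and the energy space\<close>

lemma is_FT_FT: "is_FT u g \<Longrightarrow> FT (\<lambda>x. of_real (u x)) g"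
  by (simp add: is_FT_iff)

lemma is_FT_measurable: assumes "is_FT u g" shows "u \<in> borel_measurable borel" "g \<in> borel_measurable borel"
  using assms by (auto simp: is_FT_def L2_def)

lemma is_FT_sqint: assumes "is_FT u g" shows "sqint (\<lambda>x. of_real (u x))" "sqint g"
  using FT_sqint[OF is_FT_FT[OF assms]] by auto

lemma is_FT_lincomb:
  assumes "is_FT u g" "is_FT v h"
  shows "is_FT (\<lambda>x. a * u x + b * v x) (\<lambda>\<xi>. of_real a * g \<xi> + of_real b * h \<xi>)"
  using FT_lincomb[OF is_FT_FT[OF assms(1)] is_FT_FT[OF assms(2)], of "of_real a" "of_real b"]
  by (simp add: is_FT_iff)

lemma Parseval:
  assumes "is_FT u g" "is_FT v h"
  shows "2 * pi * (LINT x|lborel. u x * v x) = Re (LINT \<xi>|lborel. g \<xi> * cnj (h \<xi>))"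
proof -
  have "(LINT \<xi>|lborel. g \<xi> * cnj (h \<xi>)) = (LINT x|lborel. of_real (u x) * (2 * pi * cnj (of_real (v x))))"
    by (rule FT_mult_formula[OF is_FT_FT[OF assms(1)] FT_inversion[OF is_FT_FT[OF assms(2)]]])
  also have "\<dots> = (LINT x|lborel. of_real (2 * pi * (u x * v x)))"
    by (intro Bochner_Integration.integral_cong) (auto simp: mult_ac)
  also have "\<dots> = of_real (2 * pi * (LINT x|lborel. u x * v x))"
    by (simp only: integral_complex_of_real integral_mult_right_zero)
  finally show ?thesis by simp
qed

lemma fmult_is_FT:
  assumes "fmult m u v" "is_FT u g" "m \<in> borel_measurable borel"
  shows "is_FT v (\<lambda>\<xi>. m \<xi> * g \<xi>)"
proof -
  obtain g' h where gh: "is_FT u g'" "is_FT v h" "AE \<xi> in lborel. h \<xi> = m \<xi> * g' \<xi>"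
    using assms(1) unfolding fmult_def by blast
  have "AE \<xi> in lborel. g' \<xi> = g \<xi>"
    by (rule FT_unique[OF is_FT_FT[OF gh(1)] is_FT_FT[OF assms(2)]])
  with gh(3) have "AE \<xi> in lborel. h \<xi> = m \<xi> * g \<xi>" by eventually_elim simp
  moreover have "(\<lambda>\<xi>. m \<xi> * g \<xi>) \<in> borel_measurable borel"
    using assms(3) is_FT_measurable(2)[OF assms(2)] by measurable
  ultimately show ?thesis
    unfolding is_FT_iff using is_FT_measurable(1)[OF gh(2)]
    by (intro FT_cong_AE[OF is_FT_FT[OF gh(2)]]) auto
qed

lemma fmult_exists:
  assumes "is_FT u g" "m \<in> borel_measurable borel" "sqint (\<lambda>\<xi>. m \<xi> * g \<xi>)" "\<And>\<xi>. m (- \<xi>) = cnj (m \<xi>)"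
  shows "\<exists>v. fmult m u v"
proof -
  have "AE \<xi> in lborel. g (- \<xi>) = cnj (g \<xi>)" by (rule FT_real_hermitian[OF is_FT_FT[OF assms(1)]])
  then have "AE \<xi> in lborel. m (- \<xi>) * g (- \<xi>) = cnj (m \<xi> * g \<xi>)"
    by eventually_elim (simp add: assms(4))
  from FT_hermitian_real[OF assms(3) this] show ?thesis
    unfolding fmult_def is_FT_iff[symmetric] using assms(1) by auto
qed

lemma sym_Dhalf_measurable[measurable]: "sym_Dhalf \<in> borel_measurable borel"
  unfolding sym_Dhalf_def by measurable

lemma sym_dinv_measurable[measurable]: "sym_dinv \<in> borel_measurable borel"
  unfolding sym_dinv_def by measurable

definition XF :: "(real \<Rightarrow> real) \<Rightarrow> (real \<Rightarrow> complex) \<Rightarrow> bool" where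
  "XF u g \<longleftrightarrow> is_FT u g \<and> sqint (\<lambda>\<xi>. sym_Dhalf \<xi> * g \<xi>) \<and> sqint (\<lambda>\<xi>. sym_dinv \<xi> * g \<xi>)"

text \<open>The square root of the weight $(1+\xi^2)^{1/2}$ in the definition of \<^const>\<open>H_half\<close>.\<close>

definition hw :: "real \<Rightarrow> complex" where
  "hw \<xi> = of_real (sqrt (sqrt (1 + \<xi>\<^sup>2)))"

lemma hw_measurable[measurable]: "hw \<in> borel_measurable borel"
  unfolding hw_def by measurable

lemma cmod_hw_sq: "(cmod (hw \<xi>))\<^sup>2 = sqrt (1 + \<xi>\<^sup>2)"
  by (simp add: hw_def)

lemma cmod_hw_ge_1: "1 \<le> cmod (hw \<xi>)"
  by (simp add: hw_def)

lemma abs_le_hw_sq: "\<bar>\<xi>\<bar> \<le> (cmod (hw \<xi>))\<^sup>2"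
  unfolding cmod_hw_sq by (rule real_le_rsqrt) simp

lemma hw_sq_le: "(cmod (hw \<xi>))\<^sup>2 \<le> 1 + \<bar>\<xi>\<bar>"
  unfolding cmod_hw_sq by (rule real_le_lsqrt) (auto simp: power2_sum)

lemma H_half_iff: "H_half u \<longleftrightarrow> (\<exists>g. is_FT u g \<and> sqint (\<lambda>\<xi>. hw \<xi> * g \<xi>))"
proof -
  have "integrable lborel (\<lambda>\<xi>. (1 + \<xi>\<^sup>2) powr (1/2) * (cmod (g \<xi>))\<^sup>2) \<longleftrightarrow> sqint (\<lambda>\<xi>. hw \<xi> * g \<xi>)"
    if "is_FT u g" for g
  proof -
    have [measurable]: "g \<in> borel_measurable borel" using is_FT_measurable[OF that] by simp
    have m: "(\<lambda>\<xi>. hw \<xi> * g \<xi>) \<in> borel_measurable lborel" by measurable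
    have "(1 + \<xi>\<^sup>2) powr (1/2) * (cmod (g \<xi>))\<^sup>2 = (cmod (hw \<xi> * g \<xi>))\<^sup>2" for \<xi>
      by (simp add: norm_mult power_mult_distrib cmod_hw_sq powr_half_sqrt)
    then show ?thesis using m unfolding sqint_def by (simp only: simp_thms)
  qed
  then show ?thesis unfolding H_half_def by blast
qed

lemma sqint_hw_iff:
  assumes "sqint g" shows "sqint (\<lambda>\<xi>. hw \<xi> * g \<xi>) \<longleftrightarrow> sqint (\<lambda>\<xi>. sym_Dhalf \<xi> * g \<xi>)"
proof
  have [measurable]: "g \<in> borel_measurable borel" by (rule sqintD[OF assms])
  assume h: "sqint (\<lambda>\<xi>. hw \<xi> * g \<xi>)"
  show "sqint (\<lambda>\<xi>. sym_Dhalf \<xi> * g \<xi>)"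
  proof (rule sqint_mono[OF h, where C=1])
    have "cmod (sym_Dhalf \<xi>) \<le> cmod (hw \<xi>)" for \<xi>
      by (rule power2_le_imp_le) (use abs_le_hw_sq[of \<xi>] in \<open>simp_all add: sym_Dhalf_def\<close>)
    then show "AE \<xi> in lborel. cmod (sym_Dhalf \<xi> * g \<xi>) \<le> 1 * cmod (hw \<xi> * g \<xi>)"
      by (auto simp: norm_mult intro!: mult_right_mono)
  qed measurable
next
  have [measurable]: "g \<in> borel_measurable borel" by (rule sqintD[OF assms])
  assume h: "sqint (\<lambda>\<xi>. sym_Dhalf \<xi> * g \<xi>)"
  have "sqint (\<lambda>\<xi>. of_real (cmod (g \<xi>)) + of_real (cmod (sym_Dhalf \<xi> * g \<xi>)))"
    by (intro sqint_add sqint_norm assms h)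
  then show "sqint (\<lambda>\<xi>. hw \<xi> * g \<xi>)"
  proof (rule sqint_mono[where C=1])
    have "cmod (hw \<xi>) \<le> 1 + cmod (sym_Dhalf \<xi>)" for \<xi>
    proof (rule power2_le_imp_le)
      have "(cmod (hw \<xi>))\<^sup>2 \<le> 1 + \<bar>\<xi>\<bar>" by (rule hw_sq_le)
      also have "\<dots> \<le> (1 + cmod (sym_Dhalf \<xi>))\<^sup>2" by (simp add: sym_Dhalf_def power2_sum)
      finally show "(cmod (hw \<xi>))\<^sup>2 \<le> (1 + cmod (sym_Dhalf \<xi>))\<^sup>2" .
    qed simp
    then have "cmod (hw \<xi>) * cmod (g \<xi>) \<le> (1 + cmod (sym_Dhalf \<xi>)) * cmod (g \<xi>)" for \<xi>
      by (rule mult_right_mono) simp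
    moreover have "cmod (complex_of_real (cmod (g \<xi>)) + complex_of_real (cmod (sym_Dhalf \<xi> * g \<xi>)))
        = (1 + cmod (sym_Dhalf \<xi>)) * cmod (g \<xi>)" for \<xi>
      by (simp only: of_real_add[symmetric] norm_of_real) (simp add: norm_mult distrib_right)
    ultimately show "AE \<xi> in lborel. cmod (hw \<xi> * g \<xi>)
        \<le> 1 * cmod (complex_of_real (cmod (g \<xi>)) + complex_of_real (cmod (sym_Dhalf \<xi> * g \<xi>)))"
      by (simp add: norm_mult)
  qed measurable
qed

lemma in_X_iff: "in_X u \<longleftrightarrow> (\<exists>g. XF u g)"
proof
  assume "in_X u"
  then obtain g w where g: "is_FT u g" "sqint (\<lambda>\<xi>. hw \<xi> * g \<xi>)" and w: "fmult sym_dinv u w"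
    by (auto simp: in_X_def H_half_iff)
  have "sqint (\<lambda>\<xi>. sym_dinv \<xi> * g \<xi>)"
    using is_FT_sqint(2)[OF fmult_is_FT[OF w g(1)]] by simp
  then show "\<exists>g. XF u g" using g sqint_hw_iff[OF is_FT_sqint(2)[OF g(1)]] by (auto simp: XF_def)
next
  assume "\<exists>g. XF u g"
  then obtain g where g: "is_FT u g" "sqint (\<lambda>\<xi>. sym_Dhalf \<xi> * g \<xi>)" "sqint (\<lambda>\<xi>. sym_dinv \<xi> * g \<xi>)"
    by (auto simp: XF_def)
  have "\<exists>v. fmult sym_dinv u v"
    by (rule fmult_exists[OF g(1) _ g(3)]) (auto simp: sym_dinv_def)
  then show "in_X u"
    using g sqint_hw_iff[OF is_FT_sqint(2)[OF g(1)]] by (auto simp: in_X_def H_half_iff)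
qed

lemma XF_Dhalf: assumes "XF u g" shows "is_FT (Dhalf u) (\<lambda>\<xi>. sym_Dhalf \<xi> * g \<xi>)"
proof -
  have g: "is_FT u g" "sqint (\<lambda>\<xi>. sym_Dhalf \<xi> * g \<xi>)" using assms by (auto simp: XF_def)
  have "\<exists>v. fmult sym_Dhalf u v"
    by (rule fmult_exists[OF g(1) _ g(2)]) (auto simp: sym_Dhalf_def)
  then have "fmult sym_Dhalf u (Dhalf u)" unfolding Dhalf_def by (rule someI_ex)
  from fmult_is_FT[OF this g(1)] show ?thesis by simp
qed

lemma XF_dinv: assumes "XF u g" shows "is_FT (dinv u) (\<lambda>\<xi>. sym_dinv \<xi> * g \<xi>)"
proof -
  have g: "is_FT u g" "sqint (\<lambda>\<xi>. sym_dinv \<xi> * g \<xi>)" using assms by (auto simp: XF_def)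
  have "\<exists>v. fmult sym_dinv u v"
    by (rule fmult_exists[OF g(1) _ g(2)]) (auto simp: sym_dinv_def)
  then have "fmult sym_dinv u (dinv u)" unfolding dinv_def by (rule someI_ex)
  from fmult_is_FT[OF this g(1)] show ?thesis by simp
qed

section \<open>Sharp frequency cutoff and the embedding of $H^{1/2}$ into $L^r$\<close>

definition lowpass :: "real \<Rightarrow> (real \<Rightarrow> complex) \<Rightarrow> real \<Rightarrow> complex" where
  "lowpass N g x = cnj (ft (trunc N (\<lambda>\<xi>. cnj (g \<xi>))) x) / (2 * pi)"

lemma FT_lowpass: assumes "sqint g" shows "FT (lowpass N g) (trunc N g)"
proof -
  have s: "sqint (trunc N (\<lambda>\<xi>. cnj (g \<xi>)))" "integrable lborel (trunc N (\<lambda>\<xi>. cnj (g \<xi>)))"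
    using sqint_cnj[OF assms] by (auto intro: sqint_trunc integrable_trunc)
  from FT_cmult[OF FT_inversion[OF FT_ft[OF s]], of "1 / (2 * pi)"]
  have "FT (\<lambda>x. 1 / (2 * pi) * cnj (ft (trunc N (\<lambda>\<xi>. cnj (g \<xi>))) x)) (\<lambda>\<xi>. 1 / (2 * pi) * (2 * pi * cnj (trunc N (\<lambda>\<xi>. cnj (g \<xi>)) \<xi>)))"
    by simp
  moreover have "(\<lambda>x. 1 / (2 * pi) * cnj (ft (trunc N (\<lambda>\<xi>. cnj (g \<xi>))) x)) = lowpass N g"
    by (auto simp: lowpass_def)
  moreover have "(\<lambda>\<xi>. 1 / (2 * pi) * (2 * pi * cnj (trunc N (\<lambda>\<xi>. cnj (g \<xi>)) \<xi>))) = trunc N g"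
    by (auto simp: trunc_def indicator_def)
  ultimately show ?thesis by simp
qed

definition HB :: "real \<Rightarrow> (real \<Rightarrow> real) \<Rightarrow> (real \<Rightarrow> complex) \<Rightarrow> bool" where
  "HB M u g \<longleftrightarrow> is_FT u g \<and> sqint (\<lambda>\<xi>. hw \<xi> * g \<xi>) \<and> nrm (\<lambda>\<xi>. hw \<xi> * g \<xi>) \<le> M"

lemma sqrt_2pi_ge_1: "1 \<le> sqrt (2 * pi)"
  using pi_ge_two by simp

lemma HB_nrm: assumes "HB M u g" shows "nrm g \<le> M" "nrm (\<lambda>x. of_real (u x)) \<le> M"
proof -
  have g: "is_FT u g" "sqint (\<lambda>\<xi>. hw \<xi> * g \<xi>)" "nrm (\<lambda>\<xi>. hw \<xi> * g \<xi>) \<le> M" using assms by (auto simp: HB_def)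
  have "cmod (g \<xi>) \<le> cmod (hw \<xi> * g \<xi>)" for \<xi>
    using mult_right_mono[OF cmod_hw_ge_1, of "cmod (g \<xi>)" \<xi>] by (simp add: norm_mult)
  then have "nrm g \<le> nrm (\<lambda>\<xi>. hw \<xi> * g \<xi>)"
    by (intro nrm_mono[OF g(2)]) (use is_FT_measurable[OF g(1)] in auto)
  then show 1: "nrm g \<le> M" using g(3) by simp
  have "1 * nrm (\<lambda>x. of_real (u x)) \<le> sqrt (2 * pi) * nrm (\<lambda>x. of_real (u x))"
    by (rule mult_right_mono[OF sqrt_2pi_ge_1]) simp
  also have "\<dots> = nrm g" by (rule FT_isometry[OF is_FT_FT[OF g(1)], symmetric])
  finally show "nrm (\<lambda>x. of_real (u x)) \<le> M" using 1 by simp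
qed

lemma nrm_lowpass_diff:
  assumes "HB M u g" "N > 0"
  shows "(nrm (\<lambda>x. of_real (u x) - lowpass N g x))\<^sup>2 \<le> M\<^sup>2 / N"
proof -
  have g: "is_FT u g" "sqint (\<lambda>\<xi>. hw \<xi> * g \<xi>)" "nrm (\<lambda>\<xi>. hw \<xi> * g \<xi>) \<le> M" using assms by (auto simp: HB_def)
  note sg = is_FT_sqint(2)[OF g(1)]
  let ?n = "nrm (\<lambda>x. of_real (u x) - lowpass N g x)"
  have [measurable]: "g \<in> borel_measurable borel" "trunc N g \<in> borel_measurable borel"
    using sg sqint_trunc[OF sg] sqintD by auto
  have "FT (\<lambda>x. of_real (u x) - lowpass N g x) (\<lambda>\<xi>. g \<xi> - trunc N g \<xi>)"
    by (rule FT_diff[OF is_FT_FT[OF g(1)] FT_lowpass[OF sg]])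
  from FT_isometry[OF this] have "?n \<le> nrm (\<lambda>\<xi>. g \<xi> - trunc N g \<xi>)"
    using mult_right_mono[OF sqrt_2pi_ge_1, of ?n] by simp
  also have "\<dots> \<le> nrm (\<lambda>\<xi>. of_real (1 / sqrt N) * (hw \<xi> * g \<xi>))"
  proof (rule nrm_mono)
    show "sqint (\<lambda>\<xi>. of_real (1 / sqrt N) * (hw \<xi> * g \<xi>))" by (rule sqint_cmult[OF g(2)])
    have "cmod (g \<xi> - trunc N g \<xi>) \<le> cmod (of_real (1 / sqrt N) * (hw \<xi> * g \<xi>))" for \<xi>
    proof (cases "\<xi> \<in> {-N..N}")
      case True
      then show ?thesis by (simp add: trunc_def)
    next
      case False
      then have "N \<le> \<bar>\<xi>\<bar>" by auto
      also have "\<dots> \<le> (cmod (hw \<xi>))\<^sup>2" by (rule abs_le_hw_sq)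
      finally have "sqrt N \<le> cmod (hw \<xi>)" by (intro real_le_lsqrt) (use assms in auto)
      then have "cmod (g \<xi>) * sqrt N \<le> cmod (g \<xi>) * cmod (hw \<xi>)" by (intro mult_left_mono) auto
      then show ?thesis using False assms(2) by (simp add: trunc_def norm_mult norm_divide field_simps)
    qed
    then show "AE \<xi> in lborel. cmod (g \<xi> - trunc N g \<xi>) \<le> cmod (of_real (1 / sqrt N) * (hw \<xi> * g \<xi>))" by simp
  qed measurable
  also have "\<dots> = 1 / sqrt N * nrm (\<lambda>\<xi>. hw \<xi> * g \<xi>)"
    using nrm_cmult[of "of_real (1 / sqrt N)" "\<lambda>\<xi>. hw \<xi> * g \<xi>"] assms(2) by (simp add: norm_divide)
  also have "\<dots> \<le> 1 / sqrt N * M" using g(3) assms(2) by (intro mult_left_mono) auto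
  finally have "?n\<^sup>2 \<le> (1 / sqrt N * M)\<^sup>2" by (rule power_mono) simp
  then show ?thesis using assms(2) by (simp add: power_mult_distrib power_divide)
qed

lemma integral_inverse_sqrt: assumes "N \<ge> 0"
  shows "integrable lborel (\<lambda>\<xi>. indicator {-N..N} \<xi> / sqrt (1 + \<xi>\<^sup>2))"
    "(LINT \<xi>|lborel. indicator {-N..N} \<xi> / sqrt (1 + \<xi>\<^sup>2)) = 2 * arsinh N"
proof -
  have D: "(arsinh has_vector_derivative 1 / sqrt (1 + x\<^sup>2)) (at x within {-N..N})" for x :: real
    unfolding has_real_derivative_iff_has_vector_derivative[symmetric]
    by (auto intro!: derivative_eq_intros simp: add.commute)
  have C: "continuous_on {-N..N} (\<lambda>x::real. 1 / sqrt (1 + x\<^sup>2))"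
    by (intro continuous_intros) (auto simp: add_nonneg_eq_0_iff)
  have "has_bochner_integral lborel (\<lambda>x. indicator {-N..N} x *\<^sub>R (1 / sqrt (1 + x\<^sup>2))) (arsinh N - arsinh (- N))"
    by (rule has_bochner_integral_FTC_Icc[OF _ D C]) (use assms in simp)
  then show "integrable lborel (\<lambda>\<xi>. indicator {-N..N} \<xi> / sqrt (1 + \<xi>\<^sup>2))"
    "(LINT \<xi>|lborel. indicator {-N..N} \<xi> / sqrt (1 + \<xi>\<^sup>2)) = 2 * arsinh N"
    by (auto simp: has_bochner_integral_iff)
qed

lemma lowpass_bound:
  assumes "HB M u g" "N \<ge> 0"
  shows "cmod (lowpass N g x) \<le> M * (1 + arsinh N)"
proof -
  have g: "is_FT u g" "sqint (\<lambda>\<xi>. hw \<xi> * g \<xi>)" "nrm (\<lambda>\<xi>. hw \<xi> * g \<xi>) \<le> M" using assms by (auto simp: HB_def)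
  define b where "b \<xi> = indicator {-N..N} \<xi> / hw \<xi>" for \<xi>
  have b_sq: "(\<lambda>\<xi>. (cmod (b \<xi>))\<^sup>2) = (\<lambda>\<xi>. indicator {-N..N} \<xi> / sqrt (1 + \<xi>\<^sup>2))"
    by (auto simp: b_def norm_divide power_divide cmod_hw_sq indicator_def)
  have sb: "sqint b"
    by (rule sqintI, unfold b_sq, unfold b_def) (use integral_inverse_sqrt[OF assms(2)] in auto)
  have "nrm b = sqrt (2 * arsinh N)"
    unfolding nrm_def b_sq integral_inverse_sqrt(2)[OF assms(2)] ..
  have "0 \<le> arsinh N" using arsinh_real_neg_iff[of N] assms(2) by linarith
  have "nrm b \<le> 1 + arsinh N" unfolding \<open>nrm b = _\<close>
    by (rule real_le_lsqrt) (use \<open>0 \<le> arsinh N\<close> in \<open>auto simp: power2_sum\<close>)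
  have "cmod (lowpass N g x) = cmod (ft (trunc N (\<lambda>\<xi>. cnj (g \<xi>))) x) / (2 * pi)"
    by (simp add: lowpass_def norm_divide norm_mult)
  also have "\<dots> \<le> cmod (ft (trunc N (\<lambda>\<xi>. cnj (g \<xi>))) x)"
  proof -
    have "(1::real) \<le> 2 * pi" using pi_ge_two by linarith
    then have "cmod z * 1 \<le> cmod z * (2 * pi)" for z by (rule mult_left_mono) simp
    then show ?thesis by (simp add: divide_le_eq)
  qed
  also have "\<dots> \<le> (LINT \<xi>|lborel. cmod (trunc N (\<lambda>\<xi>. cnj (g \<xi>)) \<xi>))" by (rule ft_bound)
  also have "\<dots> = (LINT \<xi>|lborel. cmod (hw \<xi> * g \<xi>) * cmod (b \<xi>))"
  proof (rule Bochner_Integration.integral_cong)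
    fix \<xi> :: real
    have "hw \<xi> \<noteq> 0" using cmod_hw_ge_1[of \<xi>] by auto
    then show "cmod (trunc N (\<lambda>\<xi>. cnj (g \<xi>)) \<xi>) = cmod (hw \<xi> * g \<xi>) * cmod (b \<xi>)"
      by (auto simp: trunc_def b_def norm_mult norm_divide indicator_def)
  qed simp
  also have "\<dots> \<le> nrm (\<lambda>\<xi>. hw \<xi> * g \<xi>) * nrm b" by (rule Cauchy_Schwarz[OF g(2) sb])
  also have "\<dots> \<le> M * (1 + arsinh N)"
    using g(3) \<open>nrm b \<le> _\<close> order_trans[OF nrm_nonneg g(3)] by (intro mult_mono) auto
  finally show ?thesis .
qed

lemma lowpass_bound_dyadic:
  assumes "HB M u g" shows "cmod (lowpass (2 ^ k) g x) \<le> M * (real k + 3)"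
proof -
  have M: "0 \<le> M" using assms order_trans[OF nrm_nonneg] by (auto simp: HB_def)
  have "sqrt ((2 ^ k)\<^sup>2 + 1) \<le> 2 * 2 ^ k"
  proof (rule real_le_lsqrt)
    have "(1::real) \<le> (2 ^ k)\<^sup>2" by (intro one_le_power) simp
    moreover have "(2 * 2 ^ k :: real)\<^sup>2 = 4 * (2 ^ k)\<^sup>2" by (simp add: power_mult_distrib)
    ultimately show "(2 ^ k)\<^sup>2 + 1 \<le> (2 * 2 ^ k :: real)\<^sup>2" by linarith
  qed simp_all
  moreover have "(2::real) ^ (k + 2) = 4 * 2 ^ k" "(0::real) < 2 ^ k" by simp_all
  ultimately have "2 ^ k + sqrt ((2 ^ k)\<^sup>2 + 1) \<le> (2::real) ^ (k + 2)" by linarith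
  then have "arsinh (2 ^ k :: real) \<le> ln (2 ^ (k + 2))"
    unfolding arsinh_real_def by (intro ln_mono) (auto intro: add_pos_nonneg)
  also have "\<dots> = (real k + 2) * ln 2" by (subst ln_realpow) auto
  also have "\<dots> \<le> (real k + 2) * 1" by (intro mult_left_mono) (use ln_2_less_1 in auto)
  finally have "1 + arsinh (2 ^ k :: real) \<le> real k + 3" by simp
  from mult_left_mono[OF this M] lowpass_bound[OF assms, of "2 ^ k" x] show ?thesis by simp
qed

definition Lr_term :: "real \<Rightarrow> real \<Rightarrow> nat \<Rightarrow> real" where
  "Lr_term r M k = (2 * M * (real k + 4)) powr (r - 2) * 4 * (M\<^sup>2 / 2 ^ k)"

definition Lr_const :: "real \<Rightarrow> real \<Rightarrow> real" where
  "Lr_const r M = (8 * M) powr (r - 2) * M\<^sup>2 + (\<Sum>k. Lr_term r M k)"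

lemma summable_Lr_term: assumes "M \<ge> 0" shows "summable (Lr_term r M)"
proof -
  have "summable (\<lambda>k. (real k + 4) powr (r - 2) * (1 / 2) ^ k)"
  proof (rule summable_comparison_test_bigo)
    show "summable (\<lambda>k. norm ((3 / 4 :: real) ^ k))" by (simp add: summable_geometric)
    show "(\<lambda>k. (real k + 4) powr (r - 2) * (1 / 2) ^ k) \<in> O(\<lambda>k. (3 / 4) ^ k)"
      by real_asymp
  qed
  note sm = summable_mult[OF this, of "(2 * M) powr (r - 2) * 4 * M\<^sup>2"]
  have "Lr_term r M = (\<lambda>k. (2 * M) powr (r - 2) * 4 * M\<^sup>2 * ((real k + 4) powr (r - 2) * (1 / 2) ^ k))"
  proof
    fix k
    have e: "(2 * M * (real k + 4)) powr (r - 2) = (2 * M) powr (r - 2) * (real k + 4) powr (r - 2)"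
      by (rule powr_mult)
    show "Lr_term r M k = (2 * M) powr (r - 2) * 4 * M\<^sup>2 * ((real k + 4) powr (r - 2) * (1 / 2) ^ k)"
      unfolding Lr_term_def e power_one_over by (simp only: divide_inverse mult_1_left mult_ac)
  qed
  then show ?thesis using sm by (simp only:)
qed

lemma Lr_bound:
  assumes HB: "HB M u g" and M: "M > 0" and r: "r \<ge> 2"
  shows "integrable lborel (\<lambda>x. \<bar>u x\<bar> powr r)" "(LINT x|lborel. \<bar>u x\<bar> powr r) \<le> Lr_const r M"
proof -
  have g: "is_FT u g" using HB by (auto simp: HB_def)
  have su: "sqint (\<lambda>x. of_real (u x))" by (rule is_FT_sqint[OF g])
  have sP: "sqint (lowpass N g)" for N using FT_sqint(1)[OF FT_lowpass[OF is_FT_sqint(2)[OF g]]] .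
  have [measurable]: "u \<in> borel_measurable borel" by (rule is_FT_measurable[OF g])
  have [measurable]: "lowpass N g \<in> borel_measurable borel" for N by (rule sqintD[OF sP])
  define d where "d k x = (cmod (of_real (u x) - lowpass (2 ^ k) g x))\<^sup>2" for k :: nat and x
  define a where "a k = (2 * M * (real k + 4)) powr (r - 2) * 4" for k :: nat
  have ptw: "ennreal (\<bar>u x\<bar> powr r) \<le> ennreal ((8 * M) powr (r - 2) * (u x)\<^sup>2) + (\<Sum>k. ennreal (a k * d k x))" for x
  proof (cases "\<bar>u x\<bar> \<le> 8 * M")
    case True
    have "\<bar>u x\<bar> powr r = \<bar>u x\<bar> powr (r - 2) * (u x)\<^sup>2"
      by (cases "u x = 0") (auto simp: powr_diff powr_numeral)
    also have "\<dots> \<le> (8 * M) powr (r - 2) * (u x)\<^sup>2"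
      using True r by (intro mult_right_mono powr_mono2) auto
    finally have "ennreal (\<bar>u x\<bar> powr r) \<le> ennreal ((8 * M) powr (r - 2) * (u x)\<^sup>2)"
      by (rule ennreal_leI)
    then show ?thesis by (rule add_increasing2[OF zero_le])
  next
    case False
    define U where "U = \<bar>u x\<bar>"
    define n where "n = nat \<lfloor>U / (2 * M)\<rfloor>"
    have U: "U > 8 * M" using False by (simp add: U_def)
    have "U / (2 * M) > 4" using U M by (simp add: field_simps)
    then have n: "real n \<le> U / (2 * M)" "U / (2 * M) < real n + 1" "n \<ge> 4"
      unfolding n_def by linarith+
    define k where "k = n - 3"
    have k: "real k = real n - 3" using n(3) by (simp add: k_def)
    have P: "cmod (lowpass (2 ^ k) g x) \<le> U / 2"
    proof -
      have "cmod (lowpass (2 ^ k) g x) \<le> M * real n" using lowpass_bound_dyadic[OF HB, of k x] k by simp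
      also have "\<dots> \<le> M * (U / (2 * M))" using n M by (intro mult_left_mono) auto
      finally show ?thesis using M by simp
    qed
    have "U \<le> cmod (of_real (u x) - lowpass (2 ^ k) g x) + cmod (lowpass (2 ^ k) g x)"
      using norm_triangle_ineq[of "of_real (u x) - lowpass (2 ^ k) g x" "lowpass (2 ^ k) g x"] by (simp add: U_def)
    with P have "U / 2 \<le> cmod (of_real (u x) - lowpass (2 ^ k) g x)" by simp
    then have "(U / 2)\<^sup>2 \<le> d k x" unfolding d_def using U M by (intro power_mono) auto
    then have U2: "U\<^sup>2 \<le> 4 * d k x" by (simp add: power_divide)
    have rn: "real n + 1 = real k + 4" using k by simp
    have "U < (real k + 4) * (2 * M)"
      using n(2) unfolding rn by (subst (asm) pos_divide_less_eq) (use M in auto)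
    then have "U \<le> 2 * M * (real k + 4)" by (metis mult.commute less_imp_le)
    then have U3: "U powr (r - 2) \<le> (2 * M * (real k + 4)) powr (r - 2)"
      using U M r by (intro powr_mono2) auto
    have "U powr r = U powr (r - 2) * U\<^sup>2"
      using U M by (simp add: powr_diff powr_numeral)
    also have "\<dots> \<le> (2 * M * (real k + 4)) powr (r - 2) * (4 * d k x)"
      using U3 U2 by (intro mult_mono) auto
    also have "\<dots> = a k * d k x" by (simp add: a_def)
    finally have "ennreal (\<bar>u x\<bar> powr r) \<le> ennreal (a k * d k x)" unfolding U_def by (rule ennreal_leI)
    also have "\<dots> \<le> (\<Sum>k. ennreal (a k * d k x))"
      using sum_le_suminf[of "\<lambda>k. ennreal (a k * d k x)" "{k}"] by simp
    finally show ?thesis by (rule add_increasing[OF zero_le])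
  qed
  have d_int: "integrable lborel (d k)" for k
    unfolding d_def by (rule sqint_integrable[OF sqint_diff[OF su sP]])
  have tn: "0 \<le> Lr_term r M k" for k using M by (simp add: Lr_term_def)
  have sm: "summable (Lr_term r M)" using M by (intro summable_Lr_term) simp
  have d_nonneg: "0 \<le> d k x" for k x unfolding d_def by simp
  have d_le: "(LINT x|lborel. d k x) \<le> M\<^sup>2 / 2 ^ k" for k
    using nrm_lowpass_diff[OF HB, of "2 ^ k"] unfolding d_def nrm_sq by simp
  have "(\<integral>\<^sup>+x. ennreal (\<bar>u x\<bar> powr r) \<partial>lborel)
      \<le> (\<integral>\<^sup>+x. ennreal ((8 * M) powr (r - 2) * (u x)\<^sup>2) + (\<Sum>k. ennreal (a k * d k x)) \<partial>lborel)"
    by (rule nn_integral_mono) (rule ptw)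
  also have "\<dots> = (\<integral>\<^sup>+x. ennreal ((8 * M) powr (r - 2) * (u x)\<^sup>2) \<partial>lborel) + (\<Sum>k. \<integral>\<^sup>+x. ennreal (a k * d k x) \<partial>lborel)"
    unfolding d_def by (subst nn_integral_add, measurable, subst nn_integral_suminf) measurable
  also have "\<dots> \<le> ennreal ((8 * M) powr (r - 2) * M\<^sup>2) + (\<Sum>k. ennreal (Lr_term r M k))"
  proof (intro add_mono suminf_le)
    have i: "integrable lborel (\<lambda>x. (u x)\<^sup>2)" using sqint_integrable[OF su] by simp
    have "(\<integral>\<^sup>+x. ennreal ((8 * M) powr (r - 2) * (u x)\<^sup>2) \<partial>lborel) = ennreal (LINT x|lborel. (8 * M) powr (r - 2) * (u x)\<^sup>2)"
      by (rule nn_integral_eq_integral) (use i in auto)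
    also have "(LINT x|lborel. (8 * M) powr (r - 2) * (u x)\<^sup>2) = (8 * M) powr (r - 2) * (nrm (\<lambda>x. of_real (u x)))\<^sup>2"
      by (simp add: nrm_sq)
    also have "ennreal \<dots> \<le> ennreal ((8 * M) powr (r - 2) * M\<^sup>2)"
      using HB_nrm(2)[OF HB] by (intro ennreal_leI mult_left_mono power_mono) auto
    finally show "(\<integral>\<^sup>+x. ennreal ((8 * M) powr (r - 2) * (u x)\<^sup>2) \<partial>lborel) \<le> ennreal ((8 * M) powr (r - 2) * M\<^sup>2)" .
    fix k
    have "(\<integral>\<^sup>+x. ennreal (a k * d k x) \<partial>lborel) = ennreal (LINT x|lborel. a k * d k x)"
      by (rule nn_integral_eq_integral) (use d_int[of k] in \<open>simp_all add: a_def d_nonneg\<close>)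
    also have "(LINT x|lborel. a k * d k x) = a k * (LINT x|lborel. d k x)" by simp
    also have "ennreal \<dots> \<le> ennreal (Lr_term r M k)"
      unfolding Lr_term_def a_def[symmetric] using d_le by (intro ennreal_leI mult_left_mono) (auto simp: a_def)
    finally show "(\<integral>\<^sup>+x. ennreal (a k * d k x) \<partial>lborel) \<le> ennreal (Lr_term r M k)" .
  qed simp_all
  also have "\<dots> = ennreal (Lr_const r M)"
    unfolding Lr_const_def suminf_ennreal2[OF tn sm]
    by (rule ennreal_plus[symmetric]) (use suminf_nonneg[OF sm tn] in auto)
  finally have *: "(\<integral>\<^sup>+x. ennreal (\<bar>u x\<bar> powr r) \<partial>lborel) \<le> ennreal (Lr_const r M)" .
  then show i: "integrable lborel (\<lambda>x. \<bar>u x\<bar> powr r)"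
    by (intro integrableI_nonneg) (auto intro: le_less_trans)
  have "0 \<le> Lr_const r M"
    unfolding Lr_const_def by (intro add_nonneg_nonneg suminf_nonneg sm tn) simp
  have "(\<integral>\<^sup>+x. ennreal (\<bar>u x\<bar> powr r) \<partial>lborel) = ennreal (LINT x|lborel. \<bar>u x\<bar> powr r)"
    by (rule nn_integral_eq_integral[OF i]) simp
  with * have "ennreal (LINT x|lborel. \<bar>u x\<bar> powr r) \<le> ennreal (Lr_const r M)" by simp
  then show "(LINT x|lborel. \<bar>u x\<bar> powr r) \<le> Lr_const r M"
    by (subst (asm) ennreal_le_iff) (rule \<open>0 \<le> Lr_const r M\<close>)
qed

section \<open>Compactness\<close>

lemma tendsto_weighted_integral:
  fixes a :: "nat \<Rightarrow> real \<Rightarrow> complex"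
  assumes a: "\<And>n. sqint (a n)" "\<And>x. (\<lambda>n. a n x) \<longlonglongrightarrow> 0" "\<And>n x. cmod (a n x) \<le> C" "\<And>n. nrm (a n) \<le> K"
    and v: "sqint v"
  shows "(\<lambda>n. LINT x|lborel. cmod (a n x) * cmod (v x)) \<longlonglongrightarrow> 0"
proof (rule LIMSEQ_I)
  fix e :: real assume e: "e > 0"
  have K: "K \<ge> 0" using a(4)[of 0] nrm_nonneg order_trans by blast
  note [measurable] = sqintD[OF a(1)] sqintD[OF v]
  have "\<forall>\<^sub>F R in at_top. nrm (\<lambda>x. trunc R v x - v x) < e / (2 * (K + 1))"
    using e K by (intro order_tendstoD(2)[OF tendsto_trunc[OF v]]) simp
  then obtain R where R: "nrm (\<lambda>x. trunc R v x - v x) < e / (2 * (K + 1))"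
    using eventually_happens'[OF trivial_limit_at_top_linorder] by blast
  note tv = sqint_trunc[OF v, of R] integrable_trunc[OF v, of R]
  note [measurable] = sqintD[OF tv(1)]
  have "(\<lambda>n. LINT x|lborel. cmod (a n x) * cmod (trunc R v x)) \<longlonglongrightarrow> integral\<^sup>L lborel (\<lambda>x::real. 0::real)"
  proof (rule Bochner_Integration.integral_dominated_convergence[where w="\<lambda>x. C * cmod (trunc R v x)"])
    show "integrable lborel (\<lambda>x. C * cmod (trunc R v x))" using tv(2) by simp
    show "AE x in lborel. (\<lambda>n. cmod (a n x) * cmod (trunc R v x)) \<longlonglongrightarrow> 0"
    proof (rule AE_I2)
      fix x show "(\<lambda>n. cmod (a n x) * cmod (trunc R v x)) \<longlonglongrightarrow> 0"
        using tendsto_mult_left_zero[OF tendsto_norm_zero[OF a(2)[of x]]] .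
    qed
    show "AE x in lborel. norm (cmod (a n x) * cmod (trunc R v x)) \<le> C * cmod (trunc R v x)" for n
      using a(3) by (auto simp: abs_mult intro!: mult_right_mono)
  qed measurable
  then have "(\<lambda>n. LINT x|lborel. cmod (a n x) * cmod (trunc R v x)) \<longlonglongrightarrow> 0" by simp
  from LIMSEQ_D[OF this, of "e/2"] e
  obtain N where N: "\<And>n. n \<ge> N \<Longrightarrow> \<bar>LINT x|lborel. cmod (a n x) * cmod (trunc R v x)\<bar> < e / 2" by auto
  have "\<bar>LINT x|lborel. cmod (a n x) * cmod (v x)\<bar> < e" if n: "n \<ge> N" for n
  proof -
    note dv = sqint_diff[OF tv(1) v]
    have "(LINT x|lborel. cmod (a n x) * cmod (v x))
      \<le> (LINT x|lborel. cmod (a n x) * cmod (trunc R v x) + cmod (a n x) * cmod (trunc R v x - v x))"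
    proof (rule integral_mono)
      show "integrable lborel (\<lambda>x. cmod (a n x) * cmod (v x))" by (rule Cauchy_Schwarz_integrable[OF a(1) v])
      show "integrable lborel (\<lambda>x. cmod (a n x) * cmod (trunc R v x) + cmod (a n x) * cmod (trunc R v x - v x))"
        by (intro Bochner_Integration.integrable_add Cauchy_Schwarz_integrable a tv dv)
      fix x
      have "cmod (v x) \<le> cmod (trunc R v x) + cmod (trunc R v x - v x)"
        using norm_triangle_ineq4[of "trunc R v x" "trunc R v x - v x"] by simp
      from mult_left_mono[OF this norm_ge_zero[of "a n x"]]
      show "cmod (a n x) * cmod (v x) \<le> cmod (a n x) * cmod (trunc R v x) + cmod (a n x) * cmod (trunc R v x - v x)"
        by (simp only: distrib_left)
    qed
    also have "\<dots> = (LINT x|lborel. cmod (a n x) * cmod (trunc R v x)) + (LINT x|lborel. cmod (a n x) * cmod (trunc R v x - v x))"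
      by (intro Bochner_Integration.integral_add Cauchy_Schwarz_integrable a tv dv)
    also have "(LINT x|lborel. cmod (a n x) * cmod (trunc R v x - v x)) \<le> nrm (a n) * nrm (\<lambda>x. trunc R v x - v x)"
      by (rule Cauchy_Schwarz[OF a(1) dv])
    also have "\<dots> \<le> (K + 1) * (e / (2 * (K + 1)))"
      using R a(4)[of n] K by (intro mult_mono) auto
    also have "\<dots> = e / 2" using K by (simp add: field_simps)
    finally have "(LINT x|lborel. cmod (a n x) * cmod (v x)) < e" using N[OF n] by linarith
    moreover have "0 \<le> (LINT x|lborel. cmod (a n x) * cmod (v x))" by simp
    ultimately show ?thesis by linarith
  qed
  then show "\<exists>N. \<forall>n\<ge>N. norm ((LINT x|lborel. cmod (a n x) * cmod (v x)) - 0) < e" by auto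
qed

lemma cmod_cis_diff: "cmod (cis a - cis b) \<le> \<bar>a - b\<bar>"
proof -
  have "cis a - cis b = cis b * (cis (a - b) - 1)" by (simp add: right_diff_distrib cis_mult)
  then have "cmod (cis a - cis b) = cmod (cis (a - b) - 1)" by (simp add: norm_mult)
  also have "\<dots> \<le> \<bar>a - b\<bar>" using iexp_approx1[of "a - b" 0] by (simp add: cis_conv_exp)
  finally show ?thesis .
qed

lemma lowpass_Lipschitz:
  assumes g: "sqint g" "nrm g \<le> M" and N: "N \<ge> 0"
  shows "cmod (lowpass N g x - lowpass N g y) \<le> N * M * nrm (indicator {-N..N}) * \<bar>x - y\<bar>"
proof -
  define t where "t = trunc N (\<lambda>\<xi>. cnj (g \<xi>))"
  have t: "sqint t" "integrable lborel t" unfolding t_def using sqint_cnj[OF g(1)] by (auto intro: sqint_trunc integrable_trunc)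
  have "cmod (lowpass N g x - lowpass N g y) = cmod (ft t x - ft t y) / (2 * pi)"
    unfolding lowpass_def t_def[symmetric]
    by (simp add: norm_divide norm_mult flip: diff_divide_distrib complex_cnj_diff)
  also have "\<dots> \<le> cmod (ft t x - ft t y)"
  proof -
    have "(1::real) \<le> 2 * pi" using pi_ge_two by linarith
    then have "cmod z * 1 \<le> cmod z * (2 * pi)" for z by (rule mult_left_mono) simp
    then show ?thesis by (simp add: divide_le_eq)
  qed
  also have "ft t x - ft t y = (LINT \<xi>|lborel. t \<xi> * cis (- (\<xi> * x)) - t \<xi> * cis (- (\<xi> * y)))"
    unfolding ft_def by (rule Bochner_Integration.integral_diff[symmetric]) (intro integrable_ft_integrand t)+
  also have "cmod \<dots> \<le> (LINT \<xi>|lborel. cmod (t \<xi> * cis (- (\<xi> * x)) - t \<xi> * cis (- (\<xi> * y))))"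
    by (rule integral_norm_bound)
  also have "\<dots> \<le> (LINT \<xi>|lborel. N * \<bar>x - y\<bar> * (cmod (g \<xi>) * cmod (indicator {-N..N} \<xi> :: complex)))"
  proof (rule integral_mono)
    show "integrable lborel (\<lambda>\<xi>. cmod (t \<xi> * cis (- (\<xi> * x)) - t \<xi> * cis (- (\<xi> * y))))"
      by (intro integrable_norm Bochner_Integration.integrable_diff integrable_ft_integrand t)
    show "integrable lborel (\<lambda>\<xi>. N * \<bar>x - y\<bar> * (cmod (g \<xi>) * cmod (indicator {-N..N} \<xi> :: complex)))"
      by (intro integrable_mult_right Cauchy_Schwarz_integrable g sqint_interval)
    fix \<xi> :: real
    have "cmod (t \<xi> * cis (- (\<xi> * x)) - t \<xi> * cis (- (\<xi> * y))) = cmod (t \<xi>) * cmod (cis (- (\<xi> * x)) - cis (- (\<xi> * y)))"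
      by (simp add: norm_mult flip: right_diff_distrib)
    also have "\<dots> \<le> cmod (t \<xi>) * \<bar>- (\<xi> * x) - - (\<xi> * y)\<bar>"
      by (intro mult_left_mono cmod_cis_diff) simp
    also have "\<bar>- (\<xi> * x) - - (\<xi> * y)\<bar> = \<bar>\<xi>\<bar> * \<bar>x - y\<bar>"
      unfolding abs_mult[symmetric] by (simp add: right_diff_distrib abs_minus_commute)
    also have "cmod (t \<xi>) * (\<bar>\<xi>\<bar> * \<bar>x - y\<bar>) \<le> N * \<bar>x - y\<bar> * (cmod (g \<xi>) * cmod (indicator {-N..N} \<xi> :: complex))"
    proof (cases "\<xi> \<in> {-N..N}")
      case True
      then have "\<bar>\<xi>\<bar> \<le> N" by auto
      then have "cmod (g \<xi>) * (\<bar>\<xi>\<bar> * \<bar>x - y\<bar>) \<le> cmod (g \<xi>) * (N * \<bar>x - y\<bar>)"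
        by (intro mult_left_mono mult_right_mono) auto
      with True show ?thesis by (simp add: t_def trunc_def mult_ac)
    qed (simp add: t_def trunc_def)
    finally show "cmod (t \<xi> * cis (- (\<xi> * x)) - t \<xi> * cis (- (\<xi> * y)))
      \<le> N * \<bar>x - y\<bar> * (cmod (g \<xi>) * cmod (indicator {-N..N} \<xi> :: complex))" .
  qed
  also have "\<dots> = N * \<bar>x - y\<bar> * (LINT \<xi>|lborel. cmod (g \<xi>) * cmod (indicator {-N..N} \<xi> :: complex))"
    by (rule integral_mult_right_zero)
  also have "\<dots> \<le> N * \<bar>x - y\<bar> * (nrm g * nrm (indicator {-N..N}))"
    using N by (intro mult_left_mono Cauchy_Schwarz g sqint_interval) auto
  also have "\<dots> \<le> N * \<bar>x - y\<bar> * (M * nrm (indicator {-N..N}))"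
    using N g by (intro mult_left_mono mult_right_mono) auto
  finally show ?thesis by (simp only: mult_ac)
qed

lemma lowpass_convergent_subsequence:
  assumes HB: "\<And>n. HB M (u n) (g n)"
  shows "\<exists>r::nat \<Rightarrow> nat. strict_mono r \<and> (\<forall>j x. convergent (\<lambda>n. lowpass (real (Suc j)) (g (r n)) x))"
proof -
  have M: "0 \<le> M" using HB_nrm(1)[OF HB[of 0]] order_trans[OF nrm_nonneg] by blast
  have sg: "sqint (g n)" "nrm (g n) \<le> M" for n
    using HB[of n] HB_nrm(1)[OF HB] by (auto simp: HB_def intro: is_FT_sqint)
  define D where "D j = M * (1 + arsinh (real (Suc j))) + 1" for j
  have D: "D j > 0" for j
  proof -
    have "0 \<le> arsinh (real (Suc j))" using arsinh_real_neg_iff[of "real (Suc j)"] by linarith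
    then show ?thesis unfolding D_def using M by (intro add_nonneg_pos mult_nonneg_nonneg) auto
  qed
  define f where "f n = (\<lambda>(j, x). lowpass (real (Suc j)) (g n) x / of_real (D j))" for n
  have "countable (UNIV \<times> \<rat> :: (nat \<times> real) set)" by (intro countable_SIGMA countable_rat) auto
  moreover have "norm (f n z) \<le> 1" if "z \<in> UNIV \<times> \<rat>" for n z
  proof -
    obtain j x where z: "z = (j, x)" by (cases z)
    have "cmod (lowpass (real (Suc j)) (g n) x) \<le> D j"
      using lowpass_bound[OF HB, of "real (Suc j)" n x] unfolding D_def by linarith
    then show ?thesis using D[of j] by (simp add: z f_def norm_divide)
  qed
  ultimately obtain r where r: "strict_mono r" "\<And>z. z \<in> UNIV \<times> \<rat> \<Longrightarrow> \<exists>l. (\<lambda>n. f (r n) z) \<longlonglongrightarrow> l"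
    using function_convergent_subsequence[of "UNIV \<times> \<rat>" f 1] by blast
  have "convergent (\<lambda>n. lowpass (real (Suc j)) (g (r n)) x)" for j x
  proof -
    define N where "N = real (Suc j)"
    define L where "L = N * M * nrm (indicator {-N..N}) + 1"
    have N: "N \<ge> 0" by (simp add: N_def)
    have L: "L > 0" unfolding L_def using N M by (intro add_nonneg_pos mult_nonneg_nonneg) auto
    have Lip: "cmod (lowpass N (g n) x - lowpass N (g n) y) \<le> L * \<bar>x - y\<bar>" for n y
    proof -
      have "cmod (lowpass N (g n) x - lowpass N (g n) y) \<le> N * M * nrm (indicator {-N..N}) * \<bar>x - y\<bar>"
        by (rule lowpass_Lipschitz[OF sg N])
      also have "\<dots> \<le> L * \<bar>x - y\<bar>" unfolding L_def by (intro mult_right_mono) auto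
      finally show ?thesis .
    qed
    have "Cauchy (\<lambda>n. lowpass N (g (r n)) x)"
    proof (rule metric_CauchyI)
      fix e :: real assume e: "e > 0"
      obtain y where y: "y \<in> \<rat>" "x < y" "y < x + e / (3 * L)"
        using Rats_dense_in_real[of x "x + e / (3 * L)"] e L by auto
      have "L * \<bar>x - y\<bar> < L * (e / (3 * L))" using y L by (intro mult_strict_left_mono) auto
      then have Ly: "L * \<bar>x - y\<bar> < e / 3" using L by simp
      obtain l where "(\<lambda>n. f (r n) (j, y)) \<longlonglongrightarrow> l" using r(2)[of "(j, y)"] y(1) by blast
      then have "(\<lambda>n. f (r n) (j, y) * of_real (D j)) \<longlonglongrightarrow> l * of_real (D j)" by (intro tendsto_intros)
      moreover have "f (r n) (j, y) * of_real (D j) = lowpass N (g (r n)) y" for n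
        using D[of j] by (simp add: f_def N_def)
      ultimately have "Cauchy (\<lambda>n. lowpass N (g (r n)) y)" by (simp add: LIMSEQ_imp_Cauchy)
      from metric_CauchyD[OF this, of "e/3"] e
      obtain n0 where n0: "\<And>m n. m \<ge> n0 \<Longrightarrow> n \<ge> n0 \<Longrightarrow> dist (lowpass N (g (r m)) y) (lowpass N (g (r n)) y) < e / 3" by auto
      have "dist (lowpass N (g (r m)) x) (lowpass N (g (r n)) x) < e" if "m \<ge> n0" "n \<ge> n0" for m n
      proof -
        have "dist (lowpass N (g (r m)) x) (lowpass N (g (r m)) y) < e / 3"
          "dist (lowpass N (g (r n)) x) (lowpass N (g (r n)) y) < e / 3"
          unfolding dist_norm by (rule le_less_trans[OF Lip Ly])+
        then show ?thesis using n0[OF that]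
          dist_triangle[of "lowpass N (g (r m)) x" "lowpass N (g (r n)) x" "lowpass N (g (r m)) y"]
          dist_triangle[of "lowpass N (g (r m)) y" "lowpass N (g (r n)) x" "lowpass N (g (r n)) y"]
          by (simp add: dist_commute)
      qed
      then show "\<exists>n0. \<forall>m\<ge>n0. \<forall>n\<ge>n0. dist (lowpass N (g (r m)) x) (lowpass N (g (r n)) x) < e" by blast
    qed
    then show ?thesis by (simp add: Cauchy_convergent_iff N_def)
  qed
  then show ?thesis using r(1) by blast
qed

definition wconv :: "(nat \<Rightarrow> real \<Rightarrow> real) \<Rightarrow> (real \<Rightarrow> real) \<Rightarrow> bool" where
  "wconv u w \<longleftrightarrow> sqint (\<lambda>x. of_real (w x)) \<and>
    (\<forall>v. sqint v \<longrightarrow> (\<lambda>n. LINT x|lborel. \<bar>u n x - w x\<bar> * cmod (v x)) \<longlonglongrightarrow> 0)"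

lemma HB_compact:
  assumes HB: "\<And>n. HB M (u n) (g n)"
  shows "\<exists>(r::nat \<Rightarrow> nat) w. strict_mono r \<and> wconv (\<lambda>n. u (r n)) w"
proof -
  obtain r where r: "strict_mono r" "\<And>j x. convergent (\<lambda>n. lowpass (real (Suc j)) (g (r n)) x)"
    using lowpass_convergent_subsequence[of M u g, OF HB] by blast
  have M: "0 \<le> M" using HB_nrm(1)[OF HB[of 0]] order_trans[OF nrm_nonneg] by blast
  have FTu: "is_FT (u n) (g n)" for n using HB[of n] by (simp add: HB_def)
  note sg = is_FT_sqint(2)[OF FTu] and su = is_FT_sqint(1)[OF FTu]
  define P where "P j n = lowpass (real (Suc j)) (g (r n))" for j n
  define U where "U n = (\<lambda>x. complex_of_real (u (r n) x))" for n
  have sU: "sqint (U n)" for n unfolding U_def by (rule su)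
  have sP: "sqint (P j n)" for j n unfolding P_def using FT_sqint(1)[OF FT_lowpass[OF sg]] .
  define h where "h j x = lim (\<lambda>n. P j n x)" for j x
  have Plim: "(\<lambda>n. P j n x) \<longlonglongrightarrow> h j x" for j x
    unfolding h_def P_def using r(2) by (simp add: convergent_LIMSEQ_iff)
  note [measurable] = sqintD[OF sP] sqintD[OF sU]
  have h_meas[measurable]: "h j \<in> borel_measurable borel" for j
    by (rule borel_measurable_LIMSEQ_metric[OF sqintD[OF sP]]) (rule Plim)
  define \<epsilon> where "\<epsilon> j = M / sqrt (real (Suc j))" for j
  have UP: "nrm (\<lambda>x. U n x - P j n x) \<le> \<epsilon> j" for n j
  proof (rule power2_le_imp_le)
    show "(nrm (\<lambda>x. U n x - P j n x))\<^sup>2 \<le> (\<epsilon> j)\<^sup>2"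
      using nrm_lowpass_diff[OF HB[of "r n"], of "real (Suc j)"] by (simp add: U_def P_def \<epsilon>_def power_divide)
    show "0 \<le> \<epsilon> j" using M by (simp add: \<epsilon>_def)
  qed
  have \<epsilon>_lim: "\<epsilon> \<longlonglongrightarrow> 0"
    unfolding \<epsilon>_def by real_asymp
  have UM: "nrm (U n) \<le> M" for n unfolding U_def by (rule HB_nrm(2)[OF HB])
  have PM: "nrm (P j n) \<le> M + \<epsilon> j" for j n
    using nrm_diff_ineq[OF sU[of n] sP[of j n]] UP[of n j] UM[of n] by linarith
  have sh: "sqint (h j)" "nrm (h j) \<le> M + \<epsilon> j" for j
  proof -
    have "sqint (h j) \<and> nrm (h j) \<le> M + \<epsilon> j"
    proof (rule nrm_Fatou[where s="P j"])
      show "AE x in lborel. (\<lambda>n. P j n x) \<longlonglongrightarrow> h j x" by (intro AE_I2 Plim)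
      show "\<forall>\<^sub>F n in sequentially. nrm (P j n) \<le> M + \<epsilon> j" using PM by simp
    qed (rule sP, measurable)
    then show "sqint (h j)" "nrm (h j) \<le> M + \<epsilon> j" by auto
  qed
  have hh: "nrm (\<lambda>x. h i x - h j x) \<le> \<epsilon> i + \<epsilon> j" for i j
  proof -
    have PP: "nrm (\<lambda>x. P i n x - P j n x) \<le> \<epsilon> i + \<epsilon> j" for n
      using nrm_triangle_via[OF sP[of i n] sU[of n] sP[of j n]] UP[of n i] UP[of n j] nrm_minus_commute[of "P i n" "U n"]
      by linarith
    have "sqint (\<lambda>x. h i x - h j x) \<and> nrm (\<lambda>x. h i x - h j x) \<le> \<epsilon> i + \<epsilon> j"
    proof (rule nrm_Fatou[where s="\<lambda>n x. P i n x - P j n x"])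
      show "AE x in lborel. (\<lambda>n. P i n x - P j n x) \<longlonglongrightarrow> h i x - h j x"
        by (intro AE_I2 tendsto_intros Plim)
      show "\<forall>\<^sub>F n in sequentially. nrm (\<lambda>x. P i n x - P j n x) \<le> \<epsilon> i + \<epsilon> j" using PP by simp
    qed (intro sqint_diff sP, measurable)
    then show ?thesis ..
  qed
  have "\<exists>w. sqint w \<and> (\<lambda>j. nrm (\<lambda>x. h j x - w x)) \<longlonglongrightarrow> 0"
  proof (rule sqint_complete[OF sh(1)])
    fix e :: real assume "e > 0"
    then obtain N where N: "\<And>j. j \<ge> N \<Longrightarrow> \<bar>\<epsilon> j\<bar> < e / 2" using LIMSEQ_D[OF \<epsilon>_lim, of "e/2"] by auto
    have "nrm (\<lambda>x. h i x - h j x) < e" if "i \<ge> N" "j \<ge> N" for i j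
      using hh[of i j] N[OF that(1)] N[OF that(2)] by linarith
    then show "\<exists>N. \<forall>i\<ge>N. \<forall>j\<ge>N. nrm (\<lambda>x. h i x - h j x) < e" by blast
  qed
  then obtain w where w: "sqint w" "(\<lambda>j. nrm (\<lambda>x. h j x - w x)) \<longlonglongrightarrow> 0" by blast
  note [measurable] = sqintD[OF w(1)]
  have sRe: "sqint (\<lambda>x. complex_of_real (Re (w x)))"
    by (rule sqint_mono[OF w(1), where C=1]) (auto simp: abs_Re_le_cmod)
  have "(\<lambda>n. LINT x|lborel. \<bar>u (r n) x - Re (w x)\<bar> * cmod (v x)) \<longlonglongrightarrow> 0" if v: "sqint v" for v
  proof (rule LIMSEQ_I)
    fix e :: real assume e: "e > 0"
    define V where "V = nrm v + 1"
    have V: "V > 0" "nrm v \<le> V" unfolding V_def using nrm_nonneg[of v] by linarith+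
    have "e / (3 * V) > 0" using e V by simp
    from LIMSEQ_D[OF \<epsilon>_lim this] LIMSEQ_D[OF w(2) this]
    obtain N1 N2 where "\<And>j. j \<ge> N1 \<Longrightarrow> \<bar>\<epsilon> j\<bar> < e / (3 * V)" "\<And>j. j \<ge> N2 \<Longrightarrow> nrm (\<lambda>x. h j x - w x) < e / (3 * V)"
      by auto
    then obtain j where j: "\<epsilon> j < e / (3 * V)" "nrm (\<lambda>x. h j x - w x) < e / (3 * V)"
      by (metis abs_less_iff max.cobounded1 max.cobounded2)
    define C where "C = M * (1 + arsinh (real (Suc j)))"
    have PC: "cmod (P j n x) \<le> C" for n x unfolding P_def C_def by (rule lowpass_bound[OF HB]) simp
    have hC: "cmod (h j x) \<le> C" for x
      by (rule tendsto_upperbound[OF tendsto_norm[OF Plim[of j x]]]) (use PC in auto)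
    have "(\<lambda>n. LINT x|lborel. cmod (P j n x - h j x) * cmod (v x)) \<longlonglongrightarrow> 0"
    proof (rule tendsto_weighted_integral[where C="2 * C" and K="2 * (M + \<epsilon> j)"])
      show "sqint (\<lambda>x. P j n x - h j x)" for n by (rule sqint_diff[OF sP sh(1)])
      show "(\<lambda>n. P j n x - h j x) \<longlonglongrightarrow> 0" for x using Plim[of j x] by (simp add: LIM_zero)
      show "cmod (P j n x - h j x) \<le> 2 * C" for n x
        using norm_triangle_ineq4[of "P j n x" "h j x"] PC[of n x] hC[of x] by linarith
      show "nrm (\<lambda>x. P j n x - h j x) \<le> 2 * (M + \<epsilon> j)" for n
        using nrm_triangle[OF sP[of j n] sqint_cmult[OF sh(1)[of j], of "-1"]] nrm_cmult[of "-1" "h j"] PM[of j n] sh(2)[of j]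
        by simp
    qed (rule v)
    from LIMSEQ_D[OF this, of "e/3"] e
    obtain n0 where n0: "\<And>n. n \<ge> n0 \<Longrightarrow> (LINT x|lborel. cmod (P j n x - h j x) * cmod (v x)) < e / 3" by auto
    have small: "nrm z * nrm v \<le> e / 3" if "nrm z < e / (3 * V)" for z
    proof -
      have "nrm z * nrm v \<le> e / (3 * V) * V" using that V e by (intro mult_mono) auto
      then show ?thesis using V by simp
    qed
    have "(LINT x|lborel. \<bar>u (r n) x - Re (w x)\<bar> * cmod (v x)) < e" if n: "n \<ge> n0" for n
    proof -
      have s1: "sqint (\<lambda>x. U n x - P j n x)" and s2: "sqint (\<lambda>x. P j n x - h j x)" and s3: "sqint (\<lambda>x. h j x - w x)"
        by (intro sqint_diff sU sP sh w)+
      note i = Cauchy_Schwarz_integrable[OF s1 v] Cauchy_Schwarz_integrable[OF s2 v] Cauchy_Schwarz_integrable[OF s3 v]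
      have "(LINT x|lborel. \<bar>u (r n) x - Re (w x)\<bar> * cmod (v x))
        \<le> (LINT x|lborel. cmod (U n x - P j n x) * cmod (v x) + cmod (P j n x - h j x) * cmod (v x) + cmod (h j x - w x) * cmod (v x))"
      proof (rule integral_mono)
        show "integrable lborel (\<lambda>x. \<bar>u (r n) x - Re (w x)\<bar> * cmod (v x))"
          using Cauchy_Schwarz_integrable[OF sqint_diff[OF sU[of n] sRe] v] by (simp add: U_def flip: of_real_diff)
        show "integrable lborel (\<lambda>x. cmod (U n x - P j n x) * cmod (v x) + cmod (P j n x - h j x) * cmod (v x) + cmod (h j x - w x) * cmod (v x))"
          by (intro Bochner_Integration.integrable_add i)
        fix x
        have "\<bar>u (r n) x - Re (w x)\<bar> = \<bar>Re (U n x - w x)\<bar>" by (simp add: U_def)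
        also have "\<dots> \<le> cmod (U n x - w x)" by (rule abs_Re_le_cmod)
        also have "U n x - w x = (U n x - P j n x) + (P j n x - h j x) + (h j x - w x)" by simp
        also have "cmod \<dots> \<le> cmod (U n x - P j n x) + cmod (P j n x - h j x) + cmod (h j x - w x)"
          by (intro order_trans[OF norm_triangle_ineq] add_mono order_refl norm_triangle_ineq)
        finally have "\<bar>u (r n) x - Re (w x)\<bar> * cmod (v x)
          \<le> (cmod (U n x - P j n x) + cmod (P j n x - h j x) + cmod (h j x - w x)) * cmod (v x)"
          by (rule mult_right_mono) simp
        then show "\<bar>u (r n) x - Re (w x)\<bar> * cmod (v x)
          \<le> cmod (U n x - P j n x) * cmod (v x) + cmod (P j n x - h j x) * cmod (v x) + cmod (h j x - w x) * cmod (v x)"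
          by (simp only: distrib_right)
      qed
      also have "\<dots> = (LINT x|lborel. cmod (U n x - P j n x) * cmod (v x)) + (LINT x|lborel. cmod (P j n x - h j x) * cmod (v x))
          + (LINT x|lborel. cmod (h j x - w x) * cmod (v x))"
        by (simp only: Bochner_Integration.integral_add Bochner_Integration.integrable_add i)
      also have "\<dots> < e / 3 + e / 3 + e / 3"
        using Cauchy_Schwarz[OF s1 v] small[of "\<lambda>x. U n x - P j n x"] UP[of n j] j
          Cauchy_Schwarz[OF s3 v] small[of "\<lambda>x. h j x - w x"] n0[OF n] by linarith
      finally show ?thesis by simp
    qed
    moreover have "0 \<le> (LINT x|lborel. \<bar>u (r n) x - Re (w x)\<bar> * cmod (v x))" for n by simp
    ultimately show "\<exists>n0. \<forall>n\<ge>n0. norm ((LINT x|lborel. \<bar>u (r n) x - Re (w x)\<bar> * cmod (v x)) - 0) < e"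
      by (intro exI[of _ n0]) (auto simp: abs_of_nonneg)
  qed
  then have "wconv (\<lambda>n. u (r n)) (\<lambda>x. Re (w x))" unfolding wconv_def using sRe by blast
  then show ?thesis using r(1) by blast
qed

lemma wconv_FT:
  assumes w: "wconv u w" and FT: "\<And>n. is_FT (u n) (g n)" "is_FT w G" and b: "sqint b"
  shows "(\<lambda>n. LINT \<xi>|lborel. g n \<xi> * b \<xi>) \<longlonglongrightarrow> (LINT \<xi>|lborel. G \<xi> * b \<xi>)"
proof -
  obtain B where B: "FT b B" using FT_exists[OF b] by blast
  note sB = FT_sqint(2)[OF B]
  have sw: "sqint (\<lambda>x. complex_of_real (w x))" using w by (simp add: wconv_def)
  have "(\<lambda>n. (LINT \<xi>|lborel. g n \<xi> * b \<xi>) - (LINT \<xi>|lborel. G \<xi> * b \<xi>)) \<longlonglongrightarrow> 0"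
  proof (rule Lim_null_comparison)
    show "(\<lambda>n. LINT x|lborel. \<bar>u n x - w x\<bar> * cmod (B x)) \<longlonglongrightarrow> 0" using w sB by (simp add: wconv_def)
    have "norm ((LINT \<xi>|lborel. g n \<xi> * b \<xi>) - (LINT \<xi>|lborel. G \<xi> * b \<xi>)) \<le> (LINT x|lborel. \<bar>u n x - w x\<bar> * cmod (B x))" for n
    proof -
      note su = is_FT_sqint(1)[OF FT(1)[of n]]
      have "(LINT \<xi>|lborel. g n \<xi> * b \<xi>) - (LINT \<xi>|lborel. G \<xi> * b \<xi>)
        = (LINT x|lborel. of_real (u n x) * B x) - (LINT x|lborel. of_real (w x) * B x)"
        using FT_mult_formula[OF is_FT_FT[OF FT(1)] B] FT_mult_formula[OF is_FT_FT[OF FT(2)] B] by simp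
      also have "\<dots> = (LINT x|lborel. of_real (u n x) * B x - of_real (w x) * B x)"
        by (intro Bochner_Integration.integral_diff[symmetric] sqint_mult_integrable su sw sB)
      also have "norm \<dots> \<le> (LINT x|lborel. norm (of_real (u n x) * B x - of_real (w x) * B x))"
        by (rule integral_norm_bound)
      also have "\<dots> = (LINT x|lborel. \<bar>u n x - w x\<bar> * cmod (B x))"
        by (simp add: norm_mult flip: left_diff_distrib of_real_diff)
      finally show ?thesis .
    qed
    then show "\<forall>\<^sub>F n in sequentially. norm ((LINT \<xi>|lborel. g n \<xi> * b \<xi>) - (LINT \<xi>|lborel. G \<xi> * b \<xi>))
        \<le> (LINT x|lborel. \<bar>u n x - w x\<bar> * cmod (B x))" by simp
  qed
  then show ?thesis by (simp add: LIM_zero_iff)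
qed

lemma weak_closed:
  assumes g: "\<And>n. sqint (g n)" "sqint G"
    and weak: "\<And>b. sqint b \<Longrightarrow> (\<lambda>n. LINT \<xi>|lborel. g n \<xi> * b \<xi>) \<longlonglongrightarrow> (LINT \<xi>|lborel. G \<xi> * b \<xi>)"
    and m[measurable]: "m \<in> borel_measurable borel" and mg: "\<And>n. sqint (\<lambda>\<xi>. m \<xi> * g n \<xi>)" "\<And>n. nrm (\<lambda>\<xi>. m \<xi> * g n \<xi>) \<le> K"
  shows "sqint (\<lambda>\<xi>. m \<xi> * G \<xi>)"
    "sqint b \<Longrightarrow> (\<lambda>n. LINT \<xi>|lborel. m \<xi> * g n \<xi> * b \<xi>) \<longlonglongrightarrow> (LINT \<xi>|lborel. m \<xi> * G \<xi> * b \<xi>)"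
proof -
  note [measurable] = sqintD[OF g(1)] sqintD[OF g(2)]
  define c where "c R \<xi> = (if cmod (m \<xi>) \<le> real R then 1 else 0 :: complex)" for R :: nat and \<xi>
  have [measurable]: "c R \<in> borel_measurable borel" for R unfolding c_def by measurable
  have cc: "c R \<xi> * c R \<xi> = c R \<xi>" "cnj (c R \<xi>) = c R \<xi>" "cmod (c R \<xi>) \<le> 1" for R \<xi> by (auto simp: c_def)
  have c_ev: "\<forall>\<^sub>F R in sequentially. c R \<xi> = 1" for \<xi>
  proof -
    obtain N where "cmod (m \<xi>) \<le> real N" using real_arch_simple by blast
    then have "c R \<xi> = 1" if "R \<ge> N" for R
      using that of_nat_mono[OF that, where 'a=real] by (auto simp: c_def)
    then show ?thesis by (auto simp: eventually_sequentially)
  qed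
  have mc: "sqint (\<lambda>\<xi>. m \<xi> * c R \<xi> * b \<xi>)" if b: "sqint b" for b R
  proof (rule sqint_mono[OF b, where C="real R"])
    show "(\<lambda>\<xi>. m \<xi> * c R \<xi> * b \<xi>) \<in> borel_measurable lborel" using sqintD[OF b] by measurable
    show "AE \<xi> in lborel. cmod (m \<xi> * c R \<xi> * b \<xi>) \<le> real R * cmod (b \<xi>)"
      by (auto simp: norm_mult c_def intro!: mult_right_mono)
  qed
  have K: "0 \<le> K" using mg(2)[of 0] nrm_nonneg order_trans by blast
  have wk: "(\<lambda>n. LINT \<xi>|lborel. m \<xi> * g n \<xi> * (c R \<xi> * b \<xi>)) \<longlonglongrightarrow> (LINT \<xi>|lborel. m \<xi> * G \<xi> * (c R \<xi> * b \<xi>))"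
    if b: "sqint b" for b R
    using weak[OF mc[OF b, of R]] by (simp only: mult_ac)
  have cb: "sqint (\<lambda>\<xi>. c R \<xi> * b \<xi>)" if b: "sqint b" for b R
    using sqintD[OF b] cc(3) by (intro sqint_mono[OF b, where C=1]) (auto simp: norm_mult c_def)
  have cG: "nrm (\<lambda>\<xi>. m \<xi> * c R \<xi> * G \<xi>) \<le> K" for R
  proof -
    let ?z = "\<lambda>\<xi>. m \<xi> * c R \<xi> * G \<xi>"
    note z = mc[OF g(2), of R]
    have "(\<lambda>n. cmod (LINT \<xi>|lborel. m \<xi> * g n \<xi> * (c R \<xi> * cnj (?z \<xi>)))) \<longlonglongrightarrow> cmod (LINT \<xi>|lborel. m \<xi> * G \<xi> * (c R \<xi> * cnj (?z \<xi>)))"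
      by (intro tendsto_norm wk sqint_cnj z)
    moreover have "cmod (LINT \<xi>|lborel. m \<xi> * g n \<xi> * (c R \<xi> * cnj (?z \<xi>))) \<le> K * nrm ?z" for n
    proof -
      have eq: "c R \<xi> * cnj (?z \<xi>) = cnj (?z \<xi>)" for \<xi> by (auto simp: c_def)
      have "cmod (LINT \<xi>|lborel. m \<xi> * g n \<xi> * cnj (?z \<xi>)) \<le> nrm (\<lambda>\<xi>. m \<xi> * g n \<xi>) * nrm (\<lambda>\<xi>. cnj (?z \<xi>))"
        by (rule integral_mult_bound[OF mg(1) sqint_cnj[OF z]])
      also have "\<dots> \<le> K * nrm ?z" unfolding nrm_cnj using mg(2) by (intro mult_right_mono) auto
      finally show ?thesis unfolding eq .
    qed
    ultimately have le: "cmod (LINT \<xi>|lborel. m \<xi> * G \<xi> * (c R \<xi> * cnj (?z \<xi>))) \<le> K * nrm ?z"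
      by (intro tendsto_upperbound[OF _ _ sequentially_bot]) auto
    have "(LINT \<xi>|lborel. m \<xi> * G \<xi> * (c R \<xi> * cnj (?z \<xi>))) = (LINT \<xi>|lborel. ?z \<xi> * cnj (?z \<xi>))"
      by (simp only: mult_ac)
    then have "(nrm ?z)\<^sup>2 \<le> K * nrm ?z"
      using le nrm_sq_pairing[OF z] complex_Re_le_cmod[of "LINT \<xi>|lborel. ?z \<xi> * cnj (?z \<xi>)"] by simp
    then show ?thesis using K nrm_nonneg[of ?z] by (cases "nrm ?z = 0") (auto simp: power2_eq_square)
  qed
  have F: "sqint (\<lambda>\<xi>. m \<xi> * G \<xi>) \<and> nrm (\<lambda>\<xi>. m \<xi> * G \<xi>) \<le> K"
  proof (rule nrm_Fatou[where s="\<lambda>R \<xi>. m \<xi> * c R \<xi> * G \<xi>"])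
    show "AE \<xi> in lborel. (\<lambda>R. m \<xi> * c R \<xi> * G \<xi>) \<longlonglongrightarrow> m \<xi> * G \<xi>"
    proof (rule AE_I2, rule tendsto_eventually)
      fix \<xi> show "\<forall>\<^sub>F R in sequentially. m \<xi> * c R \<xi> * G \<xi> = m \<xi> * G \<xi>"
        using c_ev[of \<xi>] by eventually_elim simp
    qed
    show "\<forall>\<^sub>F R in sequentially. nrm (\<lambda>\<xi>. m \<xi> * c R \<xi> * G \<xi>) \<le> K" using cG by simp
  qed (rule mc[OF g(2)], measurable)
  then show "sqint (\<lambda>\<xi>. m \<xi> * G \<xi>)" ..
  assume b: "sqint b"
  note [measurable] = sqintD[OF b]
  have clim: "(\<lambda>R. nrm (\<lambda>\<xi>. c R \<xi> * b \<xi> - b \<xi>)) \<longlonglongrightarrow> 0"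
  proof (rule tendsto_nrm_dominated[OF _ b])
    show "AE \<xi> in lborel. cmod (c R \<xi> * b \<xi> - b \<xi>) \<le> cmod (b \<xi>)" for R by (auto simp: c_def)
    show "AE \<xi> in lborel. (\<lambda>R. c R \<xi> * b \<xi> - b \<xi>) \<longlonglongrightarrow> 0"
    proof (rule AE_I2, rule tendsto_eventually)
      fix \<xi> show "\<forall>\<^sub>F R in sequentially. c R \<xi> * b \<xi> - b \<xi> = 0"
        using c_ev[of \<xi>] by eventually_elim simp
    qed
  qed measurable
  show "(\<lambda>n. LINT \<xi>|lborel. m \<xi> * g n \<xi> * b \<xi>) \<longlonglongrightarrow> (LINT \<xi>|lborel. m \<xi> * G \<xi> * b \<xi>)"
  proof (rule LIMSEQ_I)
    fix e :: real assume e: "e > 0"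
    have "e / (3 * (K + 1)) > 0" using e K by simp
    from LIMSEQ_D[OF clim this] obtain R where R: "nrm (\<lambda>\<xi>. c R \<xi> * b \<xi> - b \<xi>) < e / (3 * (K + 1))" by auto
    have err: "cmod ((LINT \<xi>|lborel. m \<xi> * a \<xi> * (c R \<xi> * b \<xi>)) - (LINT \<xi>|lborel. m \<xi> * a \<xi> * b \<xi>)) < e / 3"
      if a: "sqint (\<lambda>\<xi>. m \<xi> * a \<xi>)" "nrm (\<lambda>\<xi>. m \<xi> * a \<xi>) \<le> K" for a
    proof -
      have "(LINT \<xi>|lborel. m \<xi> * a \<xi> * (c R \<xi> * b \<xi>)) - (LINT \<xi>|lborel. m \<xi> * a \<xi> * b \<xi>)
        = (LINT \<xi>|lborel. m \<xi> * a \<xi> * (c R \<xi> * b \<xi>) - m \<xi> * a \<xi> * b \<xi>)"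
        by (intro Bochner_Integration.integral_diff[symmetric] sqint_mult_integrable a b cb)
      also have "\<dots> = (LINT \<xi>|lborel. m \<xi> * a \<xi> * (c R \<xi> * b \<xi> - b \<xi>))" by (simp only: right_diff_distrib)
      also have "cmod \<dots> \<le> nrm (\<lambda>\<xi>. m \<xi> * a \<xi>) * nrm (\<lambda>\<xi>. c R \<xi> * b \<xi> - b \<xi>)"
        by (rule integral_mult_bound[OF a(1) sqint_diff[OF cb[OF b] b]])
      also have "\<dots> \<le> K * nrm (\<lambda>\<xi>. c R \<xi> * b \<xi> - b \<xi>)" using a by (intro mult_right_mono) auto
      also have "\<dots> \<le> K * (e / (3 * (K + 1)))" using R K by (intro mult_left_mono) auto
      also have "\<dots> < (K + 1) * (e / (3 * (K + 1)))" using e K by (intro mult_strict_right_mono) auto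
      also have "\<dots> = e / 3" using K by (simp add: field_simps)
      finally show ?thesis .
    qed
    from LIMSEQ_D[OF wk[OF b, of R], of "e/3"] e
    obtain N where N: "\<And>n. n \<ge> N \<Longrightarrow> cmod ((LINT \<xi>|lborel. m \<xi> * g n \<xi> * (c R \<xi> * b \<xi>)) - (LINT \<xi>|lborel. m \<xi> * G \<xi> * (c R \<xi> * b \<xi>))) < e / 3" by auto
    have "cmod ((LINT \<xi>|lborel. m \<xi> * g n \<xi> * b \<xi>) - (LINT \<xi>|lborel. m \<xi> * G \<xi> * b \<xi>)) < e" if "n \<ge> N" for n
    proof -
      define A1 where "A1 = (LINT \<xi>|lborel. m \<xi> * g n \<xi> * b \<xi>)"
      define A2 where "A2 = (LINT \<xi>|lborel. m \<xi> * g n \<xi> * (c R \<xi> * b \<xi>))"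
      define A3 where "A3 = (LINT \<xi>|lborel. m \<xi> * G \<xi> * (c R \<xi> * b \<xi>))"
      define A4 where "A4 = (LINT \<xi>|lborel. m \<xi> * G \<xi> * b \<xi>)"
      have "cmod (A2 - A1) < e / 3" "cmod (A2 - A3) < e / 3" "cmod (A3 - A4) < e / 3"
        using err[OF mg(1)[of n] mg(2)[of n]] N[OF that] err[OF conjunct1[OF F] conjunct2[OF F]]
        by (simp_all only: A1_def A2_def A3_def A4_def)
      then have "dist A1 A2 < e / 3" "dist A2 A3 < e / 3" "dist A3 A4 < e / 3"
        by (simp_all add: dist_norm norm_minus_commute)
      then have "dist A1 A4 < e"
        using dist_triangle[of A1 A4 A2] dist_triangle[of A2 A4 A3] by linarith
      then show ?thesis unfolding A1_def A4_def dist_norm .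
    qed
    then show "\<exists>N. \<forall>n\<ge>N. norm ((LINT \<xi>|lborel. m \<xi> * g n \<xi> * b \<xi>) - (LINT \<xi>|lborel. m \<xi> * G \<xi> * b \<xi>)) < e" by blast
  qed
qed

section \<open>The quadratic form\<close>

locale dispersion =
  fixes \<beta> c \<gamma> :: real
  assumes beta: "\<beta> > 0" and gamma: "\<gamma> > 0" and c_less: "c < 3 * (\<beta>\<^sup>2 * \<gamma> / 4) powr (1/3)"
begin

definition W :: "real \<Rightarrow> real" where
  "W \<xi> = \<beta> * \<bar>\<xi>\<bar> - c + \<gamma> / \<xi>\<^sup>2"

definition wt :: "real \<Rightarrow> complex" where
  "wt \<xi> = of_real (sqrt (W \<xi>))"

lemma W_measurable[measurable]: "W \<in> borel_measurable borel"
  unfolding W_def by measurable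

lemma wt_measurable[measurable]: "wt \<in> borel_measurable borel"
  unfolding wt_def by measurable

text \<open>The bound is the arithmetic-geometric mean inequality for
  $\beta t/2$, $\beta t/2$, $\gamma/t^2$.\<close>

lemma dispersion_min:
  assumes t: "t > 0"
  shows "3 * (\<beta>\<^sup>2 * \<gamma> / 4) powr (1/3) \<le> \<beta> * t + \<gamma> / t\<^sup>2"
proof -
  define s where "s = (\<beta>\<^sup>2 * \<gamma> / 4) powr (1/3)"
  have s: "s > 0" unfolding s_def using beta gamma by simp
  have s3: "s ^ 3 = \<beta>\<^sup>2 * \<gamma> / 4"
  proof -
    have "s ^ 3 = s powr 3" using s by (simp add: powr_numeral)
    also have "\<dots> = (\<beta>\<^sup>2 * \<gamma> / 4) powr (1/3 * 3)" unfolding s_def powr_powr ..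
    also have "\<dots> = \<beta>\<^sup>2 * \<gamma> / 4" using beta gamma by simp
    finally show ?thesis .
  qed
  define y where "y = \<beta> * t / 2"
  have y: "y > 0" using beta t by (simp add: y_def)
  have "\<gamma> / t\<^sup>2 = s ^ 3 / y\<^sup>2"
    unfolding s3 y_def using beta t by (simp add: field_simps power2_eq_square)
  moreover have "3 * s \<le> 2 * y + s ^ 3 / y\<^sup>2"
  proof -
    have "2 * y ^ 3 + s ^ 3 - 3 * s * y\<^sup>2 = (y - s)\<^sup>2 * (2 * y + s)"
      by (simp add: power2_eq_square power3_eq_cube algebra_simps)
    also have "\<dots> \<ge> 0" using y s by simp
    finally have "3 * s * y\<^sup>2 \<le> 2 * y ^ 3 + s ^ 3" by simp
    then have "3 * s * y\<^sup>2 / y\<^sup>2 \<le> (2 * y ^ 3 + s ^ 3) / y\<^sup>2" by (intro divide_right_mono) auto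
    then show ?thesis using y by (simp add: add_divide_distrib power2_eq_square power3_eq_cube)
  qed
  ultimately show ?thesis by (simp add: s_def y_def)
qed

lemma W_lower: "\<exists>d>0. \<forall>\<xi>. \<xi> \<noteq> 0 \<longrightarrow> d * (1 + \<bar>\<xi>\<bar> + 1 / \<xi>\<^sup>2) \<le> W \<xi>"
proof -
  define cs where "cs = 3 * (\<beta>\<^sup>2 * \<gamma> / 4) powr (1/3)"
  have cs: "cs > 0" "c < cs" unfolding cs_def using beta gamma c_less by auto
  define e where "e = min 1 ((cs - c) / (cs + 1))"
  have e: "e > 0" "e \<le> 1" using cs by (auto simp: e_def)
  have "e * (cs + 1) \<le> cs - c"
  proof -
    have "e \<le> (cs - c) / (cs + 1)" by (simp add: e_def)
    then show ?thesis using cs by (simp add: pos_le_divide_eq)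
  qed
  then have ec: "e \<le> (1 - e) * cs - c" by (simp add: algebra_simps)
  define d where "d = e * min 1 (min \<beta> \<gamma>)"
  have d: "d > 0" "d \<le> e" "d \<le> e * \<beta>" "d \<le> e * \<gamma>"
    unfolding d_def using e beta gamma by (auto intro: mult_left_mono simp: mult_left_le)
  have "d * (1 + \<bar>\<xi>\<bar> + 1 / \<xi>\<^sup>2) \<le> W \<xi>" if x: "\<xi> \<noteq> 0" for \<xi>
  proof -
    have m: "cs \<le> \<beta> * \<bar>\<xi>\<bar> + \<gamma> / \<xi>\<^sup>2" using dispersion_min[of "\<bar>\<xi>\<bar>"] x by (simp add: cs_def)
    have "d * (1 + \<bar>\<xi>\<bar> + 1 / \<xi>\<^sup>2) = d + d * \<bar>\<xi>\<bar> + d * (1 / \<xi>\<^sup>2)" by (simp only: distrib_left mult_1_right)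
    also have "\<dots> \<le> e + e * \<beta> * \<bar>\<xi>\<bar> + e * \<gamma> * (1 / \<xi>\<^sup>2)"
      using d by (intro add_mono mult_right_mono) auto
    also have "\<dots> = e + e * (\<beta> * \<bar>\<xi>\<bar> + \<gamma> / \<xi>\<^sup>2)" by (simp add: algebra_simps)
    also have "\<dots> \<le> ((1 - e) * (\<beta> * \<bar>\<xi>\<bar> + \<gamma> / \<xi>\<^sup>2) - c) + e * (\<beta> * \<bar>\<xi>\<bar> + \<gamma> / \<xi>\<^sup>2)"
      using ec mult_left_mono[OF m, of "1 - e"] e by simp
    also have "\<dots> = \<beta> * \<bar>\<xi>\<bar> + \<gamma> / \<xi>\<^sup>2 - c" by (simp add: left_diff_distrib)
    also have "\<dots> = W \<xi>" by (simp add: W_def)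
    finally show ?thesis .
  qed
  then show ?thesis using d(1) by blast
qed

definition \<delta> :: real where
  "\<delta> = (SOME d. d > 0 \<and> (\<forall>\<xi>. \<xi> \<noteq> 0 \<longrightarrow> d * (1 + \<bar>\<xi>\<bar> + 1 / \<xi>\<^sup>2) \<le> W \<xi>))"

lemma \<delta>: "\<delta> > 0" "\<xi> \<noteq> 0 \<Longrightarrow> \<delta> * (1 + \<bar>\<xi>\<bar> + 1 / \<xi>\<^sup>2) \<le> W \<xi>"
  using someI_ex[OF W_lower] unfolding \<delta>_def by auto

lemma W_pos: "\<xi> \<noteq> 0 \<Longrightarrow> W \<xi> > 0"
proof -
  assume x: "\<xi> \<noteq> 0"
  have "0 < \<delta> * (1 + \<bar>\<xi>\<bar> + 1 / \<xi>\<^sup>2)" using \<delta>(1) by (intro mult_pos_pos add_pos_nonneg) auto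
  then show "W \<xi> > 0" using \<delta>(2)[OF x] by linarith
qed

lemma cmod_wt_sq: "\<xi> \<noteq> 0 \<Longrightarrow> (cmod (wt \<xi>))\<^sup>2 = W \<xi>"
  using W_pos[of \<xi>] by (simp add: wt_def)

lemma AE_nonzero: "AE \<xi> in lborel. \<xi> \<noteq> (0::real)"
  by (rule AE_lborel_singleton)

lemma le_wt:
  assumes "\<xi> \<noteq> 0" "0 \<le> a" "a\<^sup>2 \<le> 1 + \<bar>\<xi>\<bar> + 1 / \<xi>\<^sup>2"
  shows "a \<le> 1 / sqrt \<delta> * cmod (wt \<xi>)"
proof (rule power2_le_imp_le)
  have "\<delta> * a\<^sup>2 \<le> \<delta> * (1 + \<bar>\<xi>\<bar> + 1 / \<xi>\<^sup>2)" using \<delta>(1) assms(3) by (intro mult_left_mono) auto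
  also have "\<dots> \<le> (cmod (wt \<xi>))\<^sup>2" unfolding cmod_wt_sq[OF assms(1)] by (rule \<delta>(2)[OF assms(1)])
  finally show "a\<^sup>2 \<le> (1 / sqrt \<delta> * cmod (wt \<xi>))\<^sup>2"
    using \<delta>(1) by (simp add: power_mult_distrib power_divide field_simps)
qed (use \<delta>(1) in simp)

lemma sym_bounds:
  assumes "\<xi> \<noteq> 0"
  shows "cmod (sym_Dhalf \<xi>) \<le> 1 / sqrt \<delta> * cmod (wt \<xi>)" "cmod (sym_dinv \<xi>) \<le> 1 / sqrt \<delta> * cmod (wt \<xi>)"
    "cmod (hw \<xi>) \<le> 1 / sqrt \<delta> * cmod (wt \<xi>)"
proof -
  have 0: "0 \<le> 1 / \<xi>\<^sup>2" by simp
  have "(cmod (sym_Dhalf \<xi>))\<^sup>2 = \<bar>\<xi>\<bar>" by (simp add: sym_Dhalf_def)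
  then show "cmod (sym_Dhalf \<xi>) \<le> 1 / sqrt \<delta> * cmod (wt \<xi>)" using 0 by (intro le_wt[OF assms]) auto
  have "(cmod (sym_dinv \<xi>))\<^sup>2 = 1 / \<xi>\<^sup>2" by (simp add: sym_dinv_def norm_divide norm_mult power_divide)
  then show "cmod (sym_dinv \<xi>) \<le> 1 / sqrt \<delta> * cmod (wt \<xi>)" by (intro le_wt[OF assms]) auto
  show "cmod (hw \<xi>) \<le> 1 / sqrt \<delta> * cmod (wt \<xi>)"
    using hw_sq_le[of \<xi>] 0 by (intro le_wt[OF assms] norm_ge_zero) linarith
qed

lemma XF_iff: "XF u g \<longleftrightarrow> is_FT u g \<and> sqint (\<lambda>\<xi>. wt \<xi> * g \<xi>)"
proof (intro iffI conjI)
  assume X: "XF u g"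
  then show FT: "is_FT u g" by (simp add: XF_def)
  have [measurable]: "g \<in> borel_measurable borel" by (rule is_FT_measurable[OF FT])
  have s: "sqint g" "sqint (\<lambda>\<xi>. sym_Dhalf \<xi> * g \<xi>)" "sqint (\<lambda>\<xi>. sym_dinv \<xi> * g \<xi>)"
    using X is_FT_sqint(2)[OF FT] by (auto simp: XF_def)
  let ?t = "\<lambda>\<xi>. of_real (cmod (g \<xi>)) + of_real (cmod (sym_Dhalf \<xi> * g \<xi>)) + complex_of_real (cmod (sym_dinv \<xi> * g \<xi>))"
  have "sqint ?t" by (intro sqint_add sqint_norm s)
  then show "sqint (\<lambda>\<xi>. wt \<xi> * g \<xi>)"
  proof (rule sqint_mono)
    define C where "C = sqrt (\<beta> + \<bar>c\<bar> + \<gamma>)"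
    show "AE \<xi> in lborel. cmod (wt \<xi> * g \<xi>) \<le> C * cmod (?t \<xi>)"
      using AE_nonzero
    proof eventually_elim
      fix \<xi> :: real assume x: "\<xi> \<noteq> 0"
      define a where "a = cmod (sym_Dhalf \<xi>)"
      define b where "b = cmod (sym_dinv \<xi>)"
      have ab: "a\<^sup>2 = \<bar>\<xi>\<bar>" "b\<^sup>2 = 1 / \<xi>\<^sup>2" "a \<ge> 0" "b \<ge> 0"
        by (auto simp: a_def b_def sym_Dhalf_def sym_dinv_def norm_divide norm_mult power_divide)
      have "W \<xi> \<le> (\<beta> + \<bar>c\<bar> + \<gamma>) * (1 + a\<^sup>2 + b\<^sup>2)"
      proof -
        have "W \<xi> = \<beta> * a\<^sup>2 + (- c) * 1 + \<gamma> * b\<^sup>2" unfolding ab by (simp add: W_def)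
        also have "\<dots> \<le> (\<beta> + \<bar>c\<bar> + \<gamma>) * a\<^sup>2 + (\<beta> + \<bar>c\<bar> + \<gamma>) * 1 + (\<beta> + \<bar>c\<bar> + \<gamma>) * b\<^sup>2"
          using beta gamma by (intro add_mono mult_right_mono) auto
        finally show ?thesis by (simp add: algebra_simps)
      qed
      also have "\<dots> \<le> (\<beta> + \<bar>c\<bar> + \<gamma>) * (1 + a + b)\<^sup>2"
        using beta gamma ab(3,4) by (intro mult_left_mono) (auto simp: power2_eq_square algebra_simps)
      finally have "(cmod (wt \<xi>))\<^sup>2 \<le> (C * (1 + a + b))\<^sup>2"
        using beta gamma unfolding cmod_wt_sq[OF x] C_def by (simp add: power_mult_distrib)
      then have "cmod (wt \<xi>) \<le> C * (1 + a + b)"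
        by (rule power2_le_imp_le) (use ab beta gamma in \<open>simp add: C_def\<close>)
      then have "cmod (wt \<xi>) * cmod (g \<xi>) \<le> C * (1 + a + b) * cmod (g \<xi>)" by (rule mult_right_mono) simp
      moreover have "cmod (?t \<xi>) = (1 + a + b) * cmod (g \<xi>)"
        unfolding a_def b_def by (simp only: of_real_add[symmetric] norm_of_real) (simp add: norm_mult distrib_right)
      ultimately show "cmod (wt \<xi> * g \<xi>) \<le> C * cmod (?t \<xi>)" by (simp add: norm_mult)
    qed
  qed measurable
next
  assume "is_FT u g \<and> sqint (\<lambda>\<xi>. wt \<xi> * g \<xi>)"
  then have FT: "is_FT u g" and w: "sqint (\<lambda>\<xi>. wt \<xi> * g \<xi>)" by auto
  have [measurable]: "g \<in> borel_measurable borel" by (rule is_FT_measurable[OF FT])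
  have "sqint (\<lambda>\<xi>. m \<xi> * g \<xi>)"
    if m[measurable]: "m \<in> borel_measurable borel" and le: "\<And>\<xi>. \<xi> \<noteq> 0 \<Longrightarrow> cmod (m \<xi>) \<le> 1 / sqrt \<delta> * cmod (wt \<xi>)" for m
  proof (rule sqint_mono[OF w])
    show "AE \<xi> in lborel. cmod (m \<xi> * g \<xi>) \<le> 1 / sqrt \<delta> * cmod (wt \<xi> * g \<xi>)"
      using AE_nonzero
    proof eventually_elim
      fix \<xi> :: real assume "\<xi> \<noteq> 0"
      from mult_right_mono[OF le[OF this] norm_ge_zero[of "g \<xi>"]]
      show "cmod (m \<xi> * g \<xi>) \<le> 1 / sqrt \<delta> * cmod (wt \<xi> * g \<xi>)" by (simp add: norm_mult)
    qed
  qed measurable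
  then show "XF u g" unfolding XF_def using FT sym_bounds by auto
qed

lemma XF_HB:
  assumes "XF u g" shows "HB (1 / sqrt \<delta> * nrm (\<lambda>\<xi>. wt \<xi> * g \<xi>)) u g"
proof -
  have FT: "is_FT u g" and w: "sqint (\<lambda>\<xi>. wt \<xi> * g \<xi>)" using assms by (auto simp: XF_iff)
  have [measurable]: "g \<in> borel_measurable borel" by (rule is_FT_measurable[OF FT])
  have le: "AE \<xi> in lborel. cmod (hw \<xi> * g \<xi>) \<le> cmod (of_real (1 / sqrt \<delta>) * (wt \<xi> * g \<xi>))"
    using AE_nonzero
  proof eventually_elim
    fix \<xi> :: real assume "\<xi> \<noteq> 0"
    from mult_right_mono[OF sym_bounds(3)[OF this] norm_ge_zero[of "g \<xi>"]]
    show "cmod (hw \<xi> * g \<xi>) \<le> cmod (of_real (1 / sqrt \<delta>) * (wt \<xi> * g \<xi>))"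
      using \<delta>(1) by (simp add: norm_mult norm_divide)
  qed
  note sw = sqint_cmult[OF w, of "of_real (1 / sqrt \<delta>)"]
  have "sqint (\<lambda>\<xi>. hw \<xi> * g \<xi>)"
    by (rule sqint_mono[OF sw, where C=1]) (use le in auto)
  moreover have "nrm (\<lambda>\<xi>. hw \<xi> * g \<xi>) \<le> nrm (\<lambda>\<xi>. of_real (1 / sqrt \<delta>) * (wt \<xi> * g \<xi>))"
    by (rule nrm_mono[OF sw _ le]) measurable
  ultimately show ?thesis
    using FT \<delta>(1) nrm_cmult[of "of_real (1 / sqrt \<delta>)" "\<lambda>\<xi>. wt \<xi> * g \<xi>"] by (simp add: HB_def norm_divide)
qed

definition Bform :: "(real \<Rightarrow> real) \<Rightarrow> (real \<Rightarrow> real) \<Rightarrow> real" where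
  "Bform u v = \<beta> * (LINT x|lborel. Dhalf u x * Dhalf v x) - c * (LINT x|lborel. u x * v x)
     + \<gamma> * (LINT x|lborel. dinv u x * dinv v x)"

lemma I_fun_Bform: "I_fun \<beta> c \<gamma> u = Bform u u"
  by (simp add: I_fun_def Bform_def power2_eq_square)

lemma Bform_FT:
  assumes u: "XF u g" and v: "XF v h"
  shows "2 * pi * Bform u v = Re (LINT \<xi>|lborel. wt \<xi> * g \<xi> * cnj (wt \<xi> * h \<xi>))"
proof -
  have FT: "is_FT u g" "is_FT v h" using u v by (auto simp: XF_def)
  have [measurable]: "g \<in> borel_measurable borel" "h \<in> borel_measurable borel"
    using is_FT_measurable[OF FT(1)] is_FT_measurable[OF FT(2)] by auto
  note D = XF_Dhalf[OF u] XF_Dhalf[OF v] and d = XF_dinv[OF u] XF_dinv[OF v]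
  define i1 where "i1 = (\<lambda>\<xi>. sym_Dhalf \<xi> * g \<xi> * cnj (sym_Dhalf \<xi> * h \<xi>))"
  define i2 where "i2 = (\<lambda>\<xi>. g \<xi> * cnj (h \<xi>))"
  define i3 where "i3 = (\<lambda>\<xi>. sym_dinv \<xi> * g \<xi> * cnj (sym_dinv \<xi> * h \<xi>))"
  have i: "integrable lborel i1" "integrable lborel i2" "integrable lborel i3"
    unfolding i1_def i2_def i3_def
    by (intro sqint_mult_integrable sqint_cnj is_FT_sqint(2)[OF D(1)] is_FT_sqint(2)[OF D(2)]
        is_FT_sqint(2)[OF d(1)] is_FT_sqint(2)[OF d(2)] is_FT_sqint(2)[OF FT(1)] is_FT_sqint(2)[OF FT(2)])+
  have "2 * pi * Bform u v = \<beta> * (2 * pi * (LINT x|lborel. Dhalf u x * Dhalf v x))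
      - c * (2 * pi * (LINT x|lborel. u x * v x)) + \<gamma> * (2 * pi * (LINT x|lborel. dinv u x * dinv v x))"
    by (simp add: Bform_def algebra_simps)
  also have "\<dots> = \<beta> * Re (integral\<^sup>L lborel i1) - c * Re (integral\<^sup>L lborel i2) + \<gamma> * Re (integral\<^sup>L lborel i3)"
    unfolding Parseval[OF D] Parseval[OF FT] Parseval[OF d] i1_def i2_def i3_def ..
  also have "\<dots> = Re (of_real \<beta> * integral\<^sup>L lborel i1 - of_real c * integral\<^sup>L lborel i2 + of_real \<gamma> * integral\<^sup>L lborel i3)"
    by simp
  also have "of_real \<beta> * integral\<^sup>L lborel i1 - of_real c * integral\<^sup>L lborel i2 + of_real \<gamma> * integral\<^sup>L lborel i3
      = (LINT \<xi>|lborel. of_real \<beta> * i1 \<xi> - of_real c * i2 \<xi> + of_real \<gamma> * i3 \<xi>)"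
    using i by simp
  also have "\<dots> = (LINT \<xi>|lborel. wt \<xi> * g \<xi> * cnj (wt \<xi> * h \<xi>))"
  proof (rule integral_cong_AE)
    show "AE \<xi> in lborel. of_real \<beta> * i1 \<xi> - of_real c * i2 \<xi> + of_real \<gamma> * i3 \<xi> = wt \<xi> * g \<xi> * cnj (wt \<xi> * h \<xi>)"
      using AE_nonzero
    proof eventually_elim
      fix \<xi> :: real assume x: "\<xi> \<noteq> 0"
      have 1: "sym_Dhalf \<xi> * cnj (sym_Dhalf \<xi>) = of_real \<bar>\<xi>\<bar>"
        by (simp add: sym_Dhalf_def flip: of_real_mult)
      have 3: "sym_dinv \<xi> * cnj (sym_dinv \<xi>) = of_real (1 / \<xi>\<^sup>2)"
      proof -
        have "(cmod (sym_dinv \<xi>))\<^sup>2 = 1 / \<xi>\<^sup>2" by (simp add: sym_dinv_def norm_divide norm_mult power_divide)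
        then show ?thesis using complex_norm_square[of "sym_dinv \<xi>"] by simp
      qed
      have w: "wt \<xi> * cnj (wt \<xi>) = of_real (W \<xi>)"
        using W_pos[OF x] by (simp add: wt_def flip: of_real_mult)
      have "of_real \<beta> * i1 \<xi> - of_real c * i2 \<xi> + of_real \<gamma> * i3 \<xi>
        = (of_real \<beta> * (sym_Dhalf \<xi> * cnj (sym_Dhalf \<xi>)) - of_real c + of_real \<gamma> * (sym_dinv \<xi> * cnj (sym_dinv \<xi>))) * (g \<xi> * cnj (h \<xi>))"
        unfolding i1_def i2_def i3_def complex_cnj_mult by (simp only: algebra_simps)
      also have "\<dots> = of_real (W \<xi>) * (g \<xi> * cnj (h \<xi>))"
        unfolding 1 3 W_def by simp
      also have "\<dots> = wt \<xi> * g \<xi> * cnj (wt \<xi> * h \<xi>)"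
        unfolding w[symmetric] complex_cnj_mult by (simp only: mult_ac)
      finally show "of_real \<beta> * i1 \<xi> - of_real c * i2 \<xi> + of_real \<gamma> * i3 \<xi> = wt \<xi> * g \<xi> * cnj (wt \<xi> * h \<xi>)" .
    qed
  qed (simp_all add: i1_def i2_def i3_def)
  finally show ?thesis .
qed

lemma I_fun_FT: assumes "XF u g" shows "2 * pi * I_fun \<beta> c \<gamma> u = (nrm (\<lambda>\<xi>. wt \<xi> * g \<xi>))\<^sup>2"
  using Bform_FT[OF assms assms] nrm_sq_pairing[of "\<lambda>\<xi>. wt \<xi> * g \<xi>"] assms
  by (simp add: I_fun_Bform XF_iff)

lemma XF_lincomb:
  assumes "XF u g" "XF v h"
  shows "XF (\<lambda>x. a * u x + b * v x) (\<lambda>\<xi>. of_real a * g \<xi> + of_real b * h \<xi>)"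
proof -
  have "sqint (\<lambda>\<xi>. of_real a * (wt \<xi> * g \<xi>) + of_real b * (wt \<xi> * h \<xi>))"
    using assms by (intro sqint_add sqint_cmult) (auto simp: XF_iff)
  moreover have "of_real a * (wt \<xi> * g \<xi>) + of_real b * (wt \<xi> * h \<xi>) = wt \<xi> * (of_real a * g \<xi> + of_real b * h \<xi>)" for \<xi>
    by (simp only: algebra_simps)
  ultimately show ?thesis using assms is_FT_lincomb unfolding XF_iff by simp
qed

lemma XF_cmult: assumes "XF u g" shows "XF (\<lambda>x. a * u x) (\<lambda>\<xi>. of_real a * g \<xi>)"
  using XF_lincomb[OF assms assms, of a 0] by simp

lemma XF_diff: assumes "XF u g" "XF v h" shows "XF (\<lambda>x. u x - v x) (\<lambda>\<xi>. g \<xi> - h \<xi>)"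
  using XF_lincomb[OF assms, of 1 "-1"] by simp

lemma I_fun_cmult: assumes "XF u g" shows "I_fun \<beta> c \<gamma> (\<lambda>x. a * u x) = a\<^sup>2 * I_fun \<beta> c \<gamma> u"
proof -
  have "nrm (\<lambda>\<xi>. wt \<xi> * (of_real a * g \<xi>)) = \<bar>a\<bar> * nrm (\<lambda>\<xi>. wt \<xi> * g \<xi>)"
    using nrm_cmult[of "of_real a" "\<lambda>\<xi>. wt \<xi> * g \<xi>"] by (simp only: mult.left_commute norm_of_real)
  then have "2 * pi * I_fun \<beta> c \<gamma> (\<lambda>x. a * u x) = a\<^sup>2 * (2 * pi * I_fun \<beta> c \<gamma> u)"
    unfolding I_fun_FT[OF XF_cmult[OF assms, of a]] I_fun_FT[OF assms] by (simp add: power_mult_distrib)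
  also have "\<dots> = 2 * pi * (a\<^sup>2 * I_fun \<beta> c \<gamma> u)" by (simp only: mult_ac)
  finally show ?thesis by simp
qed

lemma I_fun_expand:
  assumes "XF u g" "XF v h"
  shows "I_fun \<beta> c \<gamma> (\<lambda>x. u x + t * v x) = I_fun \<beta> c \<gamma> u + 2 * t * Bform u v + t\<^sup>2 * I_fun \<beta> c \<gamma> v"
proof -
  have s: "sqint (\<lambda>\<xi>. wt \<xi> * g \<xi>)" "sqint (\<lambda>\<xi>. wt \<xi> * h \<xi>)" using assms by (auto simp: XF_iff)
  have X: "XF (\<lambda>x. u x + t * v x) (\<lambda>\<xi>. g \<xi> + of_real t * h \<xi>)" using XF_lincomb[OF assms, of 1 t] by simp
  have "2 * pi * I_fun \<beta> c \<gamma> (\<lambda>x. u x + t * v x) = (nrm (\<lambda>\<xi>. wt \<xi> * g \<xi> - of_real (- t) * (wt \<xi> * h \<xi>)))\<^sup>2"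
    unfolding I_fun_FT[OF X] by (simp add: algebra_simps)
  also have "\<dots> = (nrm (\<lambda>\<xi>. wt \<xi> * g \<xi>))\<^sup>2 - 2 * Re (LINT \<xi>|lborel. wt \<xi> * g \<xi> * cnj (of_real (- t) * (wt \<xi> * h \<xi>)))
      + (nrm (\<lambda>\<xi>. of_real (- t) * (wt \<xi> * h \<xi>)))\<^sup>2"
    by (rule nrm_diff_sq_expand[OF s(1) sqint_cmult[OF s(2)]])
  also have "(LINT \<xi>|lborel. wt \<xi> * g \<xi> * cnj (of_real (- t) * (wt \<xi> * h \<xi>)))
      = of_real (- t) * (LINT \<xi>|lborel. wt \<xi> * g \<xi> * cnj (wt \<xi> * h \<xi>))"
    unfolding integral_mult_right_zero[symmetric] complex_cnj_mult complex_cnj_complex_of_real by (simp only: mult_ac)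
  also have "Re \<dots> = - t * (2 * pi * Bform u v)" unfolding Bform_FT[OF assms] by simp
  also have "(nrm (\<lambda>\<xi>. of_real (- t) * (wt \<xi> * h \<xi>)))\<^sup>2 = t\<^sup>2 * (2 * pi * I_fun \<beta> c \<gamma> v)"
    unfolding nrm_cmult I_fun_FT[OF assms(2)] by (simp add: power_mult_distrib)
  also have "(nrm (\<lambda>\<xi>. wt \<xi> * g \<xi>))\<^sup>2 = 2 * pi * I_fun \<beta> c \<gamma> u" by (rule I_fun_FT[OF assms(1), symmetric])
  finally have "2 * pi * I_fun \<beta> c \<gamma> (\<lambda>x. u x + t * v x)
    = 2 * pi * (I_fun \<beta> c \<gamma> u + 2 * t * Bform u v + t\<^sup>2 * I_fun \<beta> c \<gamma> v)" by (simp add: algebra_simps)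
  then show ?thesis by simp
qed

lemma I_fun_nonneg: "XF u g \<Longrightarrow> 0 \<le> I_fun \<beta> c \<gamma> u"
  using I_fun_FT[of u g] zero_le_power2[of "nrm (\<lambda>\<xi>. wt \<xi> * g \<xi>)"]
  by (metis (no_types) mult_pos_pos pi_gt_zero zero_le_mult_iff zero_less_numeral not_less)

lemma I_fun_pos: assumes "XF u g" "nonzero u" shows "0 < I_fun \<beta> c \<gamma> u"
proof (rule ccontr)
  assume "\<not> 0 < I_fun \<beta> c \<gamma> u"
  then have "I_fun \<beta> c \<gamma> u = 0" using I_fun_nonneg[OF assms(1)] by simp
  then have "nrm (\<lambda>\<xi>. wt \<xi> * g \<xi>) = 0" using I_fun_FT[OF assms(1)] by simp
  then have 0: "AE \<xi> in lborel. wt \<xi> * g \<xi> = 0"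
    using assms(1) by (intro nrm_eq_0) (simp_all add: XF_iff)
  have FT: "is_FT u g" using assms(1) by (simp add: XF_def)
  have "AE \<xi> in lborel. cmod (g \<xi>) = cmod 0"
    using 0 AE_nonzero
  proof eventually_elim
    fix \<xi> :: real assume "wt \<xi> * g \<xi> = 0" "\<xi> \<noteq> 0"
    then show "cmod (g \<xi>) = cmod 0" using W_pos[of \<xi>] by (auto simp: wt_def)
  qed
  then have "nrm g = nrm (\<lambda>_. 0)" by (rule nrm_cong_AE) (use is_FT_measurable[OF FT] in auto)
  then have "nrm (\<lambda>x. of_real (u x)) = 0" using FT_isometry[OF is_FT_FT[OF FT]] by (simp add: nrm_def[of "\<lambda>_. 0"])
  then have "AE x in lborel. complex_of_real (u x) = 0" using nrm_eq_0 is_FT_sqint(1)[OF FT] by blast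
  then have "AE x in lborel. u x = 0" by simp
  then show False using assms(2) by (simp add: nonzero_def)
qed

lemma XF_HB_I:
  assumes "XF u g" "I_fun \<beta> c \<gamma> u \<le> A" shows "HB (sqrt (2 * pi * A / \<delta>)) u g"
proof -
  have "nrm (\<lambda>\<xi>. wt \<xi> * g \<xi>) = sqrt (2 * pi * I_fun \<beta> c \<gamma> u)"
    unfolding I_fun_FT[OF assms(1)] by simp
  also have "\<dots> \<le> sqrt (2 * pi * A)" using assms(2) by simp
  finally have "1 / sqrt \<delta> * nrm (\<lambda>\<xi>. wt \<xi> * g \<xi>) \<le> 1 / sqrt \<delta> * sqrt (2 * pi * A)"
    using \<delta>(1) by (intro mult_left_mono) auto
  then have "1 / sqrt \<delta> * nrm (\<lambda>\<xi>. wt \<xi> * g \<xi>) \<le> sqrt (2 * pi * A / \<delta>)" by (simp add: real_sqrt_divide)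
  then show ?thesis using XF_HB[OF assms(1)] by (auto simp: HB_def)
qed

lemma XF_shift:
  assumes "XF u g"
  shows "XF (\<lambda>x. u (x + t)) (\<lambda>\<xi>. cis (t * \<xi>) * g \<xi>)" "I_fun \<beta> c \<gamma> (\<lambda>x. u (x + t)) = I_fun \<beta> c \<gamma> u"
proof -
  have FT: "is_FT u g" and w: "sqint (\<lambda>\<xi>. wt \<xi> * g \<xi>)" using assms by (auto simp: XF_iff)
  have [measurable]: "g \<in> borel_measurable borel" by (rule is_FT_measurable[OF FT])
  have "sqint (\<lambda>\<xi>. wt \<xi> * (cis (t * \<xi>) * g \<xi>))"
    by (rule sqint_mono[OF w, where C=1]) (auto simp: norm_mult)
  then show X: "XF (\<lambda>x. u (x + t)) (\<lambda>\<xi>. cis (t * \<xi>) * g \<xi>)"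
    using FT_shift[OF is_FT_FT[OF FT]] by (simp add: XF_iff is_FT_iff)
  have "nrm (\<lambda>\<xi>. wt \<xi> * (cis (t * \<xi>) * g \<xi>)) = nrm (\<lambda>\<xi>. wt \<xi> * g \<xi>)"
    by (simp add: nrm_def norm_mult)
  then have "2 * pi * I_fun \<beta> c \<gamma> (\<lambda>x. u (x + t)) = 2 * pi * I_fun \<beta> c \<gamma> u"
    unfolding I_fun_FT[OF X] I_fun_FT[OF assms] by simp
  then show "I_fun \<beta> c \<gamma> (\<lambda>x. u (x + t)) = I_fun \<beta> c \<gamma> u" by simp
qed

lemma lowpass_shift: "lowpass N (\<lambda>\<xi>. cis (t * \<xi>) * g \<xi>) 0 = lowpass N g t"
proof -
  have "ft (trunc N (\<lambda>\<xi>. cnj (cis (t * \<xi>) * g \<xi>))) 0 = ft (trunc N (\<lambda>\<xi>. cnj (g \<xi>))) t"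
    unfolding ft_def by (intro Bochner_Integration.integral_cong) (auto simp: trunc_def cis_cnj mult_ac)
  then show ?thesis by (simp add: lowpass_def)
qed

end

section \<open>The homogeneous nonlinearity\<close>

lemma powr_add_le:
  fixes x y r :: real
  assumes "0 \<le> x" "0 \<le> y" "0 \<le> r"
  shows "(x + y) powr r \<le> 2 powr r * (x powr r + y powr r)"
proof -
  have "(x + y) powr r \<le> (2 * max x y) powr r" using assms by (intro powr_mono2) auto
  also have "\<dots> = 2 powr r * (max x y) powr r" by (rule powr_mult)
  also have "(max x y) powr r \<le> x powr r + y powr r" by (simp add: max_def)
  finally show ?thesis by (simp add: mult_left_mono)
qed

locale homogeneous_nonlinearity =
  fixes p :: real and f F f' :: "real \<Rightarrow> real"
  assumes p: "p > 1"
    and f_deriv: "\<And>s. (f has_real_derivative f' s) (at s)"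
    and homog: "\<And>t s. t > 0 \<Longrightarrow> f (t * s) = t powr p * f s"
    and F_deriv: "\<And>s. (F has_real_derivative f s) (at s)"
    and F0: "F 0 = 0"
begin

lemma F_homog: assumes t: "t > 0" shows "F (t * s) = t powr (p + 1) * F s"
proof -
  define h where "h s = F (t * s) - t powr (p + 1) * F s" for s
  have "(h has_real_derivative 0) (at s)" for s
  proof -
    have "(h has_real_derivative (f (t * s) * t - t powr (p + 1) * f s)) (at s)"
      unfolding h_def
      by (auto intro!: derivative_eq_intros DERIV_chain2[OF F_deriv] F_deriv)
    moreover have "f (t * s) * t - t powr (p + 1) * f s = 0"
      using t by (simp add: homog powr_add)
    ultimately show ?thesis by simp
  qed
  then have "h s = h 0" using DERIV_isconst_all[of h s 0] by blast
  then show ?thesis by (simp add: h_def F0)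
qed

lemma f_mult_self: "f s * s = (p + 1) * F s"
proof -
  have "((\<lambda>t. F (t * s)) has_real_derivative f (1 * s) * s) (at 1)"
    by (rule DERIV_chain2[OF F_deriv]) (auto intro!: derivative_eq_intros)
  moreover have "((\<lambda>t. F (t * s)) has_real_derivative (p + 1) * F s) (at 1)"
  proof (rule has_field_derivative_transform_within_open[where f="\<lambda>t. t powr (p + 1) * F s" and S="{0<..}"])
    show "((\<lambda>t. t powr (p + 1) * F s) has_real_derivative (p + 1) * F s) (at 1)"
      by (auto intro!: derivative_eq_intros)
  qed (auto simp: F_homog)
  ultimately show ?thesis using DERIV_unique by fastforce
qed

lemma f_0: "f 0 = 0"
proof -
  have "f 0 = 2 powr p * f 0" using homog[of 2 0] by simp
  moreover have "(2::real) powr p > 1" using powr_less_mono[of 0 p 2] p by simp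
  ultimately show ?thesis by (metis less_irrefl mult_cancel_right1)
qed

lemma f'_homog: assumes t: "t > 0" shows "f' (t * s) = t powr (p - 1) * f' s"
proof -
  have "((\<lambda>s. f (t * s)) has_real_derivative f' (t * s) * t) (at s)"
    by (rule DERIV_chain2[OF f_deriv]) (auto intro!: derivative_eq_intros)
  moreover have "((\<lambda>s. f (t * s)) has_real_derivative t powr p * f' s) (at s)"
    unfolding homog[OF t] by (rule DERIV_cmult[OF f_deriv])
  ultimately have "f' (t * s) * t = t powr p * f' s" by (rule DERIV_unique)
  then show ?thesis using t by (simp add: powr_diff field_simps)
qed

lemma f'_0: "f' 0 = 0"
proof -
  have "f' 0 = 2 powr (p - 1) * f' 0" using f'_homog[of 2 0] by simp
  moreover have "(2::real) powr (p - 1) > 1" using powr_less_mono[of 0 "p - 1" 2] p by simp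
  ultimately show ?thesis by (metis less_irrefl mult_cancel_right1)
qed

definition A :: real where
  "A = \<bar>f 1\<bar> + \<bar>f (-1)\<bar> + \<bar>f' 1\<bar> + \<bar>f' (-1)\<bar>"

lemma A_nonneg: "0 \<le> A" by (simp add: A_def)

lemma homog_bound:
  fixes g :: "real \<Rightarrow> real" and r C s :: real
  assumes "\<And>t s. t > 0 \<Longrightarrow> g (t * s) = t powr r * g s" "g 0 = 0" "\<bar>g 1\<bar> \<le> C" "\<bar>g (-1)\<bar> \<le> C"
  shows "\<bar>g s\<bar> \<le> C * \<bar>s\<bar> powr r"
proof (cases "s = 0")
  case False
  have "g s = g (\<bar>s\<bar> * sgn s)" by (simp add: abs_mult_sgn)
  also have "\<dots> = \<bar>s\<bar> powr r * g (sgn s)" using False by (intro assms) simp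
  finally have eq: "\<bar>g s\<bar> = \<bar>s\<bar> powr r * \<bar>g (sgn s)\<bar>" by (simp add: abs_mult)
  have "\<bar>g (sgn s)\<bar> \<le> C" using False assms(3,4) by (auto simp: sgn_if)
  from mult_left_mono[OF this, of "\<bar>s\<bar> powr r"] show ?thesis unfolding eq by (simp add: mult.commute)
qed (use assms in auto)

lemma f_bound: "\<bar>f s\<bar> \<le> A * \<bar>s\<bar> powr p"
  by (rule homog_bound[OF homog f_0]) (auto simp: A_def)

lemma f'_bound: "\<bar>f' s\<bar> \<le> A * \<bar>s\<bar> powr (p - 1)"
  by (rule homog_bound[OF f'_homog f'_0]) (auto simp: A_def)

lemma F_bound: "\<bar>F s\<bar> \<le> A * \<bar>s\<bar> powr (p + 1)"
proof -
  have "\<bar>F s\<bar> \<le> (p + 1) * \<bar>F s\<bar>" using p by (simp add: mult_le_cancel_right1)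
  also have "\<dots> = \<bar>f s\<bar> * \<bar>s\<bar>" using p arg_cong[OF f_mult_self[of s], of abs] by (simp add: abs_mult)
  also have "\<dots> \<le> A * \<bar>s\<bar> powr p * \<bar>s\<bar>" by (intro mult_right_mono f_bound) simp
  also have "\<dots> = A * \<bar>s\<bar> powr (p + 1)" by (cases "s = 0") (simp_all add: powr_add)
  finally show ?thesis .
qed

lemma MVT_any:
  assumes "\<And>s. (g has_real_derivative g' s) (at s)"
  shows "\<exists>z. \<bar>z\<bar> \<le> \<bar>a\<bar> + \<bar>b\<bar> \<and> \<bar>z - a\<bar> \<le> \<bar>b\<bar> \<and> g (a + b) - g a = g' z * b"
proof -
  consider "b > 0" | "b = 0" | "b < 0" by linarith
  then show ?thesis
  proof cases
    case 1
    then obtain z where "a < z" "z < a + b" "g (a + b) - g a = (a + b - a) * g' z"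
      using MVT2[of a "a + b" g g'] assms by auto
    then show ?thesis using 1 by (intro exI[of _ z]) auto
  next
    case 2
    then show ?thesis by (intro exI[of _ a]) auto
  next
    case 3
    then obtain z where "a + b < z" "z < a" "g a - g (a + b) = (a - (a + b)) * g' z"
      using MVT2[of "a + b" a g g'] assms by auto
    then show ?thesis using 3 by (intro exI[of _ z]) (auto simp: algebra_simps)
  qed
qed

lemma F_diff_bound: "\<bar>F (a + b) - F a\<bar> \<le> A * 2 powr p * ((\<bar>a\<bar> powr p + \<bar>b\<bar> powr p) * \<bar>b\<bar>)"
proof -
  obtain z where z: "\<bar>z\<bar> \<le> \<bar>a\<bar> + \<bar>b\<bar>" "F (a + b) - F a = f z * b" using MVT_any[OF F_deriv] by blast
  have "\<bar>f z\<bar> \<le> A * \<bar>z\<bar> powr p" by (rule f_bound)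
  also have "\<dots> \<le> A * (\<bar>a\<bar> + \<bar>b\<bar>) powr p" using z p A_nonneg by (intro mult_left_mono powr_mono2) auto
  also have "\<dots> \<le> A * (2 powr p * (\<bar>a\<bar> powr p + \<bar>b\<bar> powr p))"
    using A_nonneg p by (intro mult_left_mono powr_add_le) auto
  finally have "\<bar>f z\<bar> * \<bar>b\<bar> \<le> A * (2 powr p * (\<bar>a\<bar> powr p + \<bar>b\<bar> powr p)) * \<bar>b\<bar>" by (rule mult_right_mono) simp
  then show ?thesis unfolding z(2) abs_mult by (simp only: mult.assoc)
qed

lemma F_split_bound:
  "\<bar>F (a + b) - F a - F b\<bar> \<le> A * (2 powr p * 2 + 1) * (\<bar>a\<bar> powr p * \<bar>b\<bar> + \<bar>a\<bar> * \<bar>b\<bar> powr p)"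
proof -
  have main: "\<bar>F (a + b) - F a - F b\<bar> \<le> A * (2 powr p * 2 + 1) * (\<bar>a\<bar> powr p * \<bar>b\<bar>)" if ab: "\<bar>b\<bar> \<le> \<bar>a\<bar>" for a b
  proof -
    have bp: "\<bar>b\<bar> powr p \<le> \<bar>a\<bar> powr p" using ab p by (intro powr_mono2) auto
    have "\<bar>F (a + b) - F a\<bar> \<le> A * 2 powr p * ((\<bar>a\<bar> powr p + \<bar>b\<bar> powr p) * \<bar>b\<bar>)" by (rule F_diff_bound)
    also have "\<dots> \<le> A * 2 powr p * ((\<bar>a\<bar> powr p + \<bar>a\<bar> powr p) * \<bar>b\<bar>)"
      using A_nonneg bp by (intro mult_left_mono mult_right_mono) auto
    finally have 1: "\<bar>F (a + b) - F a\<bar> \<le> A * 2 powr p * 2 * (\<bar>a\<bar> powr p * \<bar>b\<bar>)" by (simp add: algebra_simps)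
    have "\<bar>F b\<bar> \<le> A * (\<bar>b\<bar> powr p * \<bar>b\<bar>)" using F_bound[of b] by (cases "b = 0") (simp_all add: powr_add)
    also have "\<dots> \<le> A * (\<bar>a\<bar> powr p * \<bar>b\<bar>)" using A_nonneg bp by (intro mult_left_mono mult_right_mono) auto
    finally have 2: "\<bar>F b\<bar> \<le> A * (\<bar>a\<bar> powr p * \<bar>b\<bar>)" .
    have "\<bar>F (a + b) - F a - F b\<bar> \<le> \<bar>F (a + b) - F a\<bar> + \<bar>F b\<bar>" by (rule abs_triangle_ineq4)
    with 1 2 have "\<bar>F (a + b) - F a - F b\<bar> \<le> A * 2 powr p * 2 * (\<bar>a\<bar> powr p * \<bar>b\<bar>) + A * (\<bar>a\<bar> powr p * \<bar>b\<bar>)" by linarith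
    then show ?thesis by (simp add: algebra_simps)
  qed
  have C: "0 \<le> A * (2 powr p * 2 + 1)" using A_nonneg by simp
  show ?thesis
  proof (cases "\<bar>b\<bar> \<le> \<bar>a\<bar>")
    case True
    have "A * (2 powr p * 2 + 1) * (\<bar>a\<bar> powr p * \<bar>b\<bar>) \<le> A * (2 powr p * 2 + 1) * (\<bar>a\<bar> powr p * \<bar>b\<bar> + \<bar>a\<bar> * \<bar>b\<bar> powr p)"
      by (intro mult_left_mono C) simp
    with main[OF True] show ?thesis by linarith
  next
    case False
    have "A * (2 powr p * 2 + 1) * (\<bar>b\<bar> powr p * \<bar>a\<bar>) \<le> A * (2 powr p * 2 + 1) * (\<bar>a\<bar> powr p * \<bar>b\<bar> + \<bar>a\<bar> * \<bar>b\<bar> powr p)"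
      by (intro mult_left_mono C) (simp add: mult.commute)
    moreover have "\<bar>F (b + a) - F b - F a\<bar> \<le> A * (2 powr p * 2 + 1) * (\<bar>b\<bar> powr p * \<bar>a\<bar>)"
      using False by (intro main) simp
    moreover have "F (b + a) - F b - F a = F (a + b) - F a - F b" by (simp add: add.commute)
    ultimately show ?thesis by linarith
  qed
qed

lemma F_Taylor_bound:
  "\<bar>F (a + b) - F a - f a * b\<bar> \<le> A * (\<bar>a\<bar> + \<bar>b\<bar>) powr (p - 1) * b\<^sup>2"
proof -
  obtain z where z: "\<bar>z - a\<bar> \<le> \<bar>b\<bar>" "F (a + b) - F a = f z * b" using MVT_any[OF F_deriv] by blast
  obtain y where y: "\<bar>y\<bar> \<le> \<bar>a\<bar> + \<bar>z - a\<bar>" "f (a + (z - a)) - f a = f' y * (z - a)" using MVT_any[OF f_deriv] by blast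
  have fz: "f z = f a + f' y * (z - a)" using y(2) by simp
  have "F (a + b) - F a - f a * b = f' y * (z - a) * b" unfolding z(2) fz by (simp add: algebra_simps)
  then have "\<bar>F (a + b) - F a - f a * b\<bar> = \<bar>f' y\<bar> * (\<bar>z - a\<bar> * \<bar>b\<bar>)" by (simp add: abs_mult)
  also have "\<dots> \<le> (A * (\<bar>a\<bar> + \<bar>b\<bar>) powr (p - 1)) * (\<bar>b\<bar> * \<bar>b\<bar>)"
  proof (rule mult_mono)
    have "\<bar>f' y\<bar> \<le> A * \<bar>y\<bar> powr (p - 1)" by (rule f'_bound)
    also have "\<dots> \<le> A * (\<bar>a\<bar> + \<bar>b\<bar>) powr (p - 1)"
      using y z p A_nonneg by (intro mult_left_mono powr_mono2) auto
    finally show "\<bar>f' y\<bar> \<le> A * (\<bar>a\<bar> + \<bar>b\<bar>) powr (p - 1)" .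
    show "\<bar>z - a\<bar> * \<bar>b\<bar> \<le> \<bar>b\<bar> * \<bar>b\<bar>" using z by (intro mult_right_mono) auto
  qed (use A_nonneg in auto)
  finally show ?thesis by (simp add: power2_eq_square)
qed

lemma F_measurable[measurable]: "F \<in> borel_measurable borel"
proof (rule borel_measurable_continuous_onI)
  show "continuous_on UNIV F" by (rule DERIV_continuous_on[of UNIV F f]) (simp add: F_deriv)
qed

lemma f_measurable[measurable]: "f \<in> borel_measurable borel"
proof (rule borel_measurable_continuous_onI)
  show "continuous_on UNIV f" by (rule DERIV_continuous_on[of UNIV f f']) (simp add: f_deriv)
qed

end

section \<open>Integrals of the nonlinearity\<close>

lemma HB_mono: "HB M u g \<Longrightarrow> M \<le> M' \<Longrightarrow> HB M' u g"
  by (auto simp: HB_def)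

lemma HB_measurable: "HB M u g \<Longrightarrow> u \<in> borel_measurable borel"
  by (auto simp: HB_def intro: is_FT_measurable)

lemma HB_sqint_powr:
  assumes "HB M u g" "M > 0" "r \<ge> 1"
  shows "sqint (\<lambda>x. of_real (\<bar>u x\<bar> powr r))" "nrm (\<lambda>x. of_real (\<bar>u x\<bar> powr r)) \<le> sqrt (Lr_const (2 * r) M)"
proof -
  have [measurable]: "u \<in> borel_measurable borel" by (rule HB_measurable[OF assms(1)])
  have eq: "(cmod (complex_of_real (\<bar>u x\<bar> powr r)))\<^sup>2 = \<bar>u x\<bar> powr (2 * r)" for x
    by (simp add: power2_eq_square flip: powr_add)
  show "sqint (\<lambda>x. of_real (\<bar>u x\<bar> powr r))"
    by (rule sqintI, measurable, unfold eq) (rule Lr_bound(1)[OF assms(1,2)], use assms in simp)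
  show "nrm (\<lambda>x. of_real (\<bar>u x\<bar> powr r)) \<le> sqrt (Lr_const (2 * r) M)"
    unfolding nrm_def eq by (intro real_sqrt_le_mono Lr_bound(2)[OF assms(1,2)]) (use assms in simp)
qed

lemma HB_diff:
  assumes "HB M u g" "HB M v h" shows "HB (2 * M) (\<lambda>x. u x - v x) (\<lambda>\<xi>. g \<xi> - h \<xi>)"
proof -
  have FT: "is_FT (\<lambda>x. u x - v x) (\<lambda>\<xi>. g \<xi> - h \<xi>)"
    using assms is_FT_lincomb[of u g v h 1 "-1"] by (simp add: HB_def)
  have s: "sqint (\<lambda>\<xi>. hw \<xi> * g \<xi>)" "sqint (\<lambda>\<xi>. hw \<xi> * h \<xi>)" "nrm (\<lambda>\<xi>. hw \<xi> * g \<xi>) \<le> M" "nrm (\<lambda>\<xi>. hw \<xi> * h \<xi>) \<le> M"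
    using assms by (auto simp: HB_def)
  have "nrm (\<lambda>\<xi>. hw \<xi> * g \<xi> - hw \<xi> * h \<xi>) \<le> 2 * M"
    using nrm_triangle[OF s(1) sqint_cmult[OF s(2), of "-1"]] nrm_cmult[of "-1" "\<lambda>\<xi>. hw \<xi> * h \<xi>"] s(3,4) by simp
  then show ?thesis using FT sqint_diff[OF s(1,2)] by (simp add: HB_def right_diff_distrib)
qed

context homogeneous_nonlinearity
begin

lemma integrable_F: assumes "HB M u g" "M > 0" shows "integrable lborel (\<lambda>x. F (u x))"
proof (rule Bochner_Integration.integrable_bound)
  have [measurable]: "u \<in> borel_measurable borel" by (rule HB_measurable[OF assms(1)])
  show "integrable lborel (\<lambda>x. A * \<bar>u x\<bar> powr (p + 1))"
    using Lr_bound(1)[OF assms, of "p + 1"] p by simp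
  show "AE x in lborel. norm (F (u x)) \<le> norm (A * \<bar>u x\<bar> powr (p + 1))"
    using F_bound A_nonneg by (simp add: abs_mult)
  show "(\<lambda>x. F (u x)) \<in> borel_measurable lborel" by measurable
qed

lemma integrable_f_mult:
  assumes "HB M u g" "M > 0" "HB M' v h"
  shows "integrable lborel (\<lambda>x. f (u x) * v x)"
proof (rule Bochner_Integration.integrable_bound)
  have [measurable]: "u \<in> borel_measurable borel" "v \<in> borel_measurable borel" using assms by (auto intro: HB_measurable)
  have sv: "sqint (\<lambda>x. complex_of_real (v x))" using assms(3) by (auto simp: HB_def intro: is_FT_sqint)
  have "integrable lborel (\<lambda>x. \<bar>u x\<bar> powr p * \<bar>v x\<bar>)"
    using Cauchy_Schwarz_integrable[OF HB_sqint_powr(1)[OF assms(1,2), of p] sv] p by simp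
  then show "integrable lborel (\<lambda>x. A * (\<bar>u x\<bar> powr p * \<bar>v x\<bar>))" by simp
  show "AE x in lborel. norm (f (u x) * v x) \<le> norm (A * (\<bar>u x\<bar> powr p * \<bar>v x\<bar>))"
  proof (rule AE_I2)
    fix x
    have "\<bar>f (u x)\<bar> * \<bar>v x\<bar> \<le> A * \<bar>u x\<bar> powr p * \<bar>v x\<bar>" by (intro mult_right_mono f_bound) simp
    then show "norm (f (u x) * v x) \<le> norm (A * (\<bar>u x\<bar> powr p * \<bar>v x\<bar>))"
      using A_nonneg by (simp add: abs_mult mult.assoc)
  qed
  show "(\<lambda>x. f (u x) * v x) \<in> borel_measurable lborel" by measurable
qed

lemma K_fun_bound:
  assumes "HB M u g" "M > 0" shows "\<bar>K_fun p F u\<bar> \<le> (p + 1) * A * (LINT x|lborel. \<bar>u x\<bar> powr (p + 1))"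
proof -
  have "\<bar>LINT x|lborel. F (u x)\<bar> \<le> (LINT x|lborel. \<bar>F (u x)\<bar>)"
    using integral_norm_bound[of lborel "\<lambda>x. F (u x)"] by simp
  also have "\<dots> \<le> (LINT x|lborel. A * \<bar>u x\<bar> powr (p + 1))"
    using integrable_F[OF assms] Lr_bound(1)[OF assms, of "p + 1"] p F_bound by (intro integral_mono) auto
  finally have "\<bar>LINT x|lborel. F (u x)\<bar> \<le> A * (LINT x|lborel. \<bar>u x\<bar> powr (p + 1))" by simp
  then have "(p + 1) * \<bar>LINT x|lborel. F (u x)\<bar> \<le> (p + 1) * (A * (LINT x|lborel. \<bar>u x\<bar> powr (p + 1)))"
    using p by (intro mult_left_mono) auto
  moreover have "\<bar>- (p + 1)\<bar> = p + 1" using p by simp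
  ultimately show ?thesis unfolding K_fun_def abs_mult by (simp only: mult.assoc)
qed

lemma K_fun_scale: "t > 0 \<Longrightarrow> K_fun p F (\<lambda>x. t * u x) = t powr (p + 1) * K_fun p F u"
  by (simp add: K_fun_def F_homog)

lemma K_fun_shift: "K_fun p F (\<lambda>x. u (x + t)) = K_fun p F u"
  using lborel_integral_real_affine[of 1 "\<lambda>x. F (u x)" t] by (simp add: K_fun_def add.commute)

lemma integral_f_self: "(LINT x|lborel. f (u x) * u x) = - K_fun p F u"
  by (simp only: K_fun_def f_mult_self integral_mult_right_zero minus_mult_left[symmetric] minus_minus)

lemma K_fun_split:
  assumes HB: "\<And>n. HB M (u n) (g n)" "HB M w h" "M > 0" and conv: "wconv u w"
  shows "(\<lambda>n. K_fun p F (u n) - K_fun p F (\<lambda>x. u n x - w x)) \<longlonglongrightarrow> K_fun p F w"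
proof -
  define z where "z n x = u n x - w x" for n x
  have zH: "HB (2 * M) (z n) (\<lambda>\<xi>. g n \<xi> - h \<xi>)" for n unfolding z_def by (rule HB_diff[OF HB(1,2)])
  have M2: "2 * M > 0" using HB(3) by simp
  have [measurable]: "w \<in> borel_measurable borel" "z n \<in> borel_measurable borel" for n
    using HB_measurable[OF HB(2)] HB_measurable[OF zH] by auto
  have sw: "sqint (\<lambda>x. complex_of_real (w x))" and sz: "sqint (\<lambda>x. complex_of_real (z n x))" for n
    using HB(2) zH[of n] by (auto simp: HB_def intro: is_FT_sqint)
  define C where "C = A * (2 powr p * 2 + 1)"
  have C: "C \<ge> 0" using A_nonneg by (simp add: C_def)
  define X1 where "X1 n = (LINT x|lborel. \<bar>z n x\<bar> * \<bar>w x\<bar> powr p)" for n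
  define X2 where "X2 n = (LINT x|lborel. \<bar>z n x\<bar> * \<bar>w x\<bar>)" for n
  define X3 where "X3 n = (LINT x|lborel. \<bar>z n x\<bar> powr p * \<bar>w x\<bar>)" for n
  have X1: "X1 \<longlonglongrightarrow> 0" using conv HB_sqint_powr(1)[OF HB(2,3), of p] p
    unfolding wconv_def X1_def z_def by fastforce
  have X2: "X2 \<longlonglongrightarrow> 0" using conv sw unfolding wconv_def X2_def z_def by fastforce
  have i1: "integrable lborel (\<lambda>x. \<bar>z n x\<bar> * \<bar>w x\<bar> powr p)" for n
    using Cauchy_Schwarz_integrable[OF sz[of n] HB_sqint_powr(1)[OF HB(2,3), of p]] p by simp
  have i2: "integrable lborel (\<lambda>x. \<bar>z n x\<bar> * \<bar>w x\<bar>)" for n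
    using Cauchy_Schwarz_integrable[OF sz[of n] sw] by simp
  have i3: "integrable lborel (\<lambda>x. \<bar>z n x\<bar> powr r * \<bar>w x\<bar>)" if "r \<ge> 1" for n r
    using Cauchy_Schwarz_integrable[OF HB_sqint_powr(1)[OF zH M2 that, of n] sw] by simp
  define D where "D = sqrt (Lr_const (2 * (p + 1)) (2 * M)) * nrm (\<lambda>x. complex_of_real (w x))"
  have D: "(LINT x|lborel. \<bar>z n x\<bar> powr (p + 1) * \<bar>w x\<bar>) \<le> D" for n
  proof -
    have q: "p + 1 \<ge> 1" using p by simp
    have "(LINT x|lborel. \<bar>z n x\<bar> powr (p + 1) * \<bar>w x\<bar>)
      \<le> nrm (\<lambda>x. complex_of_real (\<bar>z n x\<bar> powr (p + 1))) * nrm (\<lambda>x. complex_of_real (w x))"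
      using Cauchy_Schwarz[OF HB_sqint_powr(1)[OF zH M2 q, of n] sw] by simp
    also have "\<dots> \<le> D" unfolding D_def by (intro mult_right_mono HB_sqint_powr(2)[OF zH M2 q]) simp
    finally show ?thesis .
  qed
  have D0: "D \<ge> 0" using D[of 0] by (rule order_trans[rotated]) simp
  have X3_le: "X3 n \<le> L powr (p - 1) * X2 n + D / L" if L: "L > 0" for n L
  proof -
    have "X3 n \<le> (LINT x|lborel. L powr (p - 1) * (\<bar>z n x\<bar> * \<bar>w x\<bar>) + 1 / L * (\<bar>z n x\<bar> powr (p + 1) * \<bar>w x\<bar>))"
      unfolding X3_def
    proof (rule integral_mono)
      show "integrable lborel (\<lambda>x. \<bar>z n x\<bar> powr p * \<bar>w x\<bar>)" using i3[of p] p by simp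
      show "integrable lborel (\<lambda>x. L powr (p - 1) * (\<bar>z n x\<bar> * \<bar>w x\<bar>) + 1 / L * (\<bar>z n x\<bar> powr (p + 1) * \<bar>w x\<bar>))"
        using i2[of n] i3[of "p + 1" n] p by (intro Bochner_Integration.integrable_add integrable_mult_right) auto
      fix x
      define s where "s = \<bar>z n x\<bar>"
      have "s powr p \<le> L powr (p - 1) * s + 1 / L * s powr (p + 1)"
      proof (cases "s \<le> L")
        case True
        have "s powr p = s powr (p - 1) * s" unfolding s_def by (cases "z n x = 0") (simp_all add: powr_diff)
        also have "\<dots> \<le> L powr (p - 1) * s" using True p by (intro mult_right_mono powr_mono2) (auto simp: s_def)
        finally show ?thesis using L by (simp add: add_increasing2)
      next
        case False
        have "L * s powr p \<le> s * s powr p" using False L by (intro mult_right_mono) auto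
        also have "\<dots> = s powr (p + 1)" using False L by (simp add: powr_add)
        finally have "s powr p \<le> 1 / L * s powr (p + 1)" using L by (simp add: field_simps)
        moreover have "0 \<le> L powr (p - 1) * s" by (simp add: s_def)
        ultimately show ?thesis by linarith
      qed
      from mult_right_mono[OF this, of "\<bar>w x\<bar>"]
      show "\<bar>z n x\<bar> powr p * \<bar>w x\<bar> \<le> L powr (p - 1) * (\<bar>z n x\<bar> * \<bar>w x\<bar>) + 1 / L * (\<bar>z n x\<bar> powr (p + 1) * \<bar>w x\<bar>)"
        by (simp add: s_def distrib_right mult.assoc)
    qed
    also have "\<dots> = L powr (p - 1) * X2 n + 1 / L * (LINT x|lborel. \<bar>z n x\<bar> powr (p + 1) * \<bar>w x\<bar>)"
      unfolding X2_def using i2[of n] i3[of "p + 1" n] p by simp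
    also have "\<dots> \<le> L powr (p - 1) * X2 n + 1 / L * D"
      using L by (intro add_left_mono mult_left_mono D) simp
    finally show ?thesis by simp
  qed
  have X3: "X3 \<longlonglongrightarrow> 0"
  proof (rule LIMSEQ_I)
    fix e :: real assume e: "e > 0"
    define L where "L = 2 * (D + 1) / e"
    have L: "L > 0" using e D0 by (simp add: L_def)
    have "D / L < e / 2" using e D0 by (simp add: L_def field_simps)
    have "(\<lambda>n. L powr (p - 1) * X2 n) \<longlonglongrightarrow> L powr (p - 1) * 0" by (intro tendsto_intros X2)
    then have "\<forall>\<^sub>F n in sequentially. L powr (p - 1) * X2 n < e / 2" using e by (intro order_tendstoD) auto
    then obtain N where N: "\<And>n. n \<ge> N \<Longrightarrow> L powr (p - 1) * X2 n < e / 2" by (auto simp: eventually_sequentially)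
    have "norm (X3 n - 0) < e" if "n \<ge> N" for n
    proof -
      have "0 \<le> X3 n" by (simp add: X3_def)
      moreover have "X3 n < e" using X3_le[OF L, of n] N[OF that] \<open>D / L < e / 2\<close> by linarith
      ultimately show ?thesis by simp
    qed
    then show "\<exists>N. \<forall>n\<ge>N. norm (X3 n - 0) < e" by blast
  qed
  have "(\<lambda>n. K_fun p F (u n) - K_fun p F (z n) - K_fun p F w) \<longlonglongrightarrow> 0"
  proof (rule Lim_null_comparison)
    have "(\<lambda>n. (p + 1) * C * (X1 n + X3 n)) \<longlonglongrightarrow> (p + 1) * C * (0 + 0)" by (intro tendsto_intros X1 X3)
    then show "(\<lambda>n. (p + 1) * C * (X1 n + X3 n)) \<longlonglongrightarrow> 0" by simp
    have "\<bar>K_fun p F (u n) - K_fun p F (z n) - K_fun p F w\<bar> \<le> (p + 1) * C * (X1 n + X3 n)" for n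
    proof -
      note iF = integrable_F[OF HB(1)[of n] HB(3)] integrable_F[OF zH[of n] M2] integrable_F[OF HB(2,3)]
      have "K_fun p F (u n) - K_fun p F (z n) - K_fun p F w = - (p + 1) * (LINT x|lborel. F (u n x) - F (z n x) - F (w x))"
        using iF by (simp add: K_fun_def algebra_simps)
      then have eq: "\<bar>K_fun p F (u n) - K_fun p F (z n) - K_fun p F w\<bar> = (p + 1) * \<bar>LINT x|lborel. F (u n x) - F (z n x) - F (w x)\<bar>"
        using p by (simp add: abs_mult)
      have "\<bar>LINT x|lborel. F (u n x) - F (z n x) - F (w x)\<bar> \<le> (LINT x|lborel. \<bar>F (u n x) - F (z n x) - F (w x)\<bar>)"
        using integral_norm_bound[of lborel "\<lambda>x. F (u n x) - F (z n x) - F (w x)"] by simp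
      also have "\<dots> \<le> (LINT x|lborel. C * (\<bar>z n x\<bar> powr p * \<bar>w x\<bar> + \<bar>z n x\<bar> * \<bar>w x\<bar> powr p))"
      proof (rule integral_mono)
        show "integrable lborel (\<lambda>x. \<bar>F (u n x) - F (z n x) - F (w x)\<bar>)" using iF by (intro integrable_abs) simp
        show "integrable lborel (\<lambda>x. C * (\<bar>z n x\<bar> powr p * \<bar>w x\<bar> + \<bar>z n x\<bar> * \<bar>w x\<bar> powr p))"
          using i1[of n] i3[of p n] p by simp
        fix x
        have "u n x = z n x + w x" by (simp add: z_def)
        then show "\<bar>F (u n x) - F (z n x) - F (w x)\<bar> \<le> C * (\<bar>z n x\<bar> powr p * \<bar>w x\<bar> + \<bar>z n x\<bar> * \<bar>w x\<bar> powr p)"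
          using F_split_bound[of "z n x" "w x"] by (simp add: C_def)
      qed
      also have "\<dots> = C * (X3 n + X1 n)"
        unfolding X1_def X3_def using i1[of n] i3[of p n] p by simp
      finally have le: "\<bar>LINT x|lborel. F (u n x) - F (z n x) - F (w x)\<bar> \<le> C * (X1 n + X3 n)" by (simp only: add.commute)
      show ?thesis unfolding eq using mult_left_mono[OF le, of "p + 1"] p by (simp add: mult.assoc)
    qed
    then show "\<forall>\<^sub>F n in sequentially. norm (K_fun p F (u n) - K_fun p F (z n) - K_fun p F w) \<le> (p + 1) * C * (X1 n + X3 n)" by simp
  qed
  then have "(\<lambda>n. (K_fun p F (u n) - K_fun p F (z n) - K_fun p F w) + K_fun p F w) \<longlonglongrightarrow> 0 + K_fun p F w"
    by (intro tendsto_intros)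
  then show ?thesis unfolding z_def by simp
qed

lemma K_fun_tendsto:
  assumes HB: "\<And>n. HB M (u n) (g n)" "HB M w h" "M > 0"
    and conv: "(\<lambda>n. nrm (\<lambda>x. of_real (u n x - w x))) \<longlonglongrightarrow> 0"
  shows "(\<lambda>n. K_fun p F (u n)) \<longlonglongrightarrow> K_fun p F w"
proof -
  define z where "z n x = u n x - w x" for n x
  have zH: "HB (2 * M) (z n) (\<lambda>\<xi>. g n \<xi> - h \<xi>)" for n unfolding z_def by (rule HB_diff[OF HB(1,2)])
  have M2: "2 * M > 0" using HB(3) by simp
  have sz: "sqint (\<lambda>x. complex_of_real (z n x))" for n using zH[of n] by (auto simp: HB_def intro: is_FT_sqint)
  have sw: "sqint (\<lambda>x. complex_of_real (w x))" using HB(2) by (auto simp: HB_def intro: is_FT_sqint)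
  have "wconv u w"
    unfolding wconv_def
  proof (intro conjI sw allI impI)
    fix v assume v: "sqint v"
    show "(\<lambda>n. LINT x|lborel. \<bar>u n x - w x\<bar> * cmod (v x)) \<longlonglongrightarrow> 0"
    proof (rule Lim_null_comparison)
      have "(\<lambda>n. nrm (\<lambda>x. of_real (z n x)) * nrm v) \<longlonglongrightarrow> 0 * nrm v"
        using conv unfolding z_def by (intro tendsto_intros)
      then show "(\<lambda>n. nrm (\<lambda>x. of_real (z n x)) * nrm v) \<longlonglongrightarrow> 0" by simp
      have "norm (LINT x|lborel. \<bar>u n x - w x\<bar> * cmod (v x)) \<le> nrm (\<lambda>x. of_real (z n x)) * nrm v" for n
      proof -
        have "0 \<le> (LINT x|lborel. \<bar>z n x\<bar> * cmod (v x))" by simp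
        then show ?thesis using Cauchy_Schwarz[OF sz[of n] v] unfolding norm_of_real z_def[symmetric] real_norm_def by linarith
      qed
      then show "\<forall>\<^sub>F n in sequentially. norm (LINT x|lborel. \<bar>u n x - w x\<bar> * cmod (v x)) \<le> nrm (\<lambda>x. of_real (z n x)) * nrm v"
        by (rule always_eventually[OF allI])
    qed
  qed
  from K_fun_split[OF HB this]
  have 1: "(\<lambda>n. K_fun p F (u n) - K_fun p F (z n)) \<longlonglongrightarrow> K_fun p F w" unfolding z_def .
  have "(\<lambda>n. K_fun p F (z n)) \<longlonglongrightarrow> 0"
  proof (rule Lim_null_comparison)
    define D where "D = (p + 1) * A * sqrt (Lr_const (2 * p) (2 * M))"
    have "(\<lambda>n. D * nrm (\<lambda>x. of_real (z n x))) \<longlonglongrightarrow> D * 0" using conv unfolding z_def by (intro tendsto_intros)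
    then show "(\<lambda>n. D * nrm (\<lambda>x. of_real (z n x))) \<longlonglongrightarrow> 0" by simp
    have "\<bar>K_fun p F (z n)\<bar> \<le> D * nrm (\<lambda>x. of_real (z n x))" for n
    proof -
      have p1: "p \<ge> 1" using p by simp
      have "(LINT x|lborel. \<bar>z n x\<bar> powr (p + 1)) = (LINT x|lborel. \<bar>z n x\<bar> powr p * \<bar>z n x\<bar>)"
        by (intro Bochner_Integration.integral_cong) (auto simp: powr_add)
      also have "\<dots> \<le> nrm (\<lambda>x. complex_of_real (\<bar>z n x\<bar> powr p)) * nrm (\<lambda>x. complex_of_real (z n x))"
        using Cauchy_Schwarz[OF HB_sqint_powr(1)[OF zH M2 p1, of n] sz[of n]] by simp
      also have "\<dots> \<le> sqrt (Lr_const (2 * p) (2 * M)) * nrm (\<lambda>x. complex_of_real (z n x))"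
        by (intro mult_right_mono HB_sqint_powr(2)[OF zH M2 p1]) simp
      finally have "(p + 1) * A * (LINT x|lborel. \<bar>z n x\<bar> powr (p + 1))
          \<le> (p + 1) * A * (sqrt (Lr_const (2 * p) (2 * M)) * nrm (\<lambda>x. complex_of_real (z n x)))"
        using p A_nonneg by (intro mult_left_mono) auto
      then show ?thesis using K_fun_bound[OF zH M2, of n] unfolding D_def by linarith
    qed
    then show "\<forall>\<^sub>F n in sequentially. norm (K_fun p F (z n)) \<le> D * nrm (\<lambda>x. of_real (z n x))" by simp
  qed
  from tendsto_add[OF 1 this] show ?thesis by simp
qed

lemma K_fun_deriv:
  assumes u: "HB M u g" and v: "HB M v h" and M: "M > 0"
  shows "((\<lambda>t. K_fun p F (\<lambda>x. u x + t * v x)) has_real_derivative - (p + 1) * (LINT x|lborel. f (u x) * v x)) (at 0)"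
proof -
  have [measurable]: "u \<in> borel_measurable borel" "v \<in> borel_measurable borel" using u v by (auto intro: HB_measurable)
  define k where "k t = (LINT x|lborel. F (u x + t * v x))" for t
  define d where "d = (LINT x|lborel. f (u x) * v x)"
  define R where "R x = A * (2 powr (p + 1) * (\<bar>u x\<bar> powr (p + 1) + \<bar>v x\<bar> powr (p + 1)))" for x
  have iR: "integrable lborel R"
    unfolding R_def using Lr_bound(1)[OF u M, of "p + 1"] Lr_bound(1)[OF v M, of "p + 1"] p by simp
  have rem: "\<bar>F (u x + t * v x) - F (u x) - t * (f (u x) * v x)\<bar> \<le> t\<^sup>2 * R x" if t: "\<bar>t\<bar> \<le> 1" for t x
  proof -
    define a where "a = \<bar>u x\<bar> + \<bar>v x\<bar>"
    have "\<bar>t * v x\<bar> \<le> \<bar>v x\<bar>" using t by (simp add: abs_mult mult_left_le_one_le)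
    have "\<bar>F (u x + t * v x) - F (u x) - f (u x) * (t * v x)\<bar> \<le> A * (\<bar>u x\<bar> + \<bar>t * v x\<bar>) powr (p - 1) * (t * v x)\<^sup>2"
      by (rule F_Taylor_bound)
    also have "\<dots> \<le> A * a powr (p - 1) * (t\<^sup>2 * a\<^sup>2)"
    proof (intro mult_mono)
      show "(\<bar>u x\<bar> + \<bar>t * v x\<bar>) powr (p - 1) \<le> a powr (p - 1)"
        using p \<open>\<bar>t * v x\<bar> \<le> \<bar>v x\<bar>\<close> by (intro powr_mono2) (auto simp: a_def)
      have "(v x)\<^sup>2 \<le> a\<^sup>2" unfolding a_def by (intro abs_le_square_iff[THEN iffD1]) simp
      then show "(t * v x)\<^sup>2 \<le> t\<^sup>2 * a\<^sup>2" by (simp add: power_mult_distrib mult_left_mono)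
    qed (use A_nonneg in auto)
    also have "\<dots> = t\<^sup>2 * (A * a powr (p + 1))"
    proof (cases "a = 0")
      case False
      then have "a > 0" by (auto simp: a_def)
      moreover have "a powr (p + 1) = a powr (p - 1) * a powr 2" by (simp add: add.commute flip: powr_add)
      ultimately have "a powr (p + 1) = a powr (p - 1) * a\<^sup>2" by (simp add: powr_numeral)
      then show ?thesis by simp
    qed simp
    also have "\<dots> \<le> t\<^sup>2 * R x"
      unfolding R_def a_def using p A_nonneg by (intro mult_left_mono powr_add_le) auto
    finally show ?thesis by (simp add: mult_ac)
  qed
  have iu: "integrable lborel (\<lambda>x. F (u x))" by (rule integrable_F[OF u M])
  have ifv: "integrable lborel (\<lambda>x. f (u x) * v x)" by (rule integrable_f_mult[OF u M v])
  have it: "integrable lborel (\<lambda>x. F (u x + t * v x))" if t: "\<bar>t\<bar> \<le> 1" for t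
  proof -
    have "integrable lborel (\<lambda>x. F (u x + t * v x) - F (u x) - t * (f (u x) * v x))"
    proof (rule Bochner_Integration.integrable_bound)
      show "integrable lborel (\<lambda>x. t\<^sup>2 * R x)" using iR by simp
      show "AE x in lborel. norm (F (u x + t * v x) - F (u x) - t * (f (u x) * v x)) \<le> norm (t\<^sup>2 * R x)"
        using rem[OF t] by (auto intro!: AE_I2 order_trans[OF rem[OF t]])
    qed measurable
    from Bochner_Integration.integrable_add[OF this Bochner_Integration.integrable_add[OF iu integrable_mult_right[OF ifv, of t]]]
    show ?thesis by simp
  qed
  have key: "\<bar>k t - k 0 - t * d\<bar> \<le> t\<^sup>2 * integral\<^sup>L lborel R" if t: "\<bar>t\<bar> \<le> 1" for t
  proof -
    have e: "k t - k 0 - t * d = (LINT x|lborel. F (u x + t * v x) - F (u x) - t * (f (u x) * v x))"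
      using it[OF t] iu ifv by (simp add: k_def d_def)
    have "\<bar>k t - k 0 - t * d\<bar> \<le> (LINT x|lborel. \<bar>F (u x + t * v x) - F (u x) - t * (f (u x) * v x)\<bar>)"
      unfolding e using integral_norm_bound[of lborel "\<lambda>x. F (u x + t * v x) - F (u x) - t * (f (u x) * v x)"] by simp
    also have "\<dots> \<le> (LINT x|lborel. t\<^sup>2 * R x)"
    proof (rule integral_mono)
      show "integrable lborel (\<lambda>x. \<bar>F (u x + t * v x) - F (u x) - t * (f (u x) * v x)\<bar>)"
        by (rule integrable_abs, rule Bochner_Integration.integrable_diff[OF
              Bochner_Integration.integrable_diff[OF it[OF t] iu] integrable_mult_right]) (rule ifv)
      show "integrable lborel (\<lambda>x. t\<^sup>2 * R x)" using iR by (rule integrable_mult_right)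
      show "\<bar>F (u x + t * v x) - F (u x) - t * (f (u x) * v x)\<bar> \<le> t\<^sup>2 * R x" for x by (rule rem[OF t])
    qed
    finally show ?thesis by simp
  qed
  have "(k has_real_derivative d) (at 0)"
    unfolding DERIV_def
  proof (rule LIM_zero_cancel, rule Lim_null_comparison)
    have "((\<lambda>t. \<bar>t\<bar> * integral\<^sup>L lborel R) \<longlongrightarrow> \<bar>0\<bar> * integral\<^sup>L lborel R) (at (0::real))"
      by (intro tendsto_intros)
    then show "((\<lambda>t. \<bar>t\<bar> * integral\<^sup>L lborel R) \<longlongrightarrow> 0) (at (0::real))" by simp
    show "\<forall>\<^sub>F t in at 0. norm ((k (0 + t) - k 0) / t - d) \<le> \<bar>t\<bar> * integral\<^sup>L lborel R"
      unfolding eventually_at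
    proof (intro exI[of _ 1] conjI ballI impI)
      fix t :: real assume "t \<noteq> 0 \<and> dist t 0 < 1"
      then have t: "t \<noteq> 0" "\<bar>t\<bar> \<le> 1" by auto
      have "(k (0 + t) - k 0) / t - d = (k t - k 0 - t * d) / t" using t by (simp add: field_simps)
      also have "\<bar>\<dots>\<bar> \<le> t\<^sup>2 * integral\<^sup>L lborel R / \<bar>t\<bar>"
        unfolding abs_divide by (intro divide_right_mono key t) simp
      also have "\<dots> = \<bar>t\<bar> * integral\<^sup>L lborel R" using t by (simp add: power2_eq_square field_simps abs_mult_self_eq)
      finally show "norm ((k (0 + t) - k 0) / t - d) \<le> \<bar>t\<bar> * integral\<^sup>L lborel R" by simp
    qed simp
  qed
  from DERIV_cmult[OF this, of "- (p + 1)"] show ?thesis by (simp add: K_fun_def k_def[abs_def] d_def)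
qed

end

section \<open>The constrained minimisation problem\<close>

lemma sqint_gauss_scaled: assumes "k > 0" shows "sqint (gauss k)"
proof (rule sqintI)
  have i: "integrable lborel (gauss k)" by (rule integrable_gauss[OF assms])
  then show m: "gauss k \<in> borel_measurable lborel" by auto
  show "integrable lborel (\<lambda>x. (cmod (gauss k x))\<^sup>2)"
  proof (rule Bochner_Integration.integrable_bound[OF i])
    show "AE x in lborel. norm ((cmod (gauss k x))\<^sup>2) \<le> norm (gauss k x)"
      using gauss_sq_le_1 by (auto intro!: AE_I2 simp: power2_eq_square mult_left_le_one_le)
  qed (use m in measurable)
qed

lemma sqint_hw_ft_gauss: "sqint (\<lambda>\<xi>. hw \<xi> * ft (gauss 1) \<xi>)"
proof (rule sqint_mono[OF sqint_gauss_scaled[of 2]])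
  define C where "C = 2 * pi * (1 / sqrt (2 * pi))"
  have C: "C > 0" by (simp add: C_def)
  have "cmod (hw \<xi> * ft (gauss 1) \<xi>) \<le> C * exp 1 * cmod (gauss 2 \<xi>)" for \<xi>
  proof -
    have "(cmod (hw \<xi>))\<^sup>2 \<le> 1 + \<bar>\<xi>\<bar>" by (rule hw_sq_le)
    also have "\<dots> \<le> exp \<bar>\<xi>\<bar>" by (rule exp_ge_add_one_self)
    also have "\<dots> = (exp (\<bar>\<xi>\<bar> / 2))\<^sup>2" by (simp add: power2_eq_square flip: exp_add)
    finally have h: "cmod (hw \<xi>) \<le> exp (\<bar>\<xi>\<bar> / 2)" by (rule power2_le_imp_le) simp
    have E: "cmod (ft (gauss 1) \<xi>) = C * exp (- \<xi>\<^sup>2 / 2)"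
    proof -
      have "ft (gauss 1) \<xi> = of_real (C * exp (- \<xi>\<^sup>2 / 2))"
        using ft_gauss[of 1 \<xi>] by (simp add: std_normal_density_def C_def)
      then show ?thesis using C by (simp only: norm_of_real) simp
    qed
    have "cmod (hw \<xi> * ft (gauss 1) \<xi>) \<le> exp (\<bar>\<xi>\<bar> / 2) * (C * exp (- \<xi>\<^sup>2 / 2))"
      unfolding norm_mult E using h C by (intro mult_right_mono) auto
    also have "\<dots> = C * exp (\<bar>\<xi>\<bar> / 2 + - \<xi>\<^sup>2 / 2)" by (simp only: exp_add mult_ac)
    also have "\<dots> \<le> C * exp (1 + - \<xi>\<^sup>2 / 8)"
    proof -
      have "0 \<le> (\<bar>\<xi>\<bar> - 1)\<^sup>2" by simp
      then have "2 * \<bar>\<xi>\<bar> - 1 \<le> \<xi>\<^sup>2" by (simp add: power2_diff)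
      moreover have "0 \<le> \<bar>\<xi>\<bar>" by simp
      ultimately have "\<bar>\<xi>\<bar> / 2 + - \<xi>\<^sup>2 / 2 \<le> 1 + - \<xi>\<^sup>2 / 8" by linarith
      then show ?thesis using C by simp
    qed
    also have "\<dots> = C * exp 1 * cmod (gauss 2 \<xi>)" unfolding exp_add by (simp add: gauss_def power_divide)
    finally show ?thesis .
  qed
  then show "AE \<xi> in lborel. cmod (hw \<xi> * ft (gauss 1) \<xi>) \<le> C * exp 1 * cmod (gauss 2 \<xi>)" by simp
  show "(\<lambda>\<xi>. hw \<xi> * ft (gauss 1) \<xi>) \<in> borel_measurable lborel"
    using sqintD[OF sqint_gauss_scaled[of 1]] by measurable
qed simp

lemma HB_nonvanishing:
  fixes q :: real
  assumes M: "M > 0" and q: "q > 2" and \<eta>: "\<eta> > 0"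
  shows "\<exists>N>0. \<exists>s>0. \<forall>u g. HB M u g \<and> (\<forall>x. cmod (lowpass N g x) \<le> s) \<longrightarrow> (LINT x|lborel. \<bar>u x\<bar> powr q) < \<eta>"
proof -
  define C where "C = \<bar>Lr_const (q + 1) M\<bar> + 1"
  define L where "L = 4 * C / \<eta>"
  define N where "N = 16 * (L powr (q - 2) + 1) * M\<^sup>2 / \<eta>"
  define s where "s = (\<eta> / (4 * M\<^sup>2)) powr (1 / (q - 2)) / 2"
  have C: "C > 0" by (simp add: C_def)
  have L: "L > 0" using C \<eta> by (simp add: L_def)
  have N: "N > 0" unfolding N_def using M \<eta> by (intro divide_pos_pos mult_pos_pos add_nonneg_pos) auto
  have s: "s > 0" using M \<eta> by (simp add: s_def)
  have s2: "(2 * s) powr (q - 2) = \<eta> / (4 * M\<^sup>2)"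
    using M \<eta> q by (simp add: s_def powr_powr)
  have N2: "4 * L powr (q - 2) * (M\<^sup>2 / N) \<le> \<eta> / 4"
  proof -
    have "16 * L powr (q - 2) * M\<^sup>2 \<le> 16 * (L powr (q - 2) + 1) * M\<^sup>2" by (intro mult_right_mono) auto
    also have "\<dots> = N * \<eta>" using \<eta> by (simp add: N_def)
    finally show ?thesis using N \<eta> by (simp add: field_simps)
  qed
  have "(LINT x|lborel. \<bar>u x\<bar> powr q) < \<eta>"
    if HB: "HB M u g" and le: "\<And>x. cmod (lowpass N g x) \<le> s" for u g
  proof -
    have FT: "is_FT u g" using HB by (simp add: HB_def)
    have su: "sqint (\<lambda>x. complex_of_real (u x))" by (rule is_FT_sqint[OF FT])
    have sP: "sqint (lowpass N g)" using FT_sqint(1)[OF FT_lowpass[OF is_FT_sqint(2)[OF FT]]] .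
    define d where "d x = (cmod (of_real (u x) - lowpass N g x))\<^sup>2" for x
    have di: "integrable lborel d" unfolding d_def by (rule sqint_integrable[OF sqint_diff[OF su sP]])
    have dle: "integral\<^sup>L lborel d \<le> M\<^sup>2 / N" using nrm_lowpass_diff[OF HB N] unfolding nrm_sq d_def[symmetric] by simp
    have ui: "integrable lborel (\<lambda>x. (u x)\<^sup>2)" using sqint_integrable[OF su] by simp
    have ule: "(LINT x|lborel. (u x)\<^sup>2) \<le> M\<^sup>2"
    proof -
      have "(nrm (\<lambda>x. complex_of_real (u x)))\<^sup>2 \<le> M\<^sup>2" by (intro power_mono HB_nrm(2)[OF HB]) simp
      then show ?thesis by (simp add: nrm_sq)
    qed
    have iq: "integrable lborel (\<lambda>x. \<bar>u x\<bar> powr q)" "integrable lborel (\<lambda>x. \<bar>u x\<bar> powr (q + 1))"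
      "(LINT x|lborel. \<bar>u x\<bar> powr (q + 1)) \<le> C"
      using Lr_bound[OF HB M, of q] Lr_bound[OF HB M, of "q + 1"] q by (auto simp: C_def)
    have "(LINT x|lborel. \<bar>u x\<bar> powr q) \<le> (LINT x|lborel. 1 / L * \<bar>u x\<bar> powr (q + 1) + (2 * s) powr (q - 2) * (u x)\<^sup>2 + 4 * L powr (q - 2) * d x)"
    proof (rule integral_mono)
      show "integrable lborel (\<lambda>x. 1 / L * \<bar>u x\<bar> powr (q + 1) + (2 * s) powr (q - 2) * (u x)\<^sup>2 + 4 * L powr (q - 2) * d x)"
        by (intro Bochner_Integration.integrable_add integrable_mult_right iq ui di)
      fix x
      define U where "U = \<bar>u x\<bar>"
      have U: "U \<ge> 0" by (simp add: U_def)
      have nn: "0 \<le> 1 / L * U powr (q + 1)" "0 \<le> (2 * s) powr (q - 2) * U\<^sup>2" "0 \<le> 4 * L powr (q - 2) * d x"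
        using L by (auto simp: d_def)
      have Uq: "U powr q = U powr (q - 2) * U\<^sup>2"
      proof (cases "U = 0")
        case False
        then show ?thesis using U by (simp add: powr_diff powr_numeral)
      qed simp
      consider "U > L" | "U \<le> 2 * s" | "U \<le> L" "U > 2 * s" by linarith
      then have "U powr q \<le> 1 / L * U powr (q + 1) + (2 * s) powr (q - 2) * U\<^sup>2 + 4 * L powr (q - 2) * d x"
      proof cases
        case 1
        have "L * U powr q \<le> U * U powr q" using 1 by (intro mult_right_mono) auto
        also have "\<dots> = U powr (q + 1)" using 1 L by (simp add: powr_add)
        finally have "U powr q \<le> 1 / L * U powr (q + 1)" using L by (simp add: field_simps)
        then show ?thesis using nn by linarith
      next
        case 2
        have "U powr q \<le> (2 * s) powr (q - 2) * U\<^sup>2"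
          unfolding Uq using 2 q U by (intro mult_right_mono powr_mono2) auto
        then show ?thesis using nn by linarith
      next
        case 3
        have "U \<le> cmod (of_real (u x) - lowpass N g x) + cmod (lowpass N g x)"
          using norm_triangle_ineq[of "of_real (u x) - lowpass N g x" "lowpass N g x"] by (simp add: U_def)
        then have "U / 2 \<le> cmod (of_real (u x) - lowpass N g x)" using le[of x] 3 by linarith
        then have "(U / 2)\<^sup>2 \<le> d x" unfolding d_def using U by (intro power_mono) auto
        then have U2: "U\<^sup>2 \<le> 4 * d x" by (simp add: power_divide)
        have "U powr q \<le> L powr (q - 2) * (4 * d x)"
          unfolding Uq using 3 q U U2 by (intro mult_mono powr_mono2) auto
        then show ?thesis using nn by linarith
      qed
      then show "\<bar>u x\<bar> powr q \<le> 1 / L * \<bar>u x\<bar> powr (q + 1) + (2 * s) powr (q - 2) * (u x)\<^sup>2 + 4 * L powr (q - 2) * d x"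
        by (simp add: U_def)
    qed (rule iq)
    also have "\<dots> = 1 / L * (LINT x|lborel. \<bar>u x\<bar> powr (q + 1)) + (2 * s) powr (q - 2) * (LINT x|lborel. (u x)\<^sup>2)
        + 4 * L powr (q - 2) * integral\<^sup>L lborel d"
      using iq ui di by simp
    also have "\<dots> \<le> 1 / L * C + (2 * s) powr (q - 2) * M\<^sup>2 + 4 * L powr (q - 2) * (M\<^sup>2 / N)"
      using L iq ule dle by (intro add_mono mult_left_mono) auto
    also have "\<dots> \<le> \<eta> / 4 + \<eta> / 4 + \<eta> / 4"
    proof (intro add_mono N2)
      show "1 / L * C \<le> \<eta> / 4" using C \<eta> by (simp add: L_def)
      show "(2 * s) powr (q - 2) * M\<^sup>2 \<le> \<eta> / 4" unfolding s2 using M by simp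
    qed
    also have "\<dots> < \<eta>" using \<eta> by simp
    finally show ?thesis .
  qed
  then show ?thesis using N s by blast
qed

locale ground_state_problem = dispersion \<beta> c \<gamma> + homogeneous_nonlinearity p f F f'
  for \<beta> c \<gamma> p :: real and f F f' :: "real \<Rightarrow> real" +
  fixes s0 :: real
  assumes Fneg: "F s0 < 0"
begin

abbreviation I :: "(real \<Rightarrow> real) \<Rightarrow> real" where "I \<equiv> I_fun \<beta> c \<gamma>"
abbreviation K :: "(real \<Rightarrow> real) \<Rightarrow> real" where "K \<equiv> K_fun p F"

lemma K_gauss_pos: "HB M (\<lambda>x. s0 * exp (- x\<^sup>2 / 2)) g \<Longrightarrow> M > 0 \<Longrightarrow> K (\<lambda>x. s0 * exp (- x\<^sup>2 / 2)) > 0"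
proof -
  let ?w = "\<lambda>x. s0 * exp (- x\<^sup>2 / 2)"
  assume "HB M ?w g" "M > 0"
  then have i: "integrable lborel (\<lambda>x. - F (?w x))" using integrable_F by simp
  have pos: "- F (?w x) > 0" for x
    using F_homog[of "exp (- x\<^sup>2 / 2)" s0] Fneg by (simp add: mult.commute mult_neg_pos)
  have "(LINT x|lborel. - F (?w x)) \<noteq> 0"
  proof
    assume "(LINT x|lborel. - F (?w x)) = 0"
    then have "AE x in lborel. - F (?w x) = 0"
      using integral_nonneg_eq_0_iff_AE[OF i] pos by (auto intro: less_imp_le)
    moreover have "- F (?w x) \<noteq> 0" for x using pos[of x] by linarith
    ultimately have "AE x in (lborel :: real measure). False" by simp
    then show False by (simp add: eventually_False ae_filter_eq_bot_iff)
  qed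
  moreover have "(LINT x|lborel. - F (?w x)) \<ge> 0" by (rule Bochner_Integration.integral_nonneg) (rule less_imp_le[OF pos])
  ultimately have "0 < (LINT x|lborel. - F (?w x))" by simp
  then have "0 < (p + 1) * (LINT x|lborel. - F (?w x))" by (rule mult_pos_pos[rotated]) (use p in simp)
  also have "\<dots> = K ?w"
    by (simp only: K_fun_def Bochner_Integration.integral_minus mult_minus_left mult_minus_right)
  finally show ?thesis .
qed

text \<open>A Gaussian has positive \<open>K\<close> but nonzero mean; deleting a small band of low frequencies puts it
  into the energy space.\<close>

lemma exists_K_pos: "\<exists>u g. XF u g \<and> K u > 0"
proof -
  define w where "w x = s0 * exp (- x\<^sup>2 / 2)" for x :: real
  define G where "G \<xi> = of_real s0 * ft (gauss 1) \<xi>" for \<xi>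
  define d where "d n = 1 / real (Suc n)" for n
  have d: "d n > 0" for n by (simp add: d_def)
  define Gn where "Gn n \<xi> = G \<xi> - trunc (d n) G \<xi>" for n \<xi>
  have "FT (\<lambda>x. of_real s0 * gauss 1 x) G"
    unfolding G_def by (intro FT_cmult FT_ft sqint_gauss_scaled integrable_gauss) auto
  moreover have "(\<lambda>x. of_real s0 * gauss 1 x) = (\<lambda>x. complex_of_real (w x))"
    by (auto simp: gauss_def w_def)
  ultimately have FTw: "is_FT w G" by (simp add: is_FT_iff)
  note sG = is_FT_sqint(2)[OF FTw]
  have [measurable]: "G \<in> borel_measurable borel" "trunc (d n) G \<in> borel_measurable borel" for n
    using sqintD[OF sG] sqintD[OF sqint_trunc[OF sG]] by auto
  have [measurable]: "Gn n \<in> borel_measurable borel" for n unfolding Gn_def by measurable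
  have "sqint (\<lambda>\<xi>. of_real s0 * (hw \<xi> * ft (gauss 1) \<xi>))" by (intro sqint_cmult sqint_hw_ft_gauss)
  then have sh: "sqint (\<lambda>\<xi>. hw \<xi> * G \<xi>)" by (simp add: G_def mult.left_commute)
  define M where "M = nrm (\<lambda>\<xi>. hw \<xi> * G \<xi>) + 1"
  have M: "M > 0" unfolding M_def by (intro add_nonneg_pos) auto
  have HBw: "HB M w G" using FTw sh by (simp add: HB_def M_def)
  have Gn_le: "cmod (Gn n \<xi>) \<le> cmod (G \<xi>)" for n \<xi> by (simp add: Gn_def trunc_def indicator_def)
  have sGn: "sqint (Gn n)" for n unfolding Gn_def by (intro sqint_diff sG sqint_trunc)
  have "G (- \<xi>) = cnj (G \<xi>)" for \<xi>
    using ft_gauss[of 1 \<xi>] ft_gauss[of 1 "- \<xi>"] by (simp add: G_def std_normal_density_def)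
  then have "Gn n (- \<xi>) = cnj (Gn n \<xi>)" for n \<xi> by (auto simp: Gn_def trunc_def indicator_def)
  then have "\<forall>n. \<exists>u. FT (\<lambda>x. of_real (u x)) (Gn n)" using FT_hermitian_real[OF sGn] by simp
  then obtain u where u: "\<And>n. FT (\<lambda>x. of_real (u n x)) (Gn n)" by metis
  have FTu: "is_FT (u n) (Gn n)" for n using u by (simp add: is_FT_iff)
  have hn_le: "cmod (hw \<xi> * Gn n \<xi>) \<le> cmod (hw \<xi> * G \<xi>)" for n \<xi>
    using Gn_le by (simp add: norm_mult mult_left_mono)
  have shn: "sqint (\<lambda>\<xi>. hw \<xi> * Gn n \<xi>)" for n
    by (rule sqint_mono[OF sh, where C=1]) (use hn_le in auto)
  have nle: "nrm (\<lambda>\<xi>. hw \<xi> * Gn n \<xi>) \<le> nrm (\<lambda>\<xi>. hw \<xi> * G \<xi>)" for n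
    by (rule nrm_mono[OF sh]) (use hn_le in auto)
  have HBu: "HB M (u n) (Gn n)" for n
    unfolding HB_def using FTu[of n] shn[of n] nle[of n] by (simp add: M_def)
  have "sqint (\<lambda>\<xi>. sym_dinv \<xi> * Gn n \<xi>)" for n
  proof (rule sqint_mono[OF sG, where C="1 / d n"])
    have "cmod (sym_dinv \<xi> * Gn n \<xi>) \<le> 1 / d n * cmod (G \<xi>)" for \<xi>
    proof (cases "\<xi> \<in> {- d n..d n}")
      case True
      then show ?thesis using d[of n] by (simp add: Gn_def trunc_def)
    next
      case False
      then have "d n \<le> \<bar>\<xi>\<bar>" by auto
      then have "1 / \<bar>\<xi>\<bar> \<le> 1 / d n" using d[of n] by (intro divide_left_mono) auto
      then have "cmod (sym_dinv \<xi>) \<le> 1 / d n" by (simp add: sym_dinv_def norm_divide norm_mult)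
      then show ?thesis unfolding norm_mult using Gn_le d[of n] by (intro mult_mono) auto
    qed
    then show "AE \<xi> in lborel. cmod (sym_dinv \<xi> * Gn n \<xi>) \<le> 1 / d n * cmod (G \<xi>)" by simp
  qed measurable
  then have X: "XF (u n) (Gn n)" for n
    using FTu shn sqint_hw_iff[OF sGn] by (simp add: XF_def)
  have t0: "(\<lambda>n. nrm (trunc (d n) G)) \<longlonglongrightarrow> 0"
  proof (rule tendsto_nrm_dominated[OF _ sG])
    show "AE \<xi> in lborel. cmod (trunc (d n) G \<xi>) \<le> cmod (G \<xi>)" for n by (simp add: trunc_def indicator_def)
    show "AE \<xi> in lborel. (\<lambda>n. trunc (d n) G \<xi>) \<longlonglongrightarrow> 0"
      using AE_nonzero
    proof eventually_elim
      fix \<xi> :: real assume x: "\<xi> \<noteq> 0"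
      have "d \<longlonglongrightarrow> 0" unfolding d_def by (rule LIMSEQ_Suc[OF lim_const_over_n])
      then have "\<forall>\<^sub>F n in sequentially. d n < \<bar>\<xi>\<bar>" using x by (intro order_tendstoD) auto
      then have "\<forall>\<^sub>F n in sequentially. trunc (d n) G \<xi> = 0"
        by eventually_elim (auto simp: trunc_def indicator_def)
      then show "(\<lambda>n. trunc (d n) G \<xi>) \<longlonglongrightarrow> 0" by (rule tendsto_eventually)
    qed
  qed measurable
  have "(\<lambda>n. nrm (\<lambda>x. complex_of_real (u n x - w x))) \<longlonglongrightarrow> 0"
  proof (rule Lim_null_comparison[OF always_eventually t0], rule allI)
    fix n
    have "FT (\<lambda>x. complex_of_real (u n x) - complex_of_real (w x)) (\<lambda>\<xi>. Gn n \<xi> - G \<xi>)"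
      by (rule FT_diff[OF u is_FT_FT[OF FTw]])
    from FT_isometry[OF this]
    have "sqrt (2 * pi) * nrm (\<lambda>x. complex_of_real (u n x) - complex_of_real (w x)) = nrm (trunc (d n) G)"
      by (simp add: Gn_def nrm_def[of "\<lambda>\<xi>. - trunc (d n) G \<xi>"] nrm_def[of "trunc (d n) G"])
    then show "norm (nrm (\<lambda>x. complex_of_real (u n x - w x))) \<le> nrm (trunc (d n) G)"
      using mult_right_mono[OF sqrt_2pi_ge_1 nrm_nonneg[of "\<lambda>x. complex_of_real (u n x) - complex_of_real (w x)"]] by simp
  qed
  then have "(\<lambda>n. K (u n)) \<longlonglongrightarrow> K w" by (rule K_fun_tendsto[OF HBu HBw M])
  moreover have "K w > 0" using K_gauss_pos HBw M unfolding w_def by blast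
  ultimately have "\<forall>\<^sub>F n in sequentially. K (u n) > 0" by (rule order_tendstoD)
  then obtain n where "K (u n) > 0" using eventually_happens'[OF sequentially_bot] by blast
  then show ?thesis using X by blast
qed

definition m :: real where
  "m = Inf {I u | u g. XF u g \<and> K u = 1}"

definition \<theta> :: real where
  "\<theta> = 2 / (p + 1)"

lemma \<theta>: "0 < \<theta>" "\<theta> < 1"
  using p by (auto simp: \<theta>_def)

lemma normalise_K:
  assumes "XF u g" "K u > 0"
  defines "t \<equiv> K u powr (- 1 / (p + 1))"
  shows "t > 0" "K (\<lambda>x. t * u x) = 1" "t\<^sup>2 = K u powr (- \<theta>)"
proof -
  show t: "t > 0" using assms by simp
  have "t powr (p + 1) = K u powr (- 1)" unfolding t_def powr_powr using p by simp
  then show "K (\<lambda>x. t * u x) = 1" using assms(2) K_fun_scale[OF t, of u] by (simp add: powr_minus)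
  have "t\<^sup>2 = t powr 2" using t by (simp add: powr_numeral)
  then show "t\<^sup>2 = K u powr (- \<theta>)" unfolding t_def powr_powr by (simp add: \<theta>_def)
qed

lemma m_set: "{I u | u g. XF u g \<and> K u = 1} \<noteq> {}" "bdd_below {I u | u g. XF u g \<and> K u = 1}"
proof -
  obtain u g where u: "XF u g" "K u > 0" using exists_K_pos by blast
  then show "{I u | u g. XF u g \<and> K u = 1} \<noteq> {}"
    using XF_cmult[OF u(1)] normalise_K(2)[OF u] by blast
  show "bdd_below {I u | u g. XF u g \<and> K u = 1}"
    by (rule bdd_belowI[of _ 0]) (auto intro: I_fun_nonneg)
qed

lemma m_le: "XF u g \<Longrightarrow> K u = 1 \<Longrightarrow> m \<le> I u"
  unfolding m_def by (rule cInf_lower[OF _ m_set(2)]) blast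

lemma m_le_I: assumes "XF u g" shows "m * (max 0 (K u)) powr \<theta> \<le> I u"
proof (cases "K u > 0")
  case True
  define t where "t = K u powr (- 1 / (p + 1))"
  note n = normalise_K[OF assms True, folded t_def]
  have "m \<le> t\<^sup>2 * I u" using m_le[OF XF_cmult[OF assms] n(2)] I_fun_cmult[OF assms] by simp
  also have "\<dots> = I u / K u powr \<theta>" unfolding n(3) by (simp add: powr_minus divide_inverse)
  finally show ?thesis using True by (simp add: field_simps max_def)
next
  case False
  then show ?thesis using I_fun_nonneg[OF assms] by (simp add: max_def)
qed

lemma m_pos: "m > 0"
proof -
  define M where "M = sqrt (2 * pi * 1 / \<delta>)"
  have M: "M > 0" using \<delta>(1) by (simp add: M_def)
  define C where "C = \<bar>(p + 1) * A * Lr_const (p + 1) M\<bar>"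
  have KC: "K v \<le> C" if v: "XF v g" "I v \<le> 1" for v g
  proof -
    have HB: "HB M v g" unfolding M_def by (rule XF_HB_I[OF v])
    have "K v \<le> (p + 1) * A * (LINT x|lborel. \<bar>v x\<bar> powr (p + 1))" using K_fun_bound[OF HB M] by linarith
    also have "\<dots> \<le> (p + 1) * A * Lr_const (p + 1) M"
      using p A_nonneg by (intro mult_left_mono Lr_bound(2)[OF HB M]) auto
    finally show ?thesis by (simp add: C_def)
  qed
  define t where "t = (C + 1) powr (1 / (p + 1))"
  have t: "t > 0" "t powr (p + 1) = C + 1" using p by (auto simp: t_def powr_powr C_def)
  have "1 / t\<^sup>2 \<le> I u" if u: "XF u g" "K u = 1" for u g
  proof (rule ccontr)
    assume "\<not> 1 / t\<^sup>2 \<le> I u"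
    then have "t\<^sup>2 * I u \<le> 1" using t by (simp add: field_simps)
    then have "I (\<lambda>x. t * u x) \<le> 1" using I_fun_cmult[OF u(1)] by simp
    from KC[OF XF_cmult[OF u(1)] this] show False using K_fun_scale[OF t(1), of u] t u by simp
  qed
  then have "1 / t\<^sup>2 \<le> m" unfolding m_def by (intro cInf_greatest m_set) blast
  moreover have "1 / t\<^sup>2 > 0" using t by simp
  ultimately show ?thesis by linarith
qed

end

context ground_state_problem
begin

lemma exists_minimising_sequence:
  "\<exists>u g. \<forall>n::nat. XF (u n) (g n) \<and> K (u n) = 1 \<and> I (u n) \<le> m + 1 / real (Suc n)"
proof -
  have "\<exists>u g. XF u g \<and> K u = 1 \<and> I u \<le> m + 1 / real (Suc n)" for n
  proof -
    have "Inf {I u | u g. XF u g \<and> K u = 1} < m + 1 / real (Suc n)" unfolding m_def[symmetric] by simp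
    from cInf_lessD[OF m_set(1) this] show ?thesis by (auto intro: less_imp_le)
  qed
  then show ?thesis by metis
qed

text \<open>Translating a minimising sequence so that a fixed low-frequency part stays away from zero at
  the origin prevents the weak limit from vanishing.\<close>

lemma exists_nonvanishing_minimising_sequence:
  "\<exists>v g N s. (\<forall>n::nat. XF (v n) (g n) \<and> K (v n) = 1 \<and> I (v n) \<le> m + 1 / real (Suc n) \<and> s < cmod (lowpass N (g n) 0)) \<and> s > 0"
proof -
  obtain u g where u: "\<And>n::nat. XF (u n) (g n)" "\<And>n. K (u n) = 1" "\<And>n. I (u n) \<le> m + 1 / real (Suc n)"
    using exists_minimising_sequence by blast
  define M where "M = sqrt (2 * pi * (m + 1) / \<delta>)"
  have M: "M > 0" using \<delta>(1) m_pos by (simp add: M_def)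
  have "I (u n) \<le> m + 1" for n
  proof -
    have "1 / real (Suc n) \<le> 1" by simp
    then show ?thesis using u(3)[of n] by linarith
  qed
  then have HB: "HB M (u n) (g n)" for n unfolding M_def using XF_HB_I[OF u(1)] by blast
  define B where "B = (p + 1) * A"
  have B: "B \<ge> 0" using p A_nonneg by (simp add: B_def)
  have q: "p + 1 > 2" "1 / (B + 1) > 0" using p B by auto
  obtain N s where N: "s > 0" "\<forall>u g. HB M u g \<and> (\<forall>x. cmod (lowpass N g x) \<le> s)
      \<longrightarrow> (LINT x|lborel. \<bar>u x\<bar> powr (p + 1)) < 1 / (B + 1)"
    using HB_nonvanishing[OF M q] by blast
  have "\<exists>x. s < cmod (lowpass N (g n) x)" for n
  proof (rule ccontr)
    assume "\<not> (\<exists>x. s < cmod (lowpass N (g n) x))"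
    then have "(LINT x|lborel. \<bar>u n x\<bar> powr (p + 1)) < 1 / (B + 1)"
      using N(2) HB[of n] by (meson not_less)
    then have "B * (LINT x|lborel. \<bar>u n x\<bar> powr (p + 1)) \<le> B * (1 / (B + 1))"
      using B by (intro mult_left_mono) auto
    also have "\<dots> < 1" using B by (simp add: field_simps)
    finally show False using K_fun_bound[OF HB M, of n] u(2)[of n] by (simp add: B_def)
  qed
  then obtain x where x: "\<And>n. s < cmod (lowpass N (g n) (x n))" by metis
  define v where "v n = (\<lambda>y. u n (y + x n))" for n
  define h where "h n = (\<lambda>\<xi>. cis (x n * \<xi>) * g n \<xi>)" for n
  have "XF (v n) (h n) \<and> K (v n) = 1 \<and> I (v n) \<le> m + 1 / real (Suc n) \<and> s < cmod (lowpass N (h n) 0)" for n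
    unfolding v_def h_def lowpass_shift using XF_shift[OF u(1)] K_fun_shift u(2,3) x by simp
  then show ?thesis using N(1) by blast
qed

lemma powr_sum_gt_1:
  assumes "0 < k" "k < 1" shows "1 < k powr \<theta> + (1 - k) powr \<theta>"
proof -
  have "x < x powr \<theta>" if "0 < x" "x < 1" for x :: real
    using powr_less_mono'[of x \<theta> 1] \<theta> that by simp
  from this[OF assms] this[of "1 - k"] assms show ?thesis by simp
qed

lemma exists_minimiser: "\<exists>\<phi> g. XF \<phi> g \<and> K \<phi> = 1 \<and> I \<phi> = m"
proof -
  obtain u g N s where u: "\<And>n::nat. XF (u n) (g n)" "\<And>n. K (u n) = 1" "\<And>n. I (u n) \<le> m + 1 / real (Suc n)"
      "\<And>n. s < cmod (lowpass N (g n) 0)" "s > 0"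
    using exists_nonvanishing_minimising_sequence by metis
  have Im1: "I (u n) \<le> m + 1" for n
  proof -
    have "1 / real (Suc n) \<le> 1" by simp
    then show ?thesis using u(3)[of n] by linarith
  qed
  have HB0: "HB (sqrt (2 * pi * (m + 1) / \<delta>)) (u n) (g n)" for n using XF_HB_I[OF u(1) Im1] .
  have I_lim: "(\<lambda>n. I (u n)) \<longlonglongrightarrow> m"
  proof (rule tendsto_sandwich)
    show "\<forall>\<^sub>F n in sequentially. m \<le> I (u n)" using m_le[OF u(1,2)] by simp
    show "\<forall>\<^sub>F n in sequentially. I (u n) \<le> m + 1 / real (Suc n)" using u(3) by simp
    have "(\<lambda>n. m + 1 / real (Suc n)) \<longlonglongrightarrow> m + 0"
      by (intro tendsto_add tendsto_const LIMSEQ_Suc[OF lim_const_over_n])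
    then show "(\<lambda>n. m + 1 / real (Suc n)) \<longlonglongrightarrow> m" by simp
  qed simp
  obtain r w where r: "strict_mono r" and conv: "wconv (\<lambda>n. u (r n)) w" using HB_compact[of "sqrt (2 * pi * (m + 1) / \<delta>)" u g, OF HB0] by blast
  define v where "v n = u (r n)" for n
  define gv where "gv n = g (r n)" for n
  have v: "XF (v n) (gv n)" "K (v n) = 1" for n unfolding v_def gv_def using u by auto
  have Iv: "(\<lambda>n. I (v n)) \<longlonglongrightarrow> m" using LIMSEQ_subseq_LIMSEQ[OF I_lim r] by (simp add: v_def comp_def)
  have cv: "wconv v w" using conv by (simp add: v_def[abs_def])
  have "sqint (\<lambda>x. complex_of_real (w x))" using cv by (simp add: wconv_def)
  then obtain G where G: "is_FT w G" unfolding is_FT_iff using FT_exists by blast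
  have FTv: "is_FT (v n) (gv n)" and sv: "sqint (\<lambda>\<xi>. wt \<xi> * gv n \<xi>)" for n using v(1)[of n] by (auto simp: XF_iff)
  have nv: "nrm (\<lambda>\<xi>. wt \<xi> * gv n \<xi>) \<le> sqrt (2 * pi * (m + 1))" for n
  proof (rule real_le_rsqrt)
    have "(nrm (\<lambda>\<xi>. wt \<xi> * gv n \<xi>))\<^sup>2 = 2 * pi * I (u (r n))" using I_fun_FT[OF v(1)[of n]] by (simp add: v_def)
    also have "\<dots> \<le> 2 * pi * (m + 1)" using Im1 by (intro mult_left_mono) auto
    finally show "(nrm (\<lambda>\<xi>. wt \<xi> * gv n \<xi>))\<^sup>2 \<le> 2 * pi * (m + 1)" .
  qed
  note weak = wconv_FT[OF cv FTv G]
  note wc = weak_closed[OF is_FT_sqint(2)[OF FTv] is_FT_sqint(2)[OF G] weak wt_measurable sv nv]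
  have Xw: "XF w G" using G wc(1) by (simp add: XF_iff)
  have wnz: "nonzero w"
  proof -
    have lp: "cmod (LINT \<xi>|lborel. h \<xi> * indicator {-N..N} \<xi>) = 2 * pi * cmod (lowpass N h 0)" for h
    proof -
      have "ft (trunc N (\<lambda>\<xi>. cnj (h \<xi>))) 0 = (LINT \<xi>|lborel. cnj (h \<xi> * indicator {-N..N} \<xi>))"
        unfolding ft_def by (intro Bochner_Integration.integral_cong) (auto simp: trunc_def indicator_def)
      also have "\<dots> = cnj (LINT \<xi>|lborel. h \<xi> * indicator {-N..N} \<xi>)" by (rule Bochner_Integration.integral_cnj)
      finally show ?thesis by (simp add: lowpass_def norm_divide norm_mult)
    qed
    have "(\<lambda>n. cmod (LINT \<xi>|lborel. gv n \<xi> * indicator {-N..N} \<xi>)) \<longlonglongrightarrow> cmod (LINT \<xi>|lborel. G \<xi> * indicator {-N..N} \<xi>)"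
      by (intro tendsto_norm weak sqint_interval)
    moreover have "2 * pi * s \<le> cmod (LINT \<xi>|lborel. gv n \<xi> * indicator {-N..N} \<xi>)" for n
      unfolding lp gv_def using u(4)[of "r n"] by simp
    ultimately have "2 * pi * s \<le> cmod (LINT \<xi>|lborel. G \<xi> * indicator {-N..N} \<xi>)"
      by (intro tendsto_lowerbound[OF _ _ sequentially_bot]) auto
    moreover have "0 < 2 * pi * s" using u(5) by simp
    ultimately have ne: "(LINT \<xi>|lborel. G \<xi> * indicator {-N..N} \<xi>) \<noteq> 0" by auto
    show ?thesis
      unfolding nonzero_def
    proof
      assume "AE x in lborel. w x = 0"
      then have "AE x in lborel. cmod (complex_of_real (w x)) = cmod 0" by simp
      then have "nrm (\<lambda>x. complex_of_real (w x)) = nrm (\<lambda>_. 0)"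
        by (rule nrm_cong_AE) (use is_FT_measurable(1)[OF G] in auto)
      then have "nrm G = 0" using FT_isometry[OF is_FT_FT[OF G]] by (simp add: nrm_def[of "\<lambda>_. 0"])
      then have "cmod (LINT \<xi>|lborel. G \<xi> * indicator {-N..N} \<xi>) \<le> 0"
        using integral_mult_bound[OF is_FT_sqint(2)[OF G] sqint_interval[of N]] by simp
      then show False using ne by simp
    qed
  qed
  define z where "z n = (\<lambda>x. v n x - w x)" for n
  have Xz: "XF (z n) (\<lambda>\<xi>. gv n \<xi> - G \<xi>)" for n unfolding z_def by (rule XF_diff[OF v(1) Xw])
  have Iz: "(\<lambda>n. I (z n)) \<longlonglongrightarrow> m - I w"
  proof -
    define X where "X n = Re (LINT \<xi>|lborel. wt \<xi> * gv n \<xi> * cnj (wt \<xi> * G \<xi>))" for n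
    have "X \<longlonglongrightarrow> Re (LINT \<xi>|lborel. wt \<xi> * G \<xi> * cnj (wt \<xi> * G \<xi>))"
      unfolding X_def by (intro tendsto_Re wc(2) sqint_cnj wc(1))
    moreover have "Re (LINT \<xi>|lborel. wt \<xi> * G \<xi> * cnj (wt \<xi> * G \<xi>)) = 2 * pi * I w"
      using nrm_sq_pairing[OF wc(1)] I_fun_FT[OF Xw] by (simp only:)
    ultimately have X: "X \<longlonglongrightarrow> 2 * pi * I w" by (simp only:)
    have h: "2 * pi * I (z n) = 2 * pi * I (v n) - 2 * X n + 2 * pi * I w" for n
      unfolding I_fun_FT[OF Xz] I_fun_FT[OF v(1)] I_fun_FT[OF Xw] X_def
      using nrm_diff_sq_expand[OF sv wc(1), of n] by (simp only: right_diff_distrib)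
    have eq: "I (z n) = I (v n) - X n / pi + I w" for n
    proof -
      have "pi * I (z n) = pi * I (v n) - X n + pi * I w" using h[of n] by linarith
      also have "\<dots> = pi * (I (v n) - X n / pi + I w)" by (simp add: algebra_simps)
      finally show ?thesis by simp
    qed
    have "(\<lambda>n. I (v n) - X n / pi + I w) \<longlonglongrightarrow> m - 2 * pi * I w / pi + I w" by (intro tendsto_intros Iv X) simp
    then show ?thesis unfolding eq by simp
  qed
  define k where "k = K w"
  have Kz: "(\<lambda>n. K (z n)) \<longlonglongrightarrow> 1 - k"
  proof -
    define M where "M = max (sqrt (2 * pi * (m + 1) / \<delta>)) (1 / sqrt \<delta> * nrm (\<lambda>\<xi>. wt \<xi> * G \<xi>))"
    have "sqrt (2 * pi * (m + 1) / \<delta>) > 0" using m_pos \<delta>(1) by simp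
    then have M: "M > 0" unfolding M_def by (rule less_le_trans[OF _ max.cobounded1])
    have "HB M (v n) (gv n)" for n unfolding v_def gv_def by (rule HB_mono[OF HB0]) (simp add: M_def)
    moreover have "HB M w G" by (rule HB_mono[OF XF_HB[OF Xw]]) (simp add: M_def)
    ultimately have "(\<lambda>n. K (v n) - K (\<lambda>x. v n x - w x)) \<longlonglongrightarrow> K w" using K_fun_split M cv by blast
    then have "(\<lambda>n. 1 - (1 - K (z n))) \<longlonglongrightarrow> 1 - k" unfolding v(2) z_def k_def by (intro tendsto_intros)
    then show ?thesis by simp
  qed
  have "(\<lambda>n. m * (max 0 (K (z n))) powr \<theta>) \<longlonglongrightarrow> m * (max 0 (1 - k)) powr \<theta>"
    by (intro tendsto_intros tendsto_powr' Kz) (use \<theta> in auto)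
  then have z_ge: "m * (max 0 (1 - k)) powr \<theta> \<le> m - I w"
    using Iz by (rule LIMSEQ_le) (use m_le_I[OF Xz] in auto)
  have w_ge: "m * (max 0 k) powr \<theta> \<le> I w" unfolding k_def by (rule m_le_I[OF Xw])
  have Iw: "I w > 0" by (rule I_fun_pos[OF Xw wnz])
  consider "k \<le> 0" | "0 < k" "k < 1" | "k \<ge> 1" by linarith
  then have "k = 1 \<and> I w = m"
  proof cases
    case 1
    then have "1 \<le> (max 0 (1 - k)) powr \<theta>" using \<theta> by (intro ge_one_powr_ge_zero) auto
    from mult_left_mono[OF this, of m] m_pos have "m \<le> m * (max 0 (1 - k)) powr \<theta>" by simp
    then show ?thesis using z_ge Iw by linarith
  next
    case 2
    then have "m * (k powr \<theta> + (1 - k) powr \<theta>) \<le> m" using z_ge w_ge by (simp add: max_def algebra_simps)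
    moreover have "m * 1 < m * (k powr \<theta> + (1 - k) powr \<theta>)"
      using powr_sum_gt_1[OF 2] m_pos by (intro mult_strict_left_mono) auto
    ultimately show ?thesis by simp
  next
    case 3
    then have "m * k powr \<theta> \<le> I w" "I w \<le> m" using w_ge z_ge \<theta> by (auto simp: max_def split: if_splits)
    moreover have "1 \<le> k powr \<theta>" using 3 \<theta> by (intro ge_one_powr_ge_zero) auto
    moreover have "m * 1 \<le> m * k powr \<theta>" using \<open>1 \<le> k powr \<theta>\<close> m_pos by (intro mult_left_mono) auto
    ultimately have "I w = m" "m * k powr \<theta> \<le> m * 1" by auto
    then have "k powr \<theta> \<le> 1" using m_pos by (simp only: mult_le_cancel_left_pos)
    moreover have "1 < k powr \<theta>" if "k > 1" using that \<theta> powr_less_mono2[of \<theta> 1 k] by simp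
    ultimately show ?thesis using 3 \<open>I w = m\<close> by (cases "k = 1") auto
  qed
  then show ?thesis using Xw by (auto simp: k_def)
qed

section \<open>The Euler-Lagrange equation and ground states\<close>

lemma solitary_iff:
  "solitary \<beta> c \<gamma> f \<phi> \<longleftrightarrow> in_X \<phi> \<and> (\<forall>\<psi>. in_X \<psi> \<longrightarrow> Bform \<phi> \<psi> + (LINT x|lborel. f (\<phi> x) * \<psi> x) = 0)"
proof -
  have "(a - b + s = - d) \<longleftrightarrow> (a - b + d + s = 0)" for a b d s :: real by auto
  then show ?thesis
    unfolding solitary_def Bform_def by (simp add: algebra_simps eq_neg_iff_add_eq_0)
qed

lemma Euler_Lagrange:
  assumes X: "XF \<phi> g" and Kpos: "K \<phi> > 0" and min: "I \<phi> = m * K \<phi> powr \<theta>" and IK: "I \<phi> = K \<phi>"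
    and Y: "XF \<psi> h"
  shows "Bform \<phi> \<psi> + (LINT x|lborel. f (\<phi> x) * \<psi> x) = 0"
proof -
  define D where "D = - (p + 1) * (LINT x|lborel. f (\<phi> x) * \<psi> x)"
  define k where "k t = K (\<lambda>x. \<phi> x + t * \<psi> x)" for t
  define M where "M = max 1 (max (1 / sqrt \<delta> * nrm (\<lambda>\<xi>. wt \<xi> * g \<xi>)) (1 / sqrt \<delta> * nrm (\<lambda>\<xi>. wt \<xi> * h \<xi>)))"
  have M: "M > 0" by (simp add: M_def)
  have HB: "HB M \<phi> g" "HB M \<psi> h"
    using HB_mono[OF XF_HB[OF X], of M] HB_mono[OF XF_HB[OF Y], of M] by (auto simp: M_def)
  have kD: "(k has_real_derivative D) (at 0)" unfolding k_def D_def by (rule K_fun_deriv[OF HB M])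
  have k0: "k 0 = K \<phi>" by (simp add: k_def)
  define J where "J t = (I \<phi> + 2 * t * Bform \<phi> \<psi> + t\<^sup>2 * I \<psi>) - m * k t powr \<theta>" for t
  have JD: "(J has_real_derivative (2 * Bform \<phi> \<psi> - m * (\<theta> * K \<phi> powr (\<theta> - 1) * D))) (at 0)"
    unfolding J_def using Kpos
    by (auto intro!: derivative_eq_intros kD simp: k0)
  have "isCont k 0" using kD by (rule DERIV_isCont)
  then have "\<forall>\<^sub>F t in at 0. k t > 0"
    using Kpos unfolding isCont_def k0 by (rule order_tendstoD)
  then obtain d where d: "d > 0" "\<And>t. t \<noteq> 0 \<Longrightarrow> \<bar>t\<bar> < d \<Longrightarrow> k t > 0"
    unfolding eventually_at by auto
  have "J 0 \<le> J t" if t: "\<bar>0 - t\<bar> < d" for t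
  proof -
    have "k t > 0" using d(2)[of t] t k0 Kpos by (cases "t = 0") auto
    have Xt: "XF (\<lambda>x. \<phi> x + t * \<psi> x) (\<lambda>\<xi>. of_real 1 * g \<xi> + of_real t * h \<xi>)"
      using XF_lincomb[OF X Y, of 1 t] by simp
    have "m * k t powr \<theta> \<le> I (\<lambda>x. \<phi> x + t * \<psi> x)"
      using m_le_I[OF Xt] \<open>k t > 0\<close> by (simp add: k_def max_def)
    then have "0 \<le> J t" unfolding J_def I_fun_expand[OF X Y] by simp
    moreover have "J 0 = 0" using min by (simp add: J_def k0)
    ultimately show ?thesis by simp
  qed
  then have "2 * Bform \<phi> \<psi> - m * (\<theta> * K \<phi> powr (\<theta> - 1) * D) = 0"
    using DERIV_local_min[OF JD d(1)] by blast
  moreover have "m * K \<phi> powr (\<theta> - 1) = 1"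
  proof -
    have "m * K \<phi> powr \<theta> / K \<phi> = 1" using min IK Kpos by simp
    then show ?thesis using Kpos by (simp add: powr_diff)
  qed
  then have "m * (\<theta> * K \<phi> powr (\<theta> - 1) * D) = \<theta> * D" by (simp add: mult.left_commute[of m] mult.commute[of m] mult.assoc)
  moreover have "\<theta> * D = - 2 * (LINT x|lborel. f (\<phi> x) * \<psi> x)" using p by (simp add: \<theta>_def D_def field_simps)
  ultimately show ?thesis by simp
qed

definition \<mu> :: real where
  "\<mu> = m powr ((p + 1) / (p - 1))"

lemma \<mu>_pos: "\<mu> > 0" using m_pos by (simp add: \<mu>_def)

lemma \<mu>_eq: "\<mu> = m * \<mu> powr \<theta>"
proof -
  have "a / b * (2 / a) = 2 / b" if "a \<noteq> 0" for a b :: real using that by simp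
  from this[of "p + 1" "p - 1"] have "(p + 1) / (p - 1) * \<theta> = 2 / (p - 1)" using p by (simp only: \<theta>_def)
  moreover have "1 + 2 / (p - 1) = (p + 1) / (p - 1)" using p by (simp add: field_simps)
  ultimately have "1 + (p + 1) / (p - 1) * \<theta> = (p + 1) / (p - 1)" by (simp only:)
  then have "m powr ((p + 1) / (p - 1)) = m powr (1 + (p + 1) / (p - 1) * \<theta>)" by simp
  also have "\<dots> = m * \<mu> powr \<theta>" unfolding \<mu>_def powr_powr using m_pos by (simp add: powr_add)
  finally show ?thesis by (simp add: \<mu>_def)
qed

lemma \<mu>_le:
  assumes "XF u g" "nonzero u" "I u = K u" shows "\<mu> \<le> I u"
proof -
  have pos: "I u > 0" by (rule I_fun_pos[OF assms(1,2)])
  have "m * I u powr \<theta> \<le> I u" using m_le_I[OF assms(1)] pos assms(3) by (simp add: max_def)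
  then have "m \<le> I u / I u powr \<theta>" using pos by (simp add: field_simps)
  also have "\<dots> = I u powr (1 - \<theta>)" using pos by (simp add: powr_diff)
  finally have "m powr ((p + 1) / (p - 1)) \<le> (I u powr (1 - \<theta>)) powr ((p + 1) / (p - 1))"
    using m_pos p by (intro powr_mono2) auto
  also have "\<dots> = I u"
  proof -
    have "1 - \<theta> = (p - 1) / (p + 1)" using p by (simp add: \<theta>_def field_simps)
    then have e: "(1 - \<theta>) * ((p + 1) / (p - 1)) = 1" using p by simp
    show ?thesis unfolding powr_powr e using pos by simp
  qed
  finally show ?thesis by (simp add: \<mu>_def)
qed

lemma S_fun_on_constraint:
  assumes "I u = K u" shows "S_fun p \<beta> c \<gamma> F u = (1 / 2 - 1 / (p + 1)) * I u"
  using assms by (simp add: S_fun_def left_diff_distrib)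

lemma kappa_pos: "1 / 2 - 1 / (p + 1) > 0"
  using p by (simp add: field_simps)

lemma exists_constrained_minimiser: "\<exists>\<phi> g. XF \<phi> g \<and> nonzero \<phi> \<and> I \<phi> = \<mu> \<and> K \<phi> = \<mu>"
proof -
  obtain \<phi> g where \<phi>: "XF \<phi> g" "K \<phi> = 1" "I \<phi> = m" using exists_minimiser by blast
  define t where "t = m powr (1 / (p - 1))"
  have t: "t > 0" using m_pos by (simp add: t_def)
  have K: "K (\<lambda>x. t * \<phi> x) = \<mu>"
    unfolding K_fun_scale[OF t] \<phi>(2) unfolding t_def powr_powr \<mu>_def by simp
  have "t\<^sup>2 = m powr (2 / (p - 1))" unfolding t_def using m_pos by (simp add: powr_powr flip: powr_numeral)
  moreover have "2 / (p - 1) + 1 = (p + 1) / (p - 1)" using p by (simp add: field_simps)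
  ultimately have I: "I (\<lambda>x. t * \<phi> x) = \<mu>"
    unfolding I_fun_cmult[OF \<phi>(1)] \<phi>(3) \<mu>_def using m_pos powr_add[of m "2 / (p - 1)" 1] by simp
  have "nonzero (\<lambda>x. t * \<phi> x)"
    unfolding nonzero_def
  proof
    assume "AE x in lborel. t * \<phi> x = 0"
    then have "AE x in lborel. F (t * \<phi> x) = 0" by eventually_elim (simp only: F0)
    then have "(LINT x|lborel. F (t * \<phi> x)) = 0" by (rule integral_eq_zero_AE)
    then show False using K \<mu>_pos by (simp add: K_fun_def)
  qed
  then show ?thesis using XF_cmult[OF \<phi>(1)] K I by blast
qed

lemma solitary_P_fun:
  assumes "solitary \<beta> c \<gamma> f \<phi>" shows "I \<phi> = K \<phi>"
  using assms integral_f_self[of \<phi>] by (auto simp: solitary_iff I_fun_Bform)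

lemma minimiser_solitary:
  assumes "XF \<phi> g" "I \<phi> = \<mu>" "K \<phi> = \<mu>" shows "solitary \<beta> c \<gamma> f \<phi>"
  unfolding solitary_iff in_X_iff
  using Euler_Lagrange[OF assms(1)] assms \<mu>_pos \<mu>_eq by auto

lemma J_inf_eq: "J_inf p \<beta> c \<gamma> F = (1 / 2 - 1 / (p + 1)) * \<mu>"
  unfolding J_inf_def
proof (rule cInf_eq_minimum)
  obtain \<phi> g where \<phi>: "XF \<phi> g" "nonzero \<phi>" "I \<phi> = \<mu>" "K \<phi> = \<mu>" using exists_constrained_minimiser by blast
  then have "S_fun p \<beta> c \<gamma> F \<phi> = (1 / 2 - 1 / (p + 1)) * \<mu>" using S_fun_on_constraint[of \<phi>] by simp
  moreover have "in_X \<phi>" "P_fun p \<beta> c \<gamma> F \<phi> = 0" using \<phi> by (auto simp: in_X_iff P_fun_def)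
  ultimately show "(1 / 2 - 1 / (p + 1)) * \<mu> \<in> {S_fun p \<beta> c \<gamma> F u |u. in_X u \<and> nonzero u \<and> P_fun p \<beta> c \<gamma> F u = 0}"
    using \<phi>(2) by (intro CollectI exI[of _ \<phi>]) simp
next
  fix x assume "x \<in> {S_fun p \<beta> c \<gamma> F u |u. in_X u \<and> nonzero u \<and> P_fun p \<beta> c \<gamma> F u = 0}"
  then obtain u g where u: "x = S_fun p \<beta> c \<gamma> F u" "XF u g" "nonzero u" "I u = K u"
    by (auto simp: in_X_iff P_fun_def)
  show "(1 / 2 - 1 / (p + 1)) * \<mu> \<le> x"
    unfolding u(1) S_fun_on_constraint[OF u(4)] using kappa_pos \<mu>_le[OF u(2-4)] by (intro mult_left_mono) auto
qed

lemma ground_states_iff: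
  "\<phi> \<in> ground_states p \<beta> c \<gamma> f F \<longleftrightarrow>
     in_X \<phi> \<and> nonzero \<phi> \<and> P_fun p \<beta> c \<gamma> F \<phi> = 0 \<and> S_fun p \<beta> c \<gamma> F \<phi> = J_inf p \<beta> c \<gamma> F"
proof
  assume g: "\<phi> \<in> ground_states p \<beta> c \<gamma> f F"
  then have s: "solitary \<beta> c \<gamma> f \<phi>" and nz: "nonzero \<phi>"
    and le: "\<And>\<psi>. solitary \<beta> c \<gamma> f \<psi> \<Longrightarrow> nonzero \<psi> \<Longrightarrow> S_fun p \<beta> c \<gamma> F \<phi> \<le> S_fun p \<beta> c \<gamma> F \<psi>"
    by (auto simp: ground_states_def)
  have X: "in_X \<phi>" using s by (simp add: solitary_def)
  then obtain g where g: "XF \<phi> g" by (auto simp: in_X_iff)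
  note IK = solitary_P_fun[OF s]
  obtain \<psi> h where \<psi>: "XF \<psi> h" "nonzero \<psi>" "I \<psi> = \<mu>" "K \<psi> = \<mu>" using exists_constrained_minimiser by blast
  have "S_fun p \<beta> c \<gamma> F \<phi> \<le> S_fun p \<beta> c \<gamma> F \<psi>" by (rule le[OF minimiser_solitary[OF \<psi>(1,3,4)] \<psi>(2)])
  then have "(1 / 2 - 1 / (p + 1)) * I \<phi> \<le> (1 / 2 - 1 / (p + 1)) * \<mu>"
    using S_fun_on_constraint[OF IK] S_fun_on_constraint[of \<psi>] \<psi>(3,4) by simp
  then have "I \<phi> \<le> \<mu>" using kappa_pos by (simp only: mult_le_cancel_left_pos)
  then have "I \<phi> = \<mu>" using \<mu>_le[OF g nz IK] by simp
  then show "in_X \<phi> \<and> nonzero \<phi> \<and> P_fun p \<beta> c \<gamma> F \<phi> = 0 \<and> S_fun p \<beta> c \<gamma> F \<phi> = J_inf p \<beta> c \<gamma> F"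
    using X nz IK S_fun_on_constraint[OF IK] by (simp add: P_fun_def J_inf_eq)
next
  assume a: "in_X \<phi> \<and> nonzero \<phi> \<and> P_fun p \<beta> c \<gamma> F \<phi> = 0 \<and> S_fun p \<beta> c \<gamma> F \<phi> = J_inf p \<beta> c \<gamma> F"
  then obtain g where g: "XF \<phi> g" by (auto simp: in_X_iff)
  have IK: "I \<phi> = K \<phi>" using a by (simp add: P_fun_def)
  have S: "S_fun p \<beta> c \<gamma> F \<phi> = (1 / 2 - 1 / (p + 1)) * \<mu>" using a by (simp add: J_inf_eq)
  then have "I \<phi> = \<mu>" using S_fun_on_constraint[OF IK] kappa_pos p by auto
  then have "solitary \<beta> c \<gamma> f \<phi>" using minimiser_solitary[OF g] IK by simp
  moreover have "S_fun p \<beta> c \<gamma> F \<phi> \<le> S_fun p \<beta> c \<gamma> F \<psi>" if s: "solitary \<beta> c \<gamma> f \<psi>" "nonzero \<psi>" for \<psi>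
  proof -
    obtain h where h: "XF \<psi> h" using s(1) by (auto simp: solitary_def in_X_iff)
    note IK' = solitary_P_fun[OF s(1)]
    show ?thesis unfolding S S_fun_on_constraint[OF IK']
      using kappa_pos \<mu>_le[OF h s(2) IK'] by (intro mult_left_mono) auto
  qed
  ultimately show "\<phi> \<in> ground_states p \<beta> c \<gamma> f F" using a by (auto simp: ground_states_def)
qed

lemma ground_states_nonempty: "ground_states p \<beta> c \<gamma> f F \<noteq> {}"
proof -
  obtain \<phi> g where \<phi>: "XF \<phi> g" "nonzero \<phi>" "I \<phi> = \<mu>" "K \<phi> = \<mu>" using exists_constrained_minimiser by blast
  have "\<phi> \<in> ground_states p \<beta> c \<gamma> f F"
    unfolding ground_states_iff using \<phi> S_fun_on_constraint[of \<phi>] by (auto simp: in_X_iff P_fun_def J_inf_eq)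
  then show ?thesis by blast
qed

end

theorem theorem4p1:
  fixes p \<beta> c \<gamma> s0 :: real and f F f' f'' :: "real \<Rightarrow> real"
  assumes p: "p > 1"
    and f_C2: "\<And>s. (f has_real_derivative f' s) (at s)"
              "\<And>s. (f' has_real_derivative f'' s) (at s)"
              "continuous_on UNIV f''"
    and homog: "\<And>t s. t > 0 \<Longrightarrow> f (t * s) = t powr p * f s"
    and F_deriv: "\<And>s. (F has_real_derivative f s) (at s)"
    and F0: "F 0 = 0"
    and Fneg: "F s0 < 0"
    and beta: "\<beta> > 0" and gamma: "\<gamma> > 0"
    and c: "c < 3 * (\<beta>\<^sup>2 * \<gamma> / 4) powr (1/3)"
  shows "ground_states p \<beta> c \<gamma> f F \<noteq> {} \<and>
         (\<forall>\<phi>. in_X \<phi> \<longrightarrow>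
            (\<phi> \<in> ground_states p \<beta> c \<gamma> f F \<longleftrightarrow>
               nonzero \<phi> \<and> P_fun p \<beta> c \<gamma> F \<phi> = 0 \<and>
               S_fun p \<beta> c \<gamma> F \<phi> = J_inf p \<beta> c \<gamma> F))"
proof -
  interpret ground_state_problem \<beta> c \<gamma> p f F f' s0
    by unfold_locales (fact beta gamma c p f_C2(1) homog F_deriv F0 Fneg)+
  show ?thesis
    using ground_states_nonempty ground_states_iff by blast
qed

end
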